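(* Let $p>2$ be a prime, $\mathbf{F}$ a field of characteristic $p$, and $M\in\mathbf{F}^{2\times4}$. If $\gamma_{1234}(M)\neq0$, $\gamma_{1235}(M)=0$, $\gamma_{1357}(M)\neq0$ and $\gamma_{1245}(M)\neq0$, then, with $\widehat{f_1},h_2,h_3$ and $N_M(z)$ as defined in the context, the set $\mathcal B:=\{x,\widehat{f_1},h_2,h_3,N_M(z)\}$ is a SAGBI basis for $\mathbf{F}[V_M]^E$. Furthermore, $\mathbf{F}[V_M]^E$ is a complete intersection with generating relations coming from the subduction of the têtes-à-têtes $(h_2^p,\widehat{f_1}^{p+1})$ and $(h_3^p,\widehat{f_1}^{p^2-1}h_2^2)$.
   Context: For $M=(c_{ij})\in\mathbf{F}^{2\times4}$, $E=\langle e_1,e_2,e_3,e_4\rangle\cong(\mathbf{Z}/p)^4$ acts on $\mathbf{F}[V_M]=\mathbf{F}[x,y,z]$ (on the right, by algebra automorphisms) by $x\cdot e_j=x$, $y\cdot e_j=y+c_{1j}x$, $z\cdot e_j=z+2c_{1j}y+(c_{1j}^2+c_{2j})x$; $\mathbf{F}[V_M]^E$ is the ring of invariants. For $f\in\mathbf{F}[V_M]$, $N_M(f)$ is the product of the distinct elements of the $E$-orbit of $f$. Minors: $\Gamma(M)$ is the $10\times4$ matrix whose row $2k+1$ is $(c_{11}^{p^k},\dots,c_{14}^{p^k})$ and whose row $2k+2$ is $(c_{21}^{p^k},\dots,c_{24}^{p^k})$, $k=0,\dots,4$; $\gamma_{ijk\ell}(M)$ is its $4\times4$ minor with rows $i,j,k,\ell$,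 written $\bar\gamma_{ijk\ell}$. Put $\delta:=y^2-xz$. Under the hypotheses of the claim one has $\bar\gamma_{1345}\neq0$, and one defines $$\widehat{f_1}:=y^{p^2}+\frac{\bar\gamma_{1245}}{\bar\gamma_{1234}}y^px^{p^2-p}+\frac{\bar\gamma_{1345}}{\bar\gamma_{1234}}\delta x^{p^2-2}+\frac{\bar\gamma_{2345}}{\bar\gamma_{1234}}yx^{p^2-1},$$ $$\widetilde{h_2}:=N_M(y)-\widehat{f_1}^{p^2}+\alpha_1\widehat{f_1}^px^{p^4-p^3}+\alpha_2\widehat{f_1}^2x^{p^4-2p^2},\quad \alpha_1:=\frac{\bar\gamma_{1359}}{\bar\gamma_{1357}}+\frac{\bar\gamma_{1245}^{p^2}}{\bar\gamma_{1234}^{p^2}},\quad \alpha_2:=\frac{\bar\gamma_{1345}^{p^2}}{\bar\gamma_{1234}^{p^2}},$$ $$h_2:=\frac{\bar\gamma_{1234}^{p^2+1}\,\widetilde{h_2}}{2x^{p^4-p^2-p}\,\bar\gamma_{1345}^{p^2}\bar\gamma_{1245}},$$ $$\widetilde{h_3}:=\widehat{f_1}^{p+1}-h_2^p+\left(\frac{\bar\gamma_{1345}}{\bar\gamma_{1245}}\right)^p\widehat{f_1}^{p-2}h_2^2x^{p^2-2p},\qquad h_3:=\frac{\bar\gamma_{1245}^{p+1}\,\widetilde{h_3}}{2\bar\gamma_{1345}^{p+1}x^{p^2-p-2}}.$$ These are elements of $\mathbf{F}[V_M]^E$ with lead terms $y^{p^2}$, $y^{p^2+p}$, $y^{p^3+p+2}$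 for $\widehat{f_1},h_2,h_3$ respectively. Conventions: graded reverse lexicographic order with $x<y<z$; $\mathrm{LM}$, $\mathrm{LT}$ denote lead monomial and lead term (with coefficient). A finite subset $\mathcal B=\{b_1,\dots,b_m\}$ of a subalgebra $A$ of a polynomial ring is a SAGBI basis for $A$ if the monomials $\mathrm{LM}(b_i)$ generate the algebra spanned by the lead monomials of the elements of $A$. A tête-à-tête is a pair $(b^I,b^J)$ of products of elements of $\mathcal B$ with $\mathrm{LM}(b^I)=\mathrm{LM}(b^J)$. Its subduction: choose a scalar $c$ with $\mathrm{LT}(b^I)=\mathrm{LT}(cb^J)$ and repeatedly cancel the lead term of $b^I-cb^J$ by scalar multiples of products of elements of $\mathcal B$; if this ends at zero, it expresses $b^I-cb^J$ as a polynomial in $\mathcal B$, giving a relation. "Generating relations coming from the subduction of" given têtes-à-têtes means that the kernel of the surjection from the polynomial ring on $m$ variables sending the variables to $b_1,\dots,b_m$ is generated by the relations so obtained. A complete intersection is an algebra having a presentation whose ideal of relations is generated by a regular sequence. *)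

theory Defs
  imports
    "HOL-Library.Poly_Mapping"
    "HOL-Computational_Algebra.Primes"
    "HOL-Analysis.Determinants"
    "HOL-Algebra.Product_Groups"
    "HOL-Algebra.Group_Action"
begin

section \<open>Polynomials as finitely supported functions on monomials\<close>

text \<open>A polynomial maps each monomial \<open>'v \<Rightarrow>\<^sub>0 nat\<close> (its exponent vector) to its coefficient;
  multiplication is the convolution product of \<open>Poly_Mapping\<close>.\<close>

type_synonym 'v mon = "'v \<Rightarrow>\<^sub>0 nat"
type_synonym ('v, 'a) mpoly = "'v mon \<Rightarrow>\<^sub>0 'a"

definition Const :: "'a::zero \<Rightarrow> ('v, 'a) mpoly" where
  "Const c = Poly_Mapping.single 0 c"

definition Var :: "'v \<Rightarrow> ('v, 'a::{zero,one}) mpoly" where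
  "Var v = Poly_Mapping.single (Poly_Mapping.single v 1) 1"

definition mon_eval :: "('v \<Rightarrow> 'b::comm_semiring_1) \<Rightarrow> 'v mon \<Rightarrow> 'b" where
  "mon_eval s m = (\<Prod>v\<in>Poly_Mapping.keys m. s v ^ Poly_Mapping.lookup m v)"

definition subst ::
  "('v \<Rightarrow> ('w, 'a) mpoly) \<Rightarrow> ('v, 'a::comm_semiring_1) mpoly \<Rightarrow> ('w, 'a) mpoly" where
  "subst s f = (\<Sum>m\<in>Poly_Mapping.keys f. Const (Poly_Mapping.lookup f m) * mon_eval s m)"

text \<open>The exact quotient; unique for \<open>g \<noteq> 0\<close> in a domain, and unspecified if \<open>g\<close> does not
  divide \<open>f\<close>.\<close>

definition exact_div :: "'b::comm_ring_1 \<Rightarrow> 'b \<Rightarrow> 'b" where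
  "exact_div f g = (THE q. f = g * q)"

section \<open>Graded reverse lexicographic order, lead monomials, lead terms\<close>

definition total_degree :: "'v mon \<Rightarrow> nat" where
  "total_degree m = (\<Sum>v\<in>Poly_Mapping.keys m. Poly_Mapping.lookup m v)"

text \<open>In equal degree the comparison is decided at the smallest variable with differing exponents,
  and the larger exponent there gives the smaller monomial.\<close>

definition grevlex_less :: "'v::linorder mon \<Rightarrow> 'v mon \<Rightarrow> bool" where
  "grevlex_less m n \<longleftrightarrow>
     total_degree m < total_degree n \<or>
     total_degree m = total_degree n \<and>
       (\<exists>v. Poly_Mapping.lookup m v > Poly_Mapping.lookup n v \<and>
            (\<forall>u<v. Poly_Mapping.lookup m u = Poly_Mapping.lookup n u))"

text \<open>\<open>LM 0\<close> is unspecified.\<close>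

definition LM :: "('v::linorder, 'a::zero) mpoly \<Rightarrow> 'v mon" where
  "LM f = (THE m. m \<in> Poly_Mapping.keys f \<and>
             (\<forall>n\<in>Poly_Mapping.keys f. n \<noteq> m \<longrightarrow> grevlex_less n m))"

definition LT :: "('v::linorder, 'a::zero) mpoly \<Rightarrow> ('v, 'a) mpoly" where
  "LT f = Poly_Mapping.single (LM f) (Poly_Mapping.lookup f (LM f))"

section \<open>Subalgebras and SAGBI bases\<close>

definition is_subalgebra :: "('v, 'a::comm_ring_1) mpoly set \<Rightarrow> bool" where
  "is_subalgebra A \<longleftrightarrow> range Const \<subseteq> A \<and> (\<forall>f\<in>A. \<forall>g\<in>A. f + g \<in> A \<and> f * g \<in> A)"

definition lin_span :: "('v, 'a::comm_ring_1) mpoly set \<Rightarrow> ('v, 'a) mpoly set" where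
  "lin_span S = Modules.module.span (\<lambda>c f. Const c * f) S"

definition lead_monomials :: "('v::linorder, 'a::comm_ring_1) mpoly set \<Rightarrow> ('v, 'a) mpoly set" where
  "lead_monomials S = {Poly_Mapping.single (LM f) 1 | f. f \<in> S \<and> f \<noteq> 0}"

definition sagbi_basis ::
  "('v::linorder, 'a::comm_ring_1) mpoly set \<Rightarrow> ('v, 'a) mpoly set \<Rightarrow> bool" where
  "sagbi_basis B A \<longleftrightarrow>
     finite B \<and> B \<subseteq> A \<and> 0 \<notin> B \<and>
     is_subalgebra hull (lead_monomials B) = lin_span (lead_monomials A)"

section \<open>Presentations and complete intersections\<close>

text \<open>\<open>poly_ring n\<close> is \<open>F[T\<^sub>0, \<dots>, T\<^sub>n\<^sub>-\<^sub>1]\<close>, cut out of the polynomials in the variables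
  \<open>T\<^sub>i\<close>, \<open>i :: nat\<close>, so that the number of variables can be quantified over.\<close>

definition poly_ring :: "nat \<Rightarrow> (nat, 'a::zero) mpoly set" where
  "poly_ring n = {f. \<forall>m\<in>Poly_Mapping.keys f. Poly_Mapping.keys m \<subseteq> {..<n}}"

definition ideal_in :: "'b::comm_ring_1 set \<Rightarrow> 'b list \<Rightarrow> 'b set" where
  "ideal_in R rs = {(\<Sum>i<length rs. q i * rs ! i) | q. \<forall>i<length rs. q i \<in> R}"

definition regular_sequence :: "'b::comm_ring_1 set \<Rightarrow> 'b list \<Rightarrow> bool" where
  "regular_sequence R rs \<longleftrightarrow>
     set rs \<subseteq> R \<and>
     (\<forall>i<length rs. \<forall>g\<in>R. g * rs ! i \<in> ideal_in R (take i rs) \<longrightarrow> g \<in> ideal_in R (take i rs)) \<and>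
     ideal_in R rs \<noteq> R"

definition relations :: "('v, 'a::comm_ring_1) mpoly list \<Rightarrow> (nat, 'a) mpoly set" where
  "relations bs = {g \<in> poly_ring (length bs). subst (\<lambda>i. bs ! i) g = 0}"

definition ci_presentation ::
  "('v, 'a::comm_ring_1) mpoly set \<Rightarrow> ('v, 'a) mpoly list \<Rightarrow> (nat, 'a) mpoly list \<Rightarrow> bool" where
  "ci_presentation A bs rs \<longleftrightarrow>
     subst (\<lambda>i. bs ! i) ` poly_ring (length bs) = A \<and>
     relations bs = ideal_in (poly_ring (length bs)) rs \<and>
     regular_sequence (poly_ring (length bs)) rs"

definition complete_intersection :: "('v, 'a::comm_ring_1) mpoly set \<Rightarrow> bool" where
  "complete_intersection A \<longleftrightarrow> (\<exists>bs rs. ci_presentation A bs rs)"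

section \<open>Tete-a-tetes and subduction\<close>

text \<open>For a list \<open>bs\<close> and an exponent vector \<open>I\<close>, \<open>power_product bs I\<close> is the product of the
  \<open>bs ! i\<close> to the powers \<open>I i\<close>.\<close>

definition power_product :: "('v, 'a::comm_ring_1) mpoly list \<Rightarrow> nat mon \<Rightarrow> ('v, 'a) mpoly" where
  "power_product bs I = mon_eval (\<lambda>i. bs ! i) I"

definition tete_a_tete ::
  "('v::linorder, 'a::comm_ring_1) mpoly list \<Rightarrow> nat mon \<Rightarrow> nat mon \<Rightarrow> bool" where
  "tete_a_tete bs I J \<longleftrightarrow>
     Poly_Mapping.keys I \<subseteq> {..<length bs} \<and> Poly_Mapping.keys J \<subseteq> {..<length bs} \<and>
     LM (power_product bs I) = LM (power_product bs J)"

text \<open>\<open>subducts_to_zero bs f q\<close>: some chain of lead term cancellations takes \<open>f\<close> to zero, and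
  \<open>q\<close> collects the cancelled terms, so that \<open>f\<close> is the value of \<open>q\<close> at \<open>bs\<close>.\<close>

inductive subducts_to_zero ::
  "('v::linorder, 'a::comm_ring_1) mpoly list \<Rightarrow> ('v, 'a) mpoly \<Rightarrow> (nat, 'a) mpoly \<Rightarrow> bool"
  for bs where
  finish: "subducts_to_zero bs 0 0"
| cancel: "subducts_to_zero bs f (Poly_Mapping.single K a + q)"
  if "f \<noteq> 0" and "Poly_Mapping.keys K \<subseteq> {..<length bs}"
    and "LT f = LT (Const a * power_product bs K)"
    and "subducts_to_zero bs (f - Const a * power_product bs K) q"

definition subduction_relation ::
  "('v::linorder, 'a::comm_ring_1) mpoly list \<Rightarrow> nat mon \<Rightarrow> nat mon \<Rightarrow> (nat, 'a) mpoly \<Rightarrow> bool"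
  where
  "subduction_relation bs I J r \<longleftrightarrow>
     tete_a_tete bs I J \<and>
     (\<exists>c q. LT (power_product bs I) = LT (Const c * power_product bs J) \<and>
            subducts_to_zero bs (power_product bs I - Const c * power_product bs J) q \<and>
            r = Poly_Mapping.single I 1 - Poly_Mapping.single J c - q)"

section \<open>The representation and its invariants\<close>

datatype xyz = VX | VY | VZ

instantiation xyz :: linorder
begin

definition less_eq_xyz :: "xyz \<Rightarrow> xyz \<Rightarrow> bool" where
  "a \<le> b \<longleftrightarrow> a = VX \<or> a = b \<or> b = VZ"

definition less_xyz :: "xyz \<Rightarrow> xyz \<Rightarrow> bool" where
  "a < b \<longleftrightarrow> a \<le> b \<and> a \<noteq> (b :: xyz)"

instance
proof
  fix a b c :: xyz
  show "a < b \<longleftrightarrow> a \<le> b \<and> \<not> b \<le> a" "a \<le> a" "a \<le> b \<or> b \<le> a"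
    by (cases a; cases b; simp add: less_eq_xyz_def less_xyz_def)+
  show "a \<le> c" if "a \<le> b" "b \<le> c"
    using that by (cases a; cases b; cases c; simp add: less_eq_xyz_def)
  show "a = b" if "a \<le> b" "b \<le> a"
    using that by (cases a; cases b; simp add: less_eq_xyz_def)
qed

end

type_synonym 'a FV = "(xyz, 'a) mpoly"

abbreviation xv :: "'a::comm_ring_1 FV" where "xv \<equiv> Var VX"
abbreviation yv :: "'a::comm_ring_1 FV" where "yv \<equiv> Var VY"
abbreviation zv :: "'a::comm_ring_1 FV" where "zv \<equiv> Var VZ"

definition gen_act :: "'a::comm_ring_1 ^ 4 ^ 2 \<Rightarrow> 4 \<Rightarrow> 'a FV \<Rightarrow> 'a FV" where
  "gen_act M j = subst (\<lambda>v. case v of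
       VX \<Rightarrow> xv
     | VY \<Rightarrow> yv + Const (M $ 1 $ j) * xv
     | VZ \<Rightarrow> zv + Const (2 * M $ 1 $ j) * yv + Const ((M $ 1 $ j)\<^sup>2 + M $ 2 $ j) * xv)"

definition E_group :: "nat \<Rightarrow> (4 \<Rightarrow> int) monoid" where
  "E_group p = product_group UNIV (\<lambda>_. integer_mod_group p)"

text \<open>An element of \<open>E_group p\<close> is a vector \<open>a\<close> of residues \<open>a j \<in> {0..<p}\<close>, standing for the
  product of the \<open>e\<^sub>j\<close> to the powers \<open>a j\<close>; it acts through the generators.\<close>

definition E_act :: "'a::comm_ring_1 ^ 4 ^ 2 \<Rightarrow> (4 \<Rightarrow> int) \<Rightarrow> 'a FV \<Rightarrow> 'a FV" where
  "E_act M a f =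
     (gen_act M 4 ^^ nat (a 4)) ((gen_act M 3 ^^ nat (a 3))
       ((gen_act M 2 ^^ nat (a 2)) ((gen_act M 1 ^^ nat (a 1)) f)))"

definition invariant_ring :: "nat \<Rightarrow> 'a::comm_ring_1 ^ 4 ^ 2 \<Rightarrow> 'a FV set" where
  "invariant_ring p M = {f. \<forall>a\<in>carrier (E_group p). E_act M a f = f}"

definition orbit_prod :: "nat \<Rightarrow> 'a::comm_ring_1 ^ 4 ^ 2 \<Rightarrow> 'a FV \<Rightarrow> 'a FV" where
  "orbit_prod p M f = \<Prod>(orbit (E_group p) (E_act M) f)"

section \<open>Minors and the generating invariants\<close>

text \<open>Row \<open>i \<in> {1..10}\<close> of the \<open>10 \<times> 4\<close> matrix: \<open>i = 2k + 1\<close> and \<open>i = 2k + 2\<close> carry the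
  \<open>p\<^sup>k\<close>-th powers of the first and second row of \<open>M\<close>.\<close>

definition Gamma_row :: "nat \<Rightarrow> 'a::comm_ring_1 ^ 4 ^ 2 \<Rightarrow> nat \<Rightarrow> 'a ^ 4" where
  "Gamma_row p M i = (\<chi> j. (M $ (if odd i then 1 else 2) $ j) ^ (p ^ ((i - 1) div 2)))"

definition gamma :: "nat \<Rightarrow> 'a::comm_ring_1 ^ 4 ^ 2 \<Rightarrow> nat \<Rightarrow> nat \<Rightarrow> nat \<Rightarrow> nat \<Rightarrow> 'a" where
  "gamma p M i j k l =
     det (vector [Gamma_row p M i, Gamma_row p M j, Gamma_row p M k, Gamma_row p M l] :: 'a ^ 4 ^ 4)"

definition delta :: "'a::comm_ring_1 FV" where
  "delta = yv\<^sup>2 - xv * zv"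

definition f1_hat :: "nat \<Rightarrow> 'a::field ^ 4 ^ 2 \<Rightarrow> 'a FV" where
  "f1_hat p M =
     yv ^ (p\<^sup>2)
     + Const (gamma p M 1 2 4 5 / gamma p M 1 2 3 4) * yv ^ p * xv ^ (p\<^sup>2 - p)
     + Const (gamma p M 1 3 4 5 / gamma p M 1 2 3 4) * delta * xv ^ (p\<^sup>2 - 2)
     + Const (gamma p M 2 3 4 5 / gamma p M 1 2 3 4) * yv * xv ^ (p\<^sup>2 - 1)"

definition alpha1 :: "nat \<Rightarrow> 'a::field ^ 4 ^ 2 \<Rightarrow> 'a" where
  "alpha1 p M = gamma p M 1 3 5 9 / gamma p M 1 3 5 7
     + gamma p M 1 2 4 5 ^ (p\<^sup>2) / gamma p M 1 2 3 4 ^ (p\<^sup>2)"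

definition alpha2 :: "nat \<Rightarrow> 'a::field ^ 4 ^ 2 \<Rightarrow> 'a" where
  "alpha2 p M = gamma p M 1 3 4 5 ^ (p\<^sup>2) / gamma p M 1 2 3 4 ^ (p\<^sup>2)"

definition h2_tilde :: "nat \<Rightarrow> 'a::field ^ 4 ^ 2 \<Rightarrow> 'a FV" where
  "h2_tilde p M = orbit_prod p M yv - f1_hat p M ^ (p\<^sup>2)
     + Const (alpha1 p M) * f1_hat p M ^ p * xv ^ (p ^ 4 - p ^ 3)
     + Const (alpha2 p M) * f1_hat p M ^ 2 * xv ^ (p ^ 4 - 2 * p\<^sup>2)"

definition h2 :: "nat \<Rightarrow> 'a::field ^ 4 ^ 2 \<Rightarrow> 'a FV" where
  "h2 p M = exact_div
     (Const (gamma p M 1 2 3 4 ^ (p\<^sup>2 + 1)) * h2_tilde p M)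
     (Const (2 * gamma p M 1 3 4 5 ^ (p\<^sup>2) * gamma p M 1 2 4 5) * xv ^ (p ^ 4 - p\<^sup>2 - p))"

definition h3_tilde :: "nat \<Rightarrow> 'a::field ^ 4 ^ 2 \<Rightarrow> 'a FV" where
  "h3_tilde p M = f1_hat p M ^ (p + 1) - h2 p M ^ p
     + Const ((gamma p M 1 3 4 5 / gamma p M 1 2 4 5) ^ p)
       * f1_hat p M ^ (p - 2) * h2 p M ^ 2 * xv ^ (p\<^sup>2 - 2 * p)"

definition h3 :: "nat \<Rightarrow> 'a::field ^ 4 ^ 2 \<Rightarrow> 'a FV" where
  "h3 p M = exact_div
     (Const (gamma p M 1 2 4 5 ^ (p + 1)) * h3_tilde p M)
     (Const (2 * gamma p M 1 3 4 5 ^ (p + 1)) * xv ^ (p\<^sup>2 - p - 2))"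

end

theory Submission
  imports Defs "HOL-Number_Theory.Cong" "HOL-Computational_Algebra.Polynomial"
begin

text \<open>
  The hypotheses on the minors describe the group as follows. Since \<open>\<gamma>\<^sub>1\<^sub>3\<^sub>5\<^sub>7 \<noteq> 0\<close>, the first row of
  the matrix is linearly independent over the prime field, so its integral combinations form an
  additive group \<open>W\<close> with \<open>p\<^sup>4\<close> elements, and the Frobenius powers of the first row of orders
  \<open>0, \<dots>, 3\<close> form a basis. In this basis \<open>\<gamma>\<^sub>1\<^sub>2\<^sub>3\<^sub>5 = 0\<close> removes the last term of the second row, and the
  conditions \<open>\<gamma>\<^sub>1\<^sub>2\<^sub>3\<^sub>4 \<noteq> 0\<close>, \<open>\<gamma>\<^sub>1\<^sub>2\<^sub>4\<^sub>5 \<noteq> 0\<close> say that two others are nonzero. Hence the group acts by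
  \<open>y \<mapsto> y + wx\<close>, \<open>delta \<mapsto> delta - phi w x\<^sup>2\<close> for \<open>w \<in> W\<close>, where \<open>phi w = r0 w + r1 w\<^sup>p + r2 w\<^sup>q\<close>, \<open>q = p\<^sup>2\<close>,
  and the quotients of minors in the definitions are \<open>r1 / r2\<close>, \<open>1 / r2\<close> and \<open>r0 / r2\<close>
  (\<open>second_row\<close>).

  The generators have the lead monomials \<open>x\<close>, \<open>y\<^sup>a\<close>, \<open>y\<^sup>b\<close>, \<open>y\<^sup>c\<close>, \<open>z\<^sup>d\<close> with \<open>a = p\<^sup>2\<close>, \<open>b = p\<^sup>2 + p\<close>,
  \<open>c = p\<^sup>3 + p + 2\<close>, \<open>d = p\<^sup>4\<close>. The relations between these monomials come from \<open>p b = (p + 1) a\<close> and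
  \<open>p c = (p\<^sup>2 - 1) a + 2 b\<close>, and the products with exponents of \<open>h2\<close> and \<open>h3\<close> less than \<open>p\<close> have
  distinct lead monomials. If every lead monomial of an invariant is a product of these five, then
  all claims are formal: invariants subduct to zero, the relations from the two tete-a-tetes have the
  coprime lead terms \<open>T\<^sub>2\<^sup>p\<close> and \<open>T\<^sub>3\<^sup>p\<close> for a suitable order, division by them leaves reduced
  polynomials, and a reduced relation is zero (locale \<open>lead_generated\<close>).

  To find the lead monomials, observe first that \<open>f1\<close> is linear in \<open>z\<close> with a power of \<open>x\<close> as
  coefficient. Removing powers of \<open>z\<close> by means of \<open>f1\<close>, one sees that every invariant becomes a
  polynomial in \<open>x\<close>, \<open>f1\<close> and the norm of \<open>y\<close> after multiplication by a power of \<open>x\<close>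
  (\<open>localization\<close>), and the definition of \<open>h2\<close> expresses the norm of \<open>y\<close> by \<open>x\<close>, \<open>f1\<close>, \<open>h2\<close>. So it
  remains to divide by powers of \<open>x\<close>, which is harmless for a combination of products with
  distinct lead monomials (\<open>LM_Inv\<close>). Such combinations are reached by two relations. The first is
  the definition of \<open>h3\<close>. For the second one subducts the difference \<open>T\<close> of the two sides of the
  second tete-a-tete, where degrees control what can occur (\<open>T_descent\<close>). Suppose that a factor
  \<open>x\<^sup>k\<close> has been split off. The coefficient in \<open>T\<close> of the power of \<open>z\<close> of exponent \<open>p\<^sup>4\<close> is a multiple
  of the power of \<open>x\<close> of exponent \<open>p\<^sup>2 + 2p\<close>. Hence, for smaller \<open>k\<close>, the cofactor modulo \<open>x\<close> has
  degree less than \<open>p\<^sup>4\<close> in \<open>z\<close>; being invariant under the \<open>p\<^sup>4\<close> translations \<open>z \<mapsto> z + 2wy\<close>, it is a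
  multiple of some \<open>y\<^sup>n\<close>. Here \<open>n > p\<^sup>4\<close>, while the semigroup generated by \<open>a\<close>, \<open>b\<close>, \<open>c\<close> contains all
  numbers from \<open>p\<^sup>4\<close> on (\<open>semigroup_conductor\<close>), so a product of \<open>f1\<close>, \<open>h2\<close>, \<open>h3\<close> cancels it. When
  \<open>k\<close> reaches \<open>p\<^sup>2 + 2p\<close>, the cofactor is an invariant with lead monomial \<open>z\<^sup>d\<close>. It takes the place of
  the norm of \<open>z\<close> in the determination of the lead monomials, and afterwards the norm, which has the
  same lead monomial, may replace it.
\<close>

section \<open>Polynomials and their evaluation\<close>

abbreviation coef :: "('v, 'a::zero) mpoly \<Rightarrow> 'v mon \<Rightarrow> 'a"
  where "coef \<equiv> Poly_Mapping.lookup"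
abbreviation mons :: "('v, 'a::zero) mpoly \<Rightarrow> 'v mon set"
  where "mons \<equiv> Poly_Mapping.keys"
abbreviation expo :: "'v mon \<Rightarrow> 'v \<Rightarrow> nat"
  where "expo \<equiv> Poly_Mapping.lookup"
abbreviation sgl :: "'k \<Rightarrow> 'c::zero \<Rightarrow> 'k \<Rightarrow>\<^sub>0 'c"
  where "sgl \<equiv> Poly_Mapping.single"

lemma Const_0 [simp]: "Const 0 = 0"
  by (simp add: Const_def)

lemma Const_1 [simp]: "Const 1 = 1"
  by (simp add: Const_def)

lemma Const_add: "Const (a + b) = Const a + Const b"
  by (simp add: Const_def single_add)

lemma Const_minus: "Const (a - b) = Const a - Const (b :: 'a::comm_ring_1)"
  by (simp add: Const_def single_diff)

lemma Const_uminus: "Const (- b) = - Const (b :: 'a::comm_ring_1)"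
  by (simp add: Const_def single_uminus)

lemma Const_mult: "Const (a * b) = Const a * Const (b :: 'a::comm_semiring_1)"
  by (simp add: Const_def mult_single)

lemma Const_power: "Const (a ^ n) = Const (a :: 'a::comm_semiring_1) ^ n"
  by (induction n) (simp_all add: Const_mult)

lemma Const_numeral [simp]: "Const (numeral n) = numeral n"
  by (simp add: Const_def)

lemma Const_of_nat: "Const (of_nat n) = of_nat n"
  by (simp add: Const_def)

lemma Const_eq_0_iff [simp]: "Const a = 0 \<longleftrightarrow> a = 0"
  by (metis Const_def lookup_single_eq lookup_zero single_zero)

lemma single_eq_Const_mult: "sgl m c = Const c * sgl m (1 :: 'a::comm_semiring_1)"
  by (simp add: Const_def mult_single)

lemma poly_eq_sum_singles:
  fixes f :: "'k \<Rightarrow>\<^sub>0 'c::comm_monoid_add"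
  shows "f = (\<Sum>m\<in>Poly_Mapping.keys f. sgl m (Poly_Mapping.lookup f m))" (is "f = ?s")
proof (rule poly_mapping_eqI)
  fix k
  have "Poly_Mapping.lookup ?s k =
      (\<Sum>m\<in>Poly_Mapping.keys f. if m = k then Poly_Mapping.lookup f m else 0)"
    by (simp add: lookup_sum lookup_single when_def)
  also have "\<dots> = Poly_Mapping.lookup f k"
    by (simp add: in_keys_iff)
  finally show "Poly_Mapping.lookup f k = Poly_Mapping.lookup ?s k" by simp
qed

text \<open>Multiplication by a single term shifts coefficients; division by powers of \<open>x\<close> rests on
  this.\<close>

lemma coef_single_mult:
  fixes f :: "('v, 'a::comm_ring_1) mpoly"
  shows "coef (sgl k c * f) (k + m) = c * coef f m"
proof -
  have "sgl k c * f = (\<Sum>n\<in>mons f. sgl (k + n) (c * coef f n))"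
    by (subst poly_eq_sum_singles[of f]) (simp add: sum_distrib_left mult_single)
  then have "coef (sgl k c * f) (k + m) = (\<Sum>n\<in>mons f. if n = m then c * coef f n else 0)"
    by (simp add: lookup_sum lookup_single when_def)
  also have "\<dots> = c * coef f m"
    by (auto simp add: in_keys_iff)
  finally show ?thesis .
qed

lemma coef_Const_mult [simp]:
  fixes f :: "('v, 'a::comm_ring_1) mpoly"
  shows "coef (Const c * f) m = c * coef f m"
  using coef_single_mult[of 0 c f m] by (simp add: Const_def)

lemma mons_diff: "mons (f - g) \<subseteq> mons f \<union> mons (g :: ('v, 'a::ab_group_add) mpoly)"
  by (auto simp: in_keys_iff lookup_minus)

lemma mons_uminus [simp]: "mons (- f) = mons (f :: ('v, 'a::ab_group_add) mpoly)"
  by (auto simp: in_keys_iff)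

lemma mons_sum: "mons (\<Sum>i\<in>A. f i) \<subseteq> (\<Union>i\<in>A. mons (f i))"
  by (auto simp: in_keys_iff lookup_sum elim!: sum.not_neutral_contains_not_neutral)

lemma mons_Const_mult: "mons (Const c * f) \<subseteq> mons (f :: ('v, 'a::comm_ring_1) mpoly)"
  by (auto simp: in_keys_iff)

lemma sgl_mult_power: "sgl m (1::'a::comm_semiring_1) ^ k = sgl (\<Sum>i<k. m) 1"
  by (induction k) (simp_all add: mult_single add.commute)

lemma mons_eq_empty_iff [simp]: "mons f = {} \<longleftrightarrow> f = 0"
  by (metis all_not_in_conv in_keys_iff keys_zero lookup_zero poly_mapping_eqI)

lemma expo_add [simp]: "expo (m + n) v = expo m v + expo n v"
  by (rule lookup_add)

lemma mons_add_mon: "Poly_Mapping.keys (m + n) = Poly_Mapping.keys m \<union> Poly_Mapping.keys (n :: 'v mon)"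
  by (auto simp: in_keys_iff)

lemma mon_eval_superset:
  assumes "finite V" "Poly_Mapping.keys m \<subseteq> V"
  shows "mon_eval s m = (\<Prod>v\<in>V. s v ^ expo m v)"
  unfolding mon_eval_def by (rule prod.mono_neutral_left) (use assms in \<open>auto simp: in_keys_iff\<close>)

lemma mon_eval_add: "mon_eval s (m + n) = mon_eval s m * mon_eval s n"
  by (simp add: mon_eval_superset[of "Poly_Mapping.keys m \<union> Poly_Mapping.keys n"] mons_add_mon
      power_add prod.distrib)

lemma mon_eval_0 [simp]: "mon_eval s 0 = 1"
  by (simp add: mon_eval_def)

lemma mon_eval_single [simp]: "mon_eval s (sgl v k) = s v ^ k"
  by (cases "k = 0") (simp_all add: mon_eval_def)

text \<open>Evaluation with a coefficient map into an arbitrary commutative ring: \<^const>\<open>subst\<close> is the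
  case of polynomial values, while the values \<open>x = 1\<close> or \<open>x = 0\<close> give dehomogenization and
  reduction modulo \<open>x\<close>.\<close>

definition peval :: "('a::comm_ring_1 \<Rightarrow> 'b::comm_ring_1) \<Rightarrow> ('v \<Rightarrow> 'b) \<Rightarrow> ('v, 'a) mpoly \<Rightarrow> 'b"
  where "peval h s f = (\<Sum>m\<in>mons f. h (coef f m) * mon_eval s m)"

text \<open>Homomorphisms are plain functions, so that evaluation maps compose with the coefficient
  embeddings of several rings.\<close>

definition is_hom :: "('a::comm_ring_1 \<Rightarrow> 'b::comm_ring_1) \<Rightarrow> bool" where
  "is_hom h \<longleftrightarrow> h 1 = 1 \<and> (\<forall>a b. h (a + b) = h a + h b) \<and> (\<forall>a b. h (a * b) = h a * h b)"

lemma is_hom_0: "is_hom h \<Longrightarrow> h 0 = 0"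
  unfolding is_hom_def by (metis add.right_neutral add_left_cancel)

lemma is_hom_Const: "is_hom (Const :: 'a::comm_ring_1 \<Rightarrow> ('v, 'a) mpoly)"
  by (simp add: is_hom_def Const_add Const_mult)

lemma is_hom_sum: "is_hom h \<Longrightarrow> h (\<Sum>i\<in>A. f i) = (\<Sum>i\<in>A. h (f i))"
  by (induction A rule: infinite_finite_induct) (auto simp: is_hom_0 is_hom_def)

lemma is_hom_prod: "is_hom h \<Longrightarrow> h (\<Prod>i\<in>A. f i) = (\<Prod>i\<in>A. h (f i))"
  by (induction A rule: infinite_finite_induct) (auto simp: is_hom_def)

lemma is_hom_power: "is_hom h \<Longrightarrow> h (a ^ n) = h a ^ n"
  by (induction n) (auto simp: is_hom_def)

lemma is_hom_uminus: "is_hom h \<Longrightarrow> h (- a) = - h a"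
  using is_hom_0[of h] unfolding is_hom_def
  by (metis add.left_inverse add_eq_0_iff)

lemma is_hom_diff: "is_hom h \<Longrightarrow> h (a - b) = h a - h b"
  using is_hom_uminus[of h b] is_hom_def[of h] by (metis diff_conv_add_uminus)

lemma is_hom_mon_eval: "is_hom h \<Longrightarrow> h (mon_eval s m) = mon_eval (\<lambda>v. h (s v)) m"
  by (simp add: mon_eval_def is_hom_prod is_hom_power)

lemma peval_superset:
  assumes "is_hom h" "finite S" "mons f \<subseteq> S"
  shows "peval h s f = (\<Sum>m\<in>S. h (coef f m) * mon_eval s m)"
  unfolding peval_def
  by (rule sum.mono_neutral_left) (use assms in \<open>auto simp: in_keys_iff is_hom_0\<close>)

lemma peval_single [simp]: "is_hom h \<Longrightarrow> peval h s (sgl m c) = h c * mon_eval s m"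
  by (simp add: peval_superset[of h "{m}"])

lemma peval_add:
  assumes "is_hom h"
  shows "peval h s (f + g) = peval h s f + peval h s g"
proof -
  have "mons (f + g) \<subseteq> mons f \<union> mons g" by (rule Poly_Mapping.keys_add)
  then show ?thesis
    using assms by (simp add: peval_superset[OF assms, of "mons f \<union> mons g"] lookup_add
        is_hom_def distrib_right sum.distrib)
qed

lemma peval_0 [simp]: "peval h s 0 = 0"
  by (simp add: peval_def)

lemma peval_sum: "is_hom h \<Longrightarrow> peval h s (\<Sum>i\<in>A. f i) = (\<Sum>i\<in>A. peval h s (f i))"
  by (induction A rule: infinite_finite_induct) (auto simp: peval_add)

lemma peval_mult:
  assumes "is_hom h"
  shows "peval h s (f * g) = peval h s f * peval h s g"
proof -
  have "f * g = (\<Sum>m\<in>mons f. \<Sum>n\<in>mons g. sgl (m + n) (coef f m * coef g n))"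
    by (subst poly_eq_sum_singles[of f], subst poly_eq_sum_singles[of g])
       (simp add: sum_product mult_single)
  then have "peval h s (f * g) = (\<Sum>m\<in>mons f. \<Sum>n\<in>mons g.
      h (coef f m * coef g n) * mon_eval s (m + n))"
    using assms by (simp add: peval_sum)
  also have "\<dots> = peval h s f * peval h s g"
    using assms by (simp add: peval_def sum_product mon_eval_add is_hom_def mult_ac)
  finally show ?thesis .
qed

lemma peval_Const [simp]: "is_hom h \<Longrightarrow> peval h s (Const c) = h c"
  by (simp add: Const_def)

lemma peval_Var [simp]: "is_hom h \<Longrightarrow> peval h s (Var v) = s v"
  by (simp add: Var_def is_hom_def)

lemma is_hom_peval:
  assumes "is_hom h" shows "is_hom (peval h s)"
  using peval_Const[OF assms, of s 1] assms
  by (simp add: is_hom_def[of "peval h s"] peval_add peval_mult) (simp add: is_hom_def)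

lemma is_hom_comp_peval:
  assumes "is_hom g" "is_hom h"
  shows "g (peval h s f) = peval (\<lambda>a. g (h a)) (\<lambda>v. g (s v)) f"
proof -
  have "g (a * b) = g a * g b" for a b using assms by (simp add: is_hom_def)
  then show ?thesis using assms by (simp add: peval_def is_hom_sum is_hom_mon_eval)
qed

lemma subst_eq_peval: "subst s f = peval Const s (f :: ('v, 'a::comm_ring_1) mpoly)"
  by (simp add: subst_def peval_def)

lemma is_hom_subst:
  "is_hom (subst s :: ('v, 'a::comm_ring_1) mpoly \<Rightarrow> ('w, 'a) mpoly)"
  using is_hom_peval[OF is_hom_Const, of s] unfolding subst_eq_peval[abs_def] .

lemma subst_Const [simp]: "subst s (Const c) = Const (c :: 'a::comm_ring_1)"
  by (simp add: subst_eq_peval is_hom_Const)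

lemma subst_Var [simp]: "subst s (Var v) = (s v :: ('w, 'a::comm_ring_1) mpoly)"
  by (simp add: subst_eq_peval is_hom_Const)

lemmas subst_ring_simps =
  is_hom_sum[OF is_hom_subst] is_hom_prod[OF is_hom_subst] is_hom_power[OF is_hom_subst]
  is_hom_uminus[OF is_hom_subst] is_hom_diff[OF is_hom_subst] is_hom_0[OF is_hom_subst]

lemma subst_add: "subst s (f + g) = subst s f + subst s (g :: ('v, 'a::comm_ring_1) mpoly)"
  and subst_mult: "subst s (f * g) = subst s f * subst s g"
  and subst_1: "subst s 1 = (1 :: ('w, 'a) mpoly)"
  using is_hom_subst[of s] by (auto simp: is_hom_def)

lemma subst_single: "subst s (sgl m c) = Const c * mon_eval s (m :: 'v mon)"
  for c :: "'a::comm_ring_1"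
  by (simp add: subst_eq_peval is_hom_Const)

lemma peval_subst:
  assumes "is_hom h"
  shows "peval h t (subst s f) = peval h (\<lambda>v. peval h t (s v)) f"
  unfolding subst_eq_peval using assms
  by (simp add: is_hom_comp_peval is_hom_peval is_hom_Const)

lemma subst_subst:
  "subst t (subst s f) = subst (\<lambda>v. subst t (s v)) (f :: ('v, 'a::comm_ring_1) mpoly)"
  unfolding subst_eq_peval[of t] subst_eq_peval[of _ f]
  using is_hom_comp_peval[OF is_hom_peval[OF is_hom_Const] is_hom_Const, of t s f]
  by (simp add: is_hom_Const)

lemma mon_eval_Var: "mon_eval Var m = sgl m (1 :: 'a::comm_ring_1)"
proof -
  have "sgl (\<Sum>v\<in>V. sgl v (expo m v)) (1::'a) = (\<Prod>v\<in>V. Var v ^ expo m v)" if "finite V" for V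
    using that
  proof (induction V)
    case (insert v V)
    have "Var v ^ k = sgl (sgl v k) (1::'a)" for k :: nat
      by (induction k) (simp_all add: Var_def mult_single flip: single_add)
    with insert show ?case by (simp add: mult_single flip: insert.IH)
  qed simp
  from this[of "Poly_Mapping.keys m"] show ?thesis
    by (simp add: mon_eval_def flip: poly_eq_sum_singles)
qed

lemma subst_ident: "subst Var f = (f :: ('v, 'a::comm_ring_1) mpoly)"
  unfolding subst_def mon_eval_Var
  by (subst (3) poly_eq_sum_singles[of f]) (simp add: single_eq_Const_mult[of _ "coef f _"])

section \<open>Lead monomials for a monomial order\<close>

definition lead :: "('v mon \<Rightarrow> 'v mon \<Rightarrow> bool) \<Rightarrow> ('v, 'a::zero) mpoly \<Rightarrow> 'v mon \<Rightarrow> 'a \<Rightarrow> bool" where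
  "lead mless f m c \<longleftrightarrow> c \<noteq> 0 \<and> coef f m = c \<and> (\<forall>n\<in>mons f. n \<noteq> m \<longrightarrow> mless n m)"

text \<open>One of the orders below is total only on the monomials in the first five variables, so
  totality is a hypothesis of \<open>lead_exists\<close> on the monomials that occur.\<close>

locale mono_order =
  fixes mless :: "'v mon \<Rightarrow> 'v mon \<Rightarrow> bool"
  assumes irrefl: "\<not> mless m m"
    and trans: "mless m n \<Longrightarrow> mless n k \<Longrightarrow> mless m k"
    and transl: "mless m n \<Longrightarrow> mless (m + k) (n + k)"
begin

lemma lead_unique: "lead mless f m c \<Longrightarrow> lead mless f n d \<Longrightarrow> m = n \<and> c = d"
  unfolding lead_def by (metis in_keys_iff irrefl trans)

lemma lead_single: "c \<noteq> 0 \<Longrightarrow> lead mless (sgl m c) m c"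
  by (auto simp: lead_def)

lemma lead_lower:
  assumes "lead mless f m c" "\<And>n. n \<in> mons g \<Longrightarrow> mless n m"
  shows "lead mless (f + g) m c"
proof -
  have "coef g m = 0" using assms(2)[of m] irrefl by (auto simp: in_keys_iff)
  then show ?thesis
    using assms unfolding lead_def
    by (auto simp: lookup_add) (metis add.left_neutral in_keys_iff lookup_add)
qed

lemma lead_mult:
  fixes f g :: "('v, 'a::idom) mpoly"
  assumes f: "lead mless f m c" and g: "lead mless g n d"
  shows "lead mless (f * g) (m + n) (c * d)"
proof -
  \<comment> \<open>Every product of terms except that of the two lead terms lies strictly below.\<close>
  have lem: "mless (a + b) (m + n)" if "a \<in> mons f" "b \<in> mons g" "a \<noteq> m \<or> b \<noteq> n" for a b
  proof -
    have "a = m \<or> mless a m" "b = n \<or> mless b n"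
      using that f g by (auto simp: lead_def)
    moreover have "mless (a + b) (m + b)" if "mless a m" using transl[OF that] .
    moreover have "mless (m + b) (m + n)" if "mless b n"
      using transl[OF that, of m] by (simp add: add.commute)
    ultimately show ?thesis using that(3) trans[of "a + b" "m + b" "m + n"] by auto
  qed
  have eq: "f * g = (\<Sum>a\<in>mons f. \<Sum>b\<in>mons g. sgl (a + b) (coef f a * coef g b))"
    by (subst poly_eq_sum_singles[of f], subst poly_eq_sum_singles[of g])
       (simp add: sum_product mult_single)
  have mf: "m \<in> mons f" "n \<in> mons g" using f g by (auto simp: lead_def in_keys_iff)
  have "coef (f * g) (m + n) =
      (\<Sum>a\<in>mons f. \<Sum>b\<in>mons g. if a + b = m + n then coef f a * coef g b else 0)"
    unfolding eq by (simp add: lookup_sum lookup_single when_def)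
  also have "\<dots> = (\<Sum>a\<in>mons f. \<Sum>b\<in>mons g. if a = m then if b = n then c * d else 0 else 0)"
  proof (intro sum.cong refl)
    fix a b assume "a \<in> mons f" "b \<in> mons g"
    then show "(if a + b = m + n then coef f a * coef g b else 0) =
        (if a = m then if b = n then c * d else 0 else 0)"
      using lem[of a b] irrefl f g by (auto simp: lead_def)
  qed
  also have "\<dots> = (\<Sum>a\<in>mons f. if a = m then c * d else 0)"
    using mf by (intro sum.cong refl) (auto simp: sum.delta)
  also have "\<dots> = c * d" using mf by (simp add: sum.delta)
  finally have 1: "coef (f * g) (m + n) = c * d" .
  have "mless k (m + n)" if k: "k \<in> mons (f * g)" "k \<noteq> m + n" for k
  proof -
    obtain a b where "a \<in> mons f" "b \<in> mons g" "k = a + b"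
      using k(1) keys_mult[of f g] by auto
    then show ?thesis using lem[of a b] k(2) by auto
  qed
  then show ?thesis using 1 f g by (auto simp: lead_def)
qed

lemma lead_1: "lead mless (1 :: ('v, 'a::idom) mpoly) 0 1"
  using lead_single[of "1::'a" 0] by simp

lemma lead_power:
  fixes f :: "('v, 'a::idom) mpoly"
  assumes "lead mless f m c"
  shows "lead mless (f ^ k) (\<Sum>i<k. m) (c ^ k)"
proof (induction k)
  case (Suc k)
  then show ?case using lead_mult[OF assms Suc] by (simp add: add.commute)
qed (simp add: lead_1)

lemma lead_prod:
  fixes f :: "'i \<Rightarrow> ('v, 'a::idom) mpoly"
  assumes "\<And>i. i \<in> I \<Longrightarrow> lead mless (f i) (m i) (c i)"
  shows "lead mless (\<Prod>i\<in>I. f i) (\<Sum>i\<in>I. m i) (\<Prod>i\<in>I. c i)"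
  using assms
  by (induction I rule: infinite_finite_induct) (auto simp: lead_1 intro!: lead_mult)

lemma lead_exists:
  assumes "f \<noteq> 0"
    and total: "\<And>m n. m \<in> mons f \<Longrightarrow> n \<in> mons f \<Longrightarrow> m \<noteq> n \<Longrightarrow> mless m n \<or> mless n m"
  obtains m where "m \<in> mons f" "lead mless f m (coef f m)"
proof -
  have "\<exists>m\<in>S. \<forall>n\<in>S. n \<noteq> m \<longrightarrow> mless n m" if "finite S" "S \<noteq> {}" "S \<subseteq> mons f" for S
    using that
  proof (induction S rule: finite_ne_induct)
    case (insert a S)
    then obtain m where m: "m \<in> S" "\<forall>n\<in>S. n \<noteq> m \<longrightarrow> mless n m" by auto
    have "a \<noteq> m" using insert m by auto
    then consider "mless a m" | "mless m a" using total[of a m] insert m by auto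
    then show ?case
    proof cases
      case 1
      with m show ?thesis by auto
    next
      case 2
      have "mless n a" if "n \<in> S" for n
        using m 2 that trans[of n m a] by (cases "n = m") auto
      with m show ?thesis by auto
    qed
  qed simp
  from this[of "mons f"] obtain m where "m \<in> mons f" "\<forall>n\<in>mons f. n \<noteq> m \<longrightarrow> mless n m"
    using assms(1) by auto
  then show ?thesis using that[of m] by (auto simp: lead_def in_keys_iff)
qed

end

section \<open>The graded reverse lexicographic order\<close>

lemma total_degree_superset:
  assumes "finite V" "Poly_Mapping.keys m \<subseteq> V"
  shows "total_degree m = (\<Sum>v\<in>V. expo m v)"
  unfolding total_degree_def
  by (rule sum.mono_neutral_left) (use assms in \<open>auto simp: in_keys_iff\<close>)

lemma total_degree_add [simp]: "total_degree (m + n) = total_degree m + total_degree n"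
  by (simp add: total_degree_superset[of "Poly_Mapping.keys m \<union> Poly_Mapping.keys n"] mons_add_mon
      sum.distrib)

lemma total_degree_0 [simp]: "total_degree 0 = 0"
  by (simp add: total_degree_def)

lemma total_degree_single [simp]: "total_degree (sgl v k) = k"
  by (cases "k = 0") (simp_all add: total_degree_def)

lemma expo_le_total_degree: "expo m v \<le> total_degree m"
  by (cases "v \<in> Poly_Mapping.keys m")
     (auto simp: total_degree_def in_keys_iff intro: member_le_sum[of v _ "expo m"])

interpretation grevlex: mono_order "grevlex_less :: 'v::linorder mon \<Rightarrow> _"
proof
  fix m n k :: "'v mon"
  show "\<not> grevlex_less m m" by (simp add: grevlex_less_def)
  show "grevlex_less m n \<Longrightarrow> grevlex_less (m + k) (n + k)"
    by (auto simp: grevlex_less_def)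
  assume mn: "grevlex_less m n" and nk: "grevlex_less n k"
  show "grevlex_less m k"
  proof (cases "total_degree m < total_degree n \<or> total_degree n < total_degree k")
    case True
    then show ?thesis using mn nk by (auto simp: grevlex_less_def)
  next
    case False
    then have eq: "total_degree m = total_degree n" "total_degree n = total_degree k"
      using mn nk by (auto simp: grevlex_less_def)
    obtain v where v: "expo m v > expo n v" "\<forall>u<v. expo m u = expo n u"
      using mn eq by (auto simp: grevlex_less_def)
    obtain w where w: "expo n w > expo k w" "\<forall>u<w. expo n u = expo k u"
      using nk eq by (auto simp: grevlex_less_def)
    have "expo m (min v w) > expo k (min v w)"
      using v w by (cases v w rule: linorder_cases) (force simp: min_def)+
    moreover have "\<forall>u<min v w. expo m u = expo k u"
      using v w by simp
    ultimately show ?thesis using eq by (auto simp: grevlex_less_def)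
  qed
qed

lemma grevlex_total:
  fixes m n :: "'v::linorder mon"
  assumes "m \<noteq> n" shows "grevlex_less m n \<or> grevlex_less n m"
proof -
  define D where "D = {v. expo m v \<noteq> expo n v}"
  have "D \<subseteq> Poly_Mapping.keys m \<union> Poly_Mapping.keys n"
    by (auto simp: D_def in_keys_iff)
  then have "finite D" by (rule finite_subset) simp
  obtain v where "expo m v \<noteq> expo n v" using assms poly_mapping_eqI by metis
  then have "D \<noteq> {}" by (auto simp: D_def)
  then have "Min D \<in> D" using \<open>finite D\<close> by simp
  moreover have "\<forall>u<Min D. u \<notin> D"
    using Min_le[OF \<open>finite D\<close>] leD by blast
  ultimately have "\<exists>w. w \<in> D \<and> (\<forall>u<w. u \<notin> D)" by blast
  then obtain w where "w \<in> D" "\<forall>u<w. u \<notin> D" by blast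
  then have "expo m w \<noteq> expo n w" "\<forall>u<w. expo m u = expo n u"
    by (auto simp: D_def)
  then have "(\<exists>v. expo m v > expo n v \<and> (\<forall>u<v. expo m u = expo n u)) \<or>
      (\<exists>v. expo n v > expo m v \<and> (\<forall>u<v. expo n u = expo m u))"
    using linorder_neqE_nat[of "expo m w" "expo n w"] by metis
  then show ?thesis
    unfolding grevlex_less_def by (cases "total_degree m" "total_degree n" rule: linorder_cases) auto
qed

abbreviation glead :: "('v::linorder, 'a::zero) mpoly \<Rightarrow> 'v mon \<Rightarrow> 'a \<Rightarrow> bool"
  where "glead \<equiv> lead grevlex_less"

lemma LM_eqI: "glead f m c \<Longrightarrow> LM f = m"
  unfolding LM_def
proof (rule the_equality)
  assume l: "glead f m c"
  then show "m \<in> mons f \<and> (\<forall>n\<in>mons f. n \<noteq> m \<longrightarrow> grevlex_less n m)"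
    by (auto simp: lead_def in_keys_iff)
  fix k assume "k \<in> mons f \<and> (\<forall>n\<in>mons f. n \<noteq> k \<longrightarrow> grevlex_less n k)"
  then have "glead f k (coef f k)" by (auto simp: lead_def in_keys_iff)
  with l show "k = m" using grevlex.lead_unique by blast
qed

lemma glead_LM:
  assumes "f \<noteq> 0" shows "glead f (LM f) (coef f (LM f))"
proof -
  obtain m where "glead f m (coef f m)"
    using grevlex.lead_exists[OF assms] grevlex_total by blast
  then show ?thesis using LM_eqI by fastforce
qed

lemma LT_eqI: "glead f m c \<Longrightarrow> LT f = sgl m c"
  unfolding LT_def by (metis LM_eqI lead_def)

lemma glead_nonzero: "glead f m c \<Longrightarrow> f \<noteq> 0"
  by (auto simp: lead_def)

lemma finite_bounded_monomials:
  assumes "finite V"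
  shows "finite {m :: 'v mon. Poly_Mapping.keys m \<subseteq> V \<and> total_degree m \<le> n}"
proof (rule finite_imageD)
  let ?S = "{m :: 'v mon. Poly_Mapping.keys m \<subseteq> V \<and> total_degree m \<le> n}"
  have "expo ` ?S \<subseteq> {f. \<forall>v. (v \<in> V \<longrightarrow> f v \<in> {..n}) \<and> (v \<notin> V \<longrightarrow> f v = 0)}"
  proof clarify
    fix m :: "'v mon" and v
    assume "Poly_Mapping.keys m \<subseteq> V" "total_degree m \<le> n"
    then show "(v \<in> V \<longrightarrow> expo m v \<in> {..n}) \<and> (v \<notin> V \<longrightarrow> expo m v = 0)"
      using expo_le_total_degree[of m v] by (auto simp: in_keys_iff subset_iff)
  qed
  then show "finite (expo ` ?S)"
    by (rule finite_subset) (rule finite_set_of_finite_funs[OF assms], simp)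
  show "inj_on expo ?S" by (rule inj_onI) (rule poly_mapping_eqI, simp)
qed

text \<open>The number of elements below serves as a measure for induction.\<close>

lemma wf_finite_downsets:
  assumes irr: "\<And>x. x \<in> S \<Longrightarrow> \<not> R x x"
    and tr: "\<And>x y z. R x y \<Longrightarrow> R y z \<Longrightarrow> R x z"
    and fin: "\<And>x. x \<in> S \<Longrightarrow> finite {y\<in>S. R y x}"
  shows "wf {(x, y). x \<in> S \<and> y \<in> S \<and> R x y}"
proof (rule wf_subset[OF wf_measure[of "\<lambda>x. card {y\<in>S. R y x}"]], clarsimp)
  fix x y assume *: "x \<in> S" "y \<in> S" "R x y"
  have "{z \<in> S. R z x} \<subset> {z \<in> S. R z y}" using * irr tr by blast
  then show "card {z \<in> S. R z x} < card {z \<in> S. R z y}"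
    using fin[OF *(2)] by (rule psubset_card_mono[rotated])
qed

section \<open>Subalgebras, polynomial rings and ideals\<close>

lemma subalgebra_Const: "is_subalgebra A \<Longrightarrow> Const c \<in> A"
  by (auto simp: is_subalgebra_def)

lemma subalgebra_add: "is_subalgebra A \<Longrightarrow> f \<in> A \<Longrightarrow> g \<in> A \<Longrightarrow> f + g \<in> A"
  by (auto simp: is_subalgebra_def)

lemma subalgebra_mult: "is_subalgebra A \<Longrightarrow> f \<in> A \<Longrightarrow> g \<in> A \<Longrightarrow> f * g \<in> A"
  by (auto simp: is_subalgebra_def)

lemma subalgebra_0: "is_subalgebra A \<Longrightarrow> 0 \<in> A"
  using subalgebra_Const[of A 0] by simp

lemma subalgebra_1: "is_subalgebra A \<Longrightarrow> 1 \<in> A"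
  using subalgebra_Const[of A 1] by simp

lemma subalgebra_diff: "is_subalgebra A \<Longrightarrow> f \<in> A \<Longrightarrow> g \<in> A \<Longrightarrow> f - g \<in> A"
  using subalgebra_add[of A f "Const (- 1) * g"] subalgebra_mult[of A "Const (- 1)" g]
    subalgebra_Const[of A "- 1"]
  by (simp add: Const_uminus)

lemma subalgebra_power: "is_subalgebra A \<Longrightarrow> f \<in> A \<Longrightarrow> f ^ n \<in> A"
  by (induction n) (auto intro: subalgebra_1 subalgebra_mult)

lemma subalgebra_sum: "is_subalgebra A \<Longrightarrow> (\<And>i. i \<in> I \<Longrightarrow> f i \<in> A) \<Longrightarrow> sum f I \<in> A"
  by (induction I rule: infinite_finite_induct) (auto intro: subalgebra_0 subalgebra_add)

lemma subalgebra_prod: "is_subalgebra A \<Longrightarrow> (\<And>i. i \<in> I \<Longrightarrow> f i \<in> A) \<Longrightarrow> prod f I \<in> A"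
  by (induction I rule: infinite_finite_induct) (auto intro: subalgebra_1 subalgebra_mult)

lemma subalgebra_subst:
  assumes "is_subalgebra A" "\<And>v. (\<exists>m\<in>mons f. v \<in> Poly_Mapping.keys m) \<Longrightarrow> s v \<in> A"
  shows "subst s f \<in> A"
  unfolding subst_def mon_eval_def
  by (intro subalgebra_sum[OF assms(1)] subalgebra_mult[OF assms(1)] subalgebra_Const[OF assms(1)]
      subalgebra_prod[OF assms(1)] subalgebra_power[OF assms(1)]) (use assms(2) in blast)

lemma poly_ringD: "f \<in> poly_ring n \<Longrightarrow> m \<in> mons f \<Longrightarrow> Poly_Mapping.keys m \<subseteq> {..<n}"
  by (auto simp: poly_ring_def)

lemma poly_ring_single: "Poly_Mapping.keys m \<subseteq> {..<n} \<Longrightarrow> sgl m c \<in> poly_ring n"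
  by (auto simp: poly_ring_def)

text \<open>The ring of polynomials in the first \<open>n\<close> variables is handled as a subalgebra, so that the
  closure lemmas above serve for its elements and for invariants alike.\<close>

lemma poly_ring_subalgebra: "is_subalgebra (poly_ring n :: (nat, 'a::comm_ring_1) mpoly set)"
proof -
  have "f + g \<in> poly_ring n" "f * g \<in> poly_ring n"
    if fg: "f \<in> poly_ring n" "g \<in> poly_ring n" for f g :: "(nat, 'a) mpoly"
  proof -
    show "f + g \<in> poly_ring n"
      using fg Poly_Mapping.keys_add[of f g] unfolding poly_ring_def by blast
    show "f * g \<in> poly_ring n"
      unfolding poly_ring_def
    proof clarify
      fix m v assume "m \<in> mons (f * g)" "v \<in> Poly_Mapping.keys m"
      then obtain a b where "a \<in> mons f" "b \<in> mons g" "v \<in> Poly_Mapping.keys (a + b)"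
        using keys_mult[of f g] by blast
      then show "v < n" using fg[THEN poly_ringD] by (auto simp: mons_add_mon)
    qed
  qed
  then show ?thesis
    by (auto simp: is_subalgebra_def Const_def intro: poly_ring_single)
qed

lemma ideal_in_Nil: "ideal_in R [] = {0}"
  by (auto simp: ideal_in_def)

lemma ideal_in_single: "ideal_in R [r] = {a * r | a. a \<in> R}"
proof (intro equalityI subsetI)
  fix f assume "f \<in> {a * r | a. a \<in> R}"
  then obtain a where "a \<in> R" "f = a * r" by auto
  then show "f \<in> ideal_in R [r]"
    unfolding ideal_in_def by (intro CollectI exI[of _ "\<lambda>_. a"]) simp
qed (auto simp: ideal_in_def)

lemma ideal_in_pair: "ideal_in R [r, s] = {a * r + b * s | a b. a \<in> R \<and> b \<in> R}"
proof (intro equalityI subsetI)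
  fix f assume "f \<in> {a * r + b * s | a b. a \<in> R \<and> b \<in> R}"
  then obtain a b where "a \<in> R" "b \<in> R" "f = a * r + b * s" by auto
  then show "f \<in> ideal_in R [r, s]"
    unfolding ideal_in_def
    by (intro CollectI exI[of _ "\<lambda>i. if i = 0 then a else b"]) (simp add: numeral_2_eq_2)
next
  fix f assume "f \<in> ideal_in R [r, s]"
  then obtain q where q: "\<forall>i<Suc (Suc 0). q i \<in> R" "f = q 0 * r + q 1 * s"
    by (auto simp: ideal_in_def)
  then have "q 0 \<in> R" "q 1 \<in> R" by auto
  with q(2) show "f \<in> {a * r + b * s | a b. a \<in> R \<and> b \<in> R}" by blast
qed

lemma ideal_in_add:
  assumes "is_subalgebra R" "f \<in> ideal_in R rs" "g \<in> ideal_in R rs"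
  shows "f + g \<in> ideal_in R rs"
proof -
  obtain a b where "\<forall>i<length rs. a i \<in> R" "f = (\<Sum>i<length rs. a i * rs ! i)"
    "\<forall>i<length rs. b i \<in> R" "g = (\<Sum>i<length rs. b i * rs ! i)"
    using assms(2,3) unfolding ideal_in_def by blast
  then show ?thesis
    unfolding ideal_in_def using subalgebra_add[OF assms(1)]
    by (intro CollectI exI[of _ "\<lambda>i. a i + b i"]) (simp add: distrib_right sum.distrib)
qed

lemma ideal_in_mult:
  assumes "is_subalgebra R" "c \<in> R" "f \<in> ideal_in R rs"
  shows "c * f \<in> ideal_in R rs"
proof -
  obtain a where "\<forall>i<length rs. a i \<in> R" "f = (\<Sum>i<length rs. a i * rs ! i)"
    using assms(3) unfolding ideal_in_def by blast
  then show ?thesis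
    unfolding ideal_in_def using subalgebra_mult[OF assms(1,2)]
    by (intro CollectI exI[of _ "\<lambda>i. c * a i"]) (simp add: sum_distrib_left mult.assoc)
qed

lemma ideal_in_nth:
  assumes "is_subalgebra R" "i < length rs"
  shows "rs ! i \<in> ideal_in R rs"
proof -
  have "(\<Sum>j<length rs. (if j = i then 1 else 0) * rs ! j) = rs ! i"
    using assms(2) by (simp add: if_distrib[of "\<lambda>u. u * _"] sum.delta cong: if_cong)
  then show ?thesis
    unfolding ideal_in_def using subalgebra_0[OF assms(1)] subalgebra_1[OF assms(1)]
    by (intro CollectI exI[of _ "\<lambda>j. if j = i then 1 else 0"]) simp
qed

lemma ideal_in_0: "is_subalgebra R \<Longrightarrow> 0 \<in> ideal_in R rs"
  unfolding ideal_in_def by (intro CollectI exI[of _ "\<lambda>_. 0"]) (simp add: subalgebra_0)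

section \<open>The monoid of lead monomials\<close>

lemma xyz_UNIV: "(UNIV :: xyz set) = {VX, VY, VZ}"
  by (auto intro: xyz.exhaust)

instance xyz :: finite
  by standard (simp add: xyz_UNIV)

lemma xyz_all: "(\<forall>v. P v) \<longleftrightarrow> P VX \<and> P VY \<and> P VZ"
  by (metis xyz.exhaust)

lemma xyz_mon_eqI:
  "expo m VX = expo n VX \<Longrightarrow> expo m VY = expo n VY \<Longrightarrow> expo m VZ = expo n VZ \<Longrightarrow> m = n"
proof (rule poly_mapping_eqI)
  fix v assume "expo m VX = expo n VX" "expo m VY = expo n VY" "expo m VZ = expo n VZ"
  then show "expo m v = expo n v" by (cases v) auto
qed

lemma total_degree_xyz: "total_degree m = expo m VX + expo m VY + expo m VZ"
  using total_degree_superset[OF finite subset_UNIV, of m] by (simp add: xyz_UNIV)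

definition xyzm :: "nat \<Rightarrow> nat \<Rightarrow> nat \<Rightarrow> xyz mon" where
  "xyzm a i k = sgl VX a + sgl VY i + sgl VZ k"

lemma expo_xyzm [simp]:
  "expo (xyzm a i k) VX = a" "expo (xyzm a i k) VY = i" "expo (xyzm a i k) VZ = k"
  by (simp_all add: xyzm_def lookup_single)

lemma xyzm_expo [simp]: "xyzm (expo m VX) (expo m VY) (expo m VZ) = m"
  by (rule xyz_mon_eqI) simp_all

lemma xyzm_eq_iff [simp]: "xyzm a i k = xyzm b j l \<longleftrightarrow> a = b \<and> i = j \<and> k = l"
  by (metis expo_xyzm)

lemma xyzm_add: "xyzm a i k + xyzm b j l = xyzm (a + b) (i + j) (k + l)"
  by (rule xyz_mon_eqI) simp_all

lemma sgl_xyzm: "sgl VX a = xyzm a 0 0" "sgl VY a = xyzm 0 a 0" "sgl VZ a = xyzm 0 0 a"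
  by (simp_all add: xyzm_def)

lemma xyzm_0: "0 = xyzm 0 0 0"
  by (simp add: xyzm_def)

lemma sum_xyzm: "(\<Sum>i<n. xyzm a b c) = xyzm (n * a) (n * b) (n * c)"
  by (induction n) (simp_all add: xyzm_0 xyzm_add add.commute)

lemma total_degree_xyzm [simp]: "total_degree (xyzm a i k) = a + i + k"
  by (simp add: total_degree_xyz)

lemma grevlex_xyz:
  "grevlex_less m n \<longleftrightarrow> total_degree m < total_degree n \<or> total_degree m = total_degree n \<and>
     (expo m VX > expo n VX \<or> expo m VX = expo n VX \<and> expo m VY > expo n VY)"
proof -
  have lt: "(\<forall>u<VX. P u) \<longleftrightarrow> True" "(\<forall>u<VY. P u) \<longleftrightarrow> P VX" "(\<forall>u<VZ. P u) \<longleftrightarrow> P VX \<and> P VY" for P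
    by (auto simp: xyz_all less_xyz_def less_eq_xyz_def)
  have ex: "(\<exists>v. P v) \<longleftrightarrow> P VX \<or> P VY \<or> P VZ" for P :: "xyz \<Rightarrow> bool"
    by (metis xyz.exhaust)
  show ?thesis
    unfolding grevlex_less_def ex lt by (auto simp: total_degree_xyz)
qed

lemma wf_grevlex_xyz: "wf {(m, n :: xyz mon). grevlex_less m n}"
proof -
  have "finite {m \<in> UNIV. grevlex_less m n}" for n :: "xyz mon"
    by (rule finite_subset[OF _ finite_bounded_monomials[of UNIV "total_degree n"]])
       (auto simp: grevlex_less_def)
  from wf_finite_downsets[of UNIV grevlex_less, OF _ _ this] show ?thesis
    using grevlex.irrefl grevlex.trans by auto
qed

text \<open>\<open>Lam p K\<close> is the lead monomial of the product with exponent vector \<open>K\<close> of five polynomials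
  with lead monomials \<open>x\<close>, \<open>y\<^sup>a\<close>, \<open>y\<^sup>b\<close>, \<open>y\<^sup>c\<close>, \<open>z\<^sup>d\<close>, where \<open>a = p\<^sup>2\<close>, \<open>b = p\<^sup>2 + p\<close>,
  \<open>c = p\<^sup>3 + p + 2\<close> and \<open>d = p\<^sup>4\<close>.\<close>

definition Lam :: "nat \<Rightarrow> nat mon \<Rightarrow> xyz mon" where
  "Lam p K = xyzm (expo K 0)
     (p\<^sup>2 * expo K 1 + (p\<^sup>2 + p) * expo K 2 + (p ^ 3 + p + 2) * expo K 3) (p ^ 4 * expo K 4)"

lemma Lam_add: "Lam p (K + L) = Lam p K + Lam p L"
  by (simp add: Lam_def xyzm_add algebra_simps)

abbreviation supp5 :: "nat mon \<Rightarrow> bool"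
  where "supp5 K \<equiv> Poly_Mapping.keys K \<subseteq> {..<5}"

lemma lessThan_5: "{..<5} = {0, 1, 2, 3, 4 :: nat}"
  by auto

lemma supp5_eqI:
  assumes "supp5 K" "supp5 L" "\<And>i. i \<in> {0, 1, 2, 3, 4} \<Longrightarrow> expo K i = expo L i"
  shows "K = L"
proof (rule poly_mapping_eqI)
  fix i show "expo K i = expo L i"
  proof (cases "i < 5")
    case True
    then have "i \<in> {0, 1, 2, 3, 4}" by auto
    then show ?thesis using assms(3) by blast
  next
    case False
    then have "i \<notin> Poly_Mapping.keys K" "i \<notin> Poly_Mapping.keys L" using assms(1,2) by auto
    then show ?thesis by (simp add: in_keys_iff)
  qed
qed

lemma mod_double_inj:
  fixes p k l :: nat
  assumes "odd p" "k < p" "l < p" "[2 * k = 2 * l] (mod p)"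
  shows "k = l"
proof -
  have "coprime 2 p" using assms(1) by simp
  then have "[k = l] (mod p)" using assms(4) by (simp add: cong_mult_lcancel_nat)
  then show ?thesis using assms(2,3) by (simp add: cong_less_modulus_unique_nat)
qed

text \<open>Digits in base \<open>p\<close>: modulo \<open>p\<close> the value is \<open>2k\<close>, which fixes \<open>k\<close>; after division by \<open>p\<close>
  the rest is \<open>j\<close> modulo \<open>p\<close>.\<close>

lemma semigroup_unique:
  fixes p :: nat
  assumes "odd p" "p > 2" "j < p" "k < p" "j' < p" "k' < p"
    and eq: "p\<^sup>2 * i + (p\<^sup>2 + p) * j + (p ^ 3 + p + 2) * k =
      p\<^sup>2 * i' + (p\<^sup>2 + p) * j' + (p ^ 3 + p + 2) * k'"
  shows "i = i' \<and> j = j' \<and> k = k'"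
proof -
  have red: "(p\<^sup>2 * i + (p\<^sup>2 + p) * j + (p ^ 3 + p + 2) * k) mod p = (2 * k) mod p" for i j k
  proof -
    have "p\<^sup>2 * i + (p\<^sup>2 + p) * j + (p ^ 3 + p + 2) * k =
        2 * k + p * (p * i + (p + 1) * j + (p\<^sup>2 + 1) * k)"
      by (simp add: algebra_simps power2_eq_square power3_eq_cube)
    then show ?thesis by (metis mod_mult_self2)
  qed
  have k: "k = k'"
    using assms red[of i j k] red[of i' j' k'] by (intro mod_double_inj[of p]) (auto simp: cong_def)
  then have "p * (p * i + (p + 1) * j) = p * (p * i' + (p + 1) * j')"
    using eq by (simp add: algebra_simps power2_eq_square)
  then have e: "p * i + (p + 1) * j = p * i' + (p + 1) * j'" using assms(2) by simp
  have red2: "(p * i + (p + 1) * j) mod p = j mod p" for i j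
  proof -
    have "p * i + (p + 1) * j = j + p * (i + j)" by (simp add: algebra_simps)
    then show ?thesis by simp
  qed
  have j: "j = j'" using red2[of i j] red2[of i' j'] assms(3,5) unfolding e by simp
  with e k assms(2) show ?thesis by simp
qed

text \<open>The numerical semigroup generated by \<open>p\<^sup>2\<close>, \<open>p\<^sup>2 + p\<close>, \<open>p\<^sup>3 + p + 2\<close> has conductor
  \<open>p\<^sup>4 - 1\<close>, just below the bound used here: the residue modulo \<open>p\<close> fixes the number of summands of the last kind, then the next
  digit those of the second kind, and what remains is a multiple of \<open>p\<^sup>2\<close> exceeding \<open>- p\<^sup>2\<close>.\<close>

lemma semigroup_conductor:
  fixes p n :: nat
  assumes "odd p" "p > 2" "n \<ge> p ^ 4"
  obtains i j k where "n = p\<^sup>2 * i + (p\<^sup>2 + p) * j + (p ^ 3 + p + 2) * k" "j < p" "k < p"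
proof -
  have "coprime 2 p" using assms(1) by simp
  then obtain u where u: "[2 * u = 1] (mod p)" using cong_solve_coprime_nat[of 2 p] by auto
  define k where "k = (u * n) mod p"
  have kp: "k < p" using assms by (simp add: k_def)
  have "[2 * k = (2 * u) * n] (mod p)"
    unfolding k_def cong_def by (simp add: mod_mult_right_eq mult.assoc)
  also have "[(2 * u) * n = 1 * n] (mod p)" using u by (rule cong_scalar_right)
  finally have "[2 * k = n] (mod p)" by simp
  then have dv1: "int p dvd int n - 2 * int k"
    by (metis cong_iff_dvd_diff cong_int_iff cong_sym of_nat_mult of_nat_numeral)
  then obtain a where a: "int n - 2 * int k = int p * a" by auto
  define b where "b = a - (int p ^ 2 + 1) * int k"
  have nb: "int n = (int p ^ 3 + int p + 2) * int k + int p * b"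
    using a by (simp add: b_def algebra_simps power2_eq_square power3_eq_cube)
  define j where "j = nat (b mod int p)"
  have jp: "j < p" using assms by (simp add: j_def nat_less_iff)
  have jb: "int j = b mod int p" using assms by (simp add: j_def)
  define i where "i = b div int p - int j"
  have "b = int p * (b div int p) + int j" by (simp add: jb)
  then have bi: "b = int p * i + (int p + 1) * int j"
    by (simp add: i_def algebra_simps)
  have eq: "int n = int p ^ 2 * i + (int p ^ 2 + int p) * int j + (int p ^ 3 + int p + 2) * int k"
    unfolding nb bi by (simp add: algebra_simps power2_eq_square)
  have "i \<ge> 0"
  proof (rule ccontr)
    assume "\<not> i \<ge> 0"
    then have "int p ^ 2 * i \<le> int p ^ 2 * (- 1)" by (intro mult_left_mono) auto
    moreover have "(int p ^ 2 + int p) * int j \<le> (int p ^ 2 + int p) * (int p - 1)"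
      using jp by (intro mult_left_mono) auto
    moreover have "(int p ^ 3 + int p + 2) * int k \<le> (int p ^ 3 + int p + 2) * (int p - 1)"
      using kp by (intro mult_left_mono) auto
    ultimately have "int n \<le> int p ^ 2 * (- 1) + (int p ^ 2 + int p) * (int p - 1)
        + (int p ^ 3 + int p + 2) * (int p - 1)"
      using eq by linarith
    also have "\<dots> = int p ^ 4 - 2"
      by (simp add: algebra_simps power2_eq_square power3_eq_cube power4_eq_xxxx)
    finally show False using assms(3) by (simp flip: of_nat_power)
  qed
  then have "int n = int (p\<^sup>2 * nat i + (p\<^sup>2 + p) * j + (p ^ 3 + p + 2) * k)"
    unfolding eq using \<open>i \<ge> 0\<close> by (simp only: of_nat_add of_nat_mult of_nat_power nat_0_le of_nat_numeral)
  then show ?thesis using that[of "nat i" j k] jp kp by (simp only: of_nat_eq_iff)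
qed

text \<open>Exponent vectors divisible neither by \<open>T\<^sub>2\<^sup>p\<close> nor by \<open>T\<^sub>3\<^sup>p\<close>, the lead terms of the two
  relations.\<close>

definition reduced :: "nat \<Rightarrow> nat mon \<Rightarrow> bool" where
  "reduced p K \<longleftrightarrow> supp5 K \<and> expo K 2 < p \<and> expo K 3 < p"

lemma Lam_inj_reduced:
  assumes "odd p" "p > 2" "reduced p K" "reduced p L" "Lam p K = Lam p L"
  shows "K = L"
proof -
  from assms(5) have eq: "expo K 0 = expo L 0" "p ^ 4 * expo K 4 = p ^ 4 * expo L 4"
    "p\<^sup>2 * expo K 1 + (p\<^sup>2 + p) * expo K 2 + (p ^ 3 + p + 2) * expo K 3 =
     p\<^sup>2 * expo L 1 + (p\<^sup>2 + p) * expo L 2 + (p ^ 3 + p + 2) * expo L 3"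
    by (simp_all add: Lam_def del: One_nat_def)
  have "expo K 1 = expo L 1 \<and> expo K 2 = expo L 2 \<and> expo K 3 = expo L 3"
    by (rule semigroup_unique[OF assms(1,2) _ _ _ _ eq(3)]) (use assms in \<open>auto simp: reduced_def\<close>)
  moreover have "expo K 4 = expo L 4" using eq(2) assms(2) by simp
  ultimately show ?thesis
    using eq(1) assms(3,4) by (intro supp5_eqI) (auto simp: reduced_def)
qed

text \<open>The order used for dividing by relations. Both sides of a tete-a-tete have the same value
  under \<^const>\<open>Lam\<close>; the weight \<open>3 K\<^sub>3 + K\<^sub>2\<close> makes \<open>T\<^sub>2\<^sup>p\<close> and \<open>T\<^sub>3\<^sup>p\<close> the larger sides of
  the two that matter.\<close>

definition tless :: "nat \<Rightarrow> nat mon \<Rightarrow> nat mon \<Rightarrow> bool" where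
  "tless p K L \<longleftrightarrow> grevlex_less (Lam p K) (Lam p L) \<or> Lam p K = Lam p L \<and>
     (3 * expo K 3 + expo K 2 < 3 * expo L 3 + expo L 2 \<or>
      3 * expo K 3 + expo K 2 = 3 * expo L 3 + expo L 2 \<and> expo K 3 < expo L 3)"

interpretation tless: mono_order "tless p" for p
proof
  show "\<not> tless p m m" for m by (simp add: tless_def grevlex.irrefl)
  show "tless p (m + k) (n + k)" if "tless p m n" for m n k
    using that grevlex.transl[of "Lam p m" "Lam p n" "Lam p k"]
    by (auto simp: tless_def Lam_add)
  show "tless p m k" if "tless p m n" "tless p n k" for m n k
    using that grevlex.trans[of "Lam p m" "Lam p n" "Lam p k"] by (auto simp: tless_def)
qed

lemma tless_total:
  assumes "p > 0" "supp5 K" "supp5 L" "K \<noteq> L"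
  shows "tless p K L \<or> tless p L K"
proof (rule ccontr)
  assume n: "\<not> (tless p K L \<or> tless p L K)"
  then have lam: "Lam p K = Lam p L"
    using grevlex_total by (auto simp: tless_def)
  with n have "expo K 3 = expo L 3" "expo K 2 = expo L 2"
    by (auto simp: tless_def)
  moreover from lam have "expo K 0 = expo L 0" "p ^ 4 * expo K 4 = p ^ 4 * expo L 4"
    "p\<^sup>2 * expo K 1 + (p\<^sup>2 + p) * expo K 2 + (p ^ 3 + p + 2) * expo K 3 =
     p\<^sup>2 * expo L 1 + (p\<^sup>2 + p) * expo L 2 + (p ^ 3 + p + 2) * expo L 3"
    by (simp_all add: Lam_def del: One_nat_def)
  ultimately have "K = L" using assms by (intro supp5_eqI) auto
  with assms(4) show False by simp
qed

lemma supp5_degree_le_Lam: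
  assumes "p > 0" "supp5 K"
  shows "total_degree K \<le> total_degree (Lam p K)"
proof -
  have "total_degree K = expo K 0 + expo K 1 + expo K 2 + expo K 3 + expo K 4"
    using total_degree_superset[OF _ assms(2)] by (simp add: lessThan_5)
  moreover have "expo K 1 \<le> p\<^sup>2 * expo K 1" "expo K 2 \<le> (p\<^sup>2 + p) * expo K 2"
    "expo K 3 \<le> (p ^ 3 + p + 2) * expo K 3" "expo K 4 \<le> p ^ 4 * expo K 4"
    using assms(1) by simp_all
  ultimately have "total_degree K \<le> expo K 0 + (p\<^sup>2 * expo K 1 + (p\<^sup>2 + p) * expo K 2 +
      (p ^ 3 + p + 2) * expo K 3) + p ^ 4 * expo K 4"
    by linarith
  then show ?thesis by (simp add: Lam_def)
qed

text \<open>\<^const>\<open>Lam\<close> does not lower the total degree, so only finitely many exponent vectors lie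
  below a given one and division terminates.\<close>

lemma wf_tless:
  assumes "p > 0"
  shows "wf {(K, L). supp5 K \<and> supp5 L \<and> tless p K L}"
proof -
  have "finite {K \<in> Collect supp5. tless p K L}" for L
  proof (rule finite_subset[OF _ finite_bounded_monomials[of "{..<5}" "total_degree (Lam p L)"]])
    show "{K \<in> Collect supp5. tless p K L} \<subseteq>
        {K. supp5 K \<and> total_degree K \<le> total_degree (Lam p L)}"
    proof clarify
      fix K assume "supp5 K" "tless p K L"
      then have "total_degree (Lam p K) \<le> total_degree (Lam p L)"
        by (auto simp: tless_def grevlex_less_def)
      with supp5_degree_le_Lam[OF assms \<open>supp5 K\<close>]
      show "total_degree K \<le> total_degree (Lam p L)" by simp
    qed
  qed simp
  from wf_finite_downsets[of "Collect supp5" "tless p", OF _ _ this] show ?thesis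
    using tless.irrefl tless.trans by auto
qed

section \<open>Division by two relations\<close>

lemma reduction_step:
  fixes t :: "(nat, 'a::field) mpoly"
  assumes t: "t \<in> poly_ring 5" "lead (tless p) t I 1"
    and K: "supp5 K" "\<And>i. expo I i \<le> expo K i"
  obtains m where "m \<in> poly_ring 5" "\<And>L. L \<in> mons (sgl K 1 - m * t) \<Longrightarrow> supp5 L \<and> tless p L K"
proof -
  define K' where "K' = K - I"
  have KK: "K' + I = K"
    by (rule poly_mapping_eqI) (use K(2) in \<open>simp add: K'_def lookup_minus\<close>)
  have "Poly_Mapping.keys K' \<subseteq> Poly_Mapping.keys K"
    by (auto simp: in_keys_iff K'_def lookup_minus)
  with K(1) have supp: "supp5 K'" by blast
  have l: "lead (tless p) (sgl K' 1 * t) K 1"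
    using tless.lead_mult[OF tless.lead_single[where c = 1 and m = K'] t(2)] by (simp add: KK)
  have "supp5 L \<and> tless p L K" if "L \<in> mons (sgl K 1 - sgl K' 1 * t)" for L
  proof -
    have "sgl K' 1 * t \<in> poly_ring 5"
      using t(1) supp by (intro subalgebra_mult[OF poly_ring_subalgebra] poly_ring_single)
    moreover have "L \<in> mons (sgl K (1::'a)) \<union> mons (sgl K' 1 * t)"
      using that mons_diff by blast
    moreover have "L \<noteq> K" using that l by (auto simp: in_keys_iff lookup_minus lead_def)
    ultimately show ?thesis using l K(1) by (auto simp: lead_def dest: poly_ringD)
  qed
  then show ?thesis
    using poly_ring_single[OF supp] by (rule that[rotated])
qed

text \<open>Multivariate division, monomial by monomial: the set \<open>D\<close> of all sums of an element of the
  ideal and a remainder is closed under linear combinations, and it contains every monomial by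
  well-founded induction, since a reduction step leaves only smaller monomials.\<close>

lemma division:
  fixes rs :: "(nat, 'a::field) mpoly list"
  assumes p: "p > 0"
    and rs: "\<And>i. i < length rs \<Longrightarrow> rs ! i \<in> poly_ring 5 \<and> lead (tless p) (rs ! i) (I i) 1"
    and f: "f \<in> poly_ring 5"
  obtains c n where "c \<in> ideal_in (poly_ring 5) rs" "n \<in> poly_ring 5" "f = c + n"
    "\<And>K i. K \<in> mons n \<Longrightarrow> i < length rs \<Longrightarrow> \<exists>v. expo K v < expo (I i) v"
proof -
  note sub = poly_ring_subalgebra[of 5, where ?'a = 'a]
  let ?J = "ideal_in (poly_ring 5) rs"
  define N :: "(nat, 'a) mpoly set"
    where "N = {n \<in> poly_ring 5. \<forall>K\<in>mons n. \<forall>i<length rs. \<exists>v. expo K v < expo (I i) v}"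
  define D where "D = {c + n | c n. c \<in> ?J \<and> n \<in> N}"
  have N_add: "f + g \<in> N" if "f \<in> N" "g \<in> N" for f g
    using that subalgebra_add[OF sub, of f g] Poly_Mapping.keys_add[of f g]
    unfolding N_def by blast
  have N_scale: "Const c * f \<in> N" if "f \<in> N" for c f
    using that subalgebra_mult[OF sub subalgebra_Const[OF sub, of c], of f] mons_Const_mult[of c f]
    unfolding N_def by blast
  have N_0: "0 \<in> N" by (simp add: N_def subalgebra_0[OF sub])
  have D_N: "n \<in> D" if "n \<in> N" for n
    unfolding D_def using that ideal_in_0[OF sub] by force
  have D_J: "c \<in> D" if "c \<in> ?J" for c
    unfolding D_def using that N_0 by force
  have D_add: "f + g \<in> D" if fg: "f \<in> D" "g \<in> D" for f g
  proof -
    obtain a n b k where "a \<in> ?J" "n \<in> N" "f = a + n" "b \<in> ?J" "k \<in> N" "g = b + k"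
      using fg unfolding D_def by blast
    moreover from this have "f + g = (a + b) + (n + k)" by (simp add: algebra_simps)
    ultimately show ?thesis
      unfolding D_def using ideal_in_add[OF sub] N_add by blast
  qed
  have D_scale: "Const c * f \<in> D" if f: "f \<in> D" for c f
  proof -
    obtain a n where "a \<in> ?J" "n \<in> N" "f = a + n"
      using f unfolding D_def by blast
    moreover from this have "Const c * f = Const c * a + Const c * n" by (simp add: algebra_simps)
    ultimately show ?thesis
      unfolding D_def using ideal_in_mult[OF sub subalgebra_Const[OF sub]] N_scale by blast
  qed
  have D_mons: "f \<in> D" if "\<And>K. K \<in> mons f \<Longrightarrow> sgl K 1 \<in> D" for f
  proof -
    have sumD: "sum h S \<in> D" if "\<And>i. i \<in> S \<Longrightarrow> h i \<in> D" for h and S :: "nat mon set"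
      using that by (induction S rule: infinite_finite_induct) (auto intro: D_add D_N[OF N_0])
    have sglD: "sgl K (coef f K) \<in> D" if "K \<in> mons f" for K
      using D_scale[OF \<open>\<And>K. K \<in> mons f \<Longrightarrow> sgl K 1 \<in> D\<close>[OF that], of "coef f K"]
      by (simp only: single_eq_Const_mult[of K "coef f K"])
    show ?thesis
      by (subst poly_eq_sum_singles[of f]) (rule sumD, erule sglD)
  qed
  have D_base: "sgl K 1 \<in> D" if "supp5 K" for K
    using wf_tless[OF p] that
  proof (induction K rule: wf_induct_rule)
    case (less K)
    show ?case
    proof (cases "\<exists>i<length rs. \<forall>v. expo (I i) v \<le> expo K v")
      case True
      then obtain i where i: "i < length rs" "\<And>v. expo (I i) v \<le> expo K v" by blast
      obtain m where m: "m \<in> poly_ring 5"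
        "\<And>L. L \<in> mons (sgl K 1 - m * rs ! i) \<Longrightarrow> supp5 L \<and> tless p L K"
        using reduction_step[of "rs ! i" p "I i" K] rs[OF i(1)] less.prems i(2) by blast
      have "sgl K 1 - m * rs ! i \<in> D"
        by (rule D_mons) (use m(2) less in blast)
      moreover have "m * rs ! i \<in> D"
        by (intro D_J ideal_in_mult[OF sub m(1)] ideal_in_nth[OF sub i(1)])
      ultimately show ?thesis using D_add by fastforce
    next
      case False
      then have "sgl K 1 \<in> N"
        using less.prems by (auto simp: N_def not_le poly_ring_single)
      then show ?thesis by (rule D_N)
    qed
  qed
  have "f \<in> D" by (rule D_mons) (use f D_base poly_ringD in blast)
  then show ?thesis using that unfolding D_def N_def by blast
qed

text \<open>The lead monomials \<open>T\<^sub>2\<^sup>p\<close> and \<open>T\<^sub>3\<^sup>p\<close> are coprime: the lead monomial of \<open>n s\<close>, for a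
  remainder \<open>n \<noteq> 0\<close> modulo \<open>r\<close>, has the same exponent of \<open>T\<^sub>2\<close> as that of \<open>n\<close>, whereas
  multiples of \<open>r\<close> have an exponent of at least \<open>p\<close>.\<close>

lemma relations_regular:
  fixes r s :: "(nat, 'a::field) mpoly"
  assumes p: "p > 0"
    and r: "r \<in> poly_ring 5" "lead (tless p) r (sgl 2 p) 1"
    and s: "s \<in> poly_ring 5" "lead (tless p) s (sgl 3 p) 1"
    and g: "g \<in> poly_ring 5" "g * s \<in> ideal_in (poly_ring 5) [r]"
  shows "g \<in> ideal_in (poly_ring 5) [r]"
proof -
  note sub = poly_ring_subalgebra[of 5, where ?'a = 'a]
  have tot: "tless p m n \<or> tless p n m"
    if "f \<in> poly_ring 5" "m \<in> mons f" "n \<in> mons f" "m \<noteq> n" for f :: "(nat, 'a) mpoly" and m n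
    using tless_total[OF p] that poly_ringD by blast
  obtain c n where cn: "c \<in> ideal_in (poly_ring 5) [r]" "n \<in> poly_ring 5" "g = c + n"
    "\<And>K i. K \<in> mons n \<Longrightarrow> i < length [r] \<Longrightarrow> \<exists>v. expo K v < expo (sgl 2 p) v"
    by (rule division[of p "[r]" "\<lambda>_. sgl 2 p" g]) (use p r g(1) in \<open>auto simp: less_Suc_eq\<close>)
  then obtain a where a: "a \<in> poly_ring 5" "c = a * r" by (auto simp: ideal_in_single)
  have K2: "expo K 2 < p" if "K \<in> mons n" for K
    using cn(4)[OF that, of 0] by (auto simp: lookup_single when_def split: if_splits)
  note an = a(1) cn(2) cn(3)[unfolded a(2)] K2
  obtain h where h: "h \<in> poly_ring 5" "g * s = h * r"
    using g(2) by (auto simp: ideal_in_single)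
  define h' where "h' = h - a * s"
  have h': "h' \<in> poly_ring 5" "n * s = h' * r"
    using h an s r
    by (auto simp: h'_def algebra_simps intro!: subalgebra_diff[OF sub] subalgebra_mult[OF sub])
  have "n = 0"
  proof (rule ccontr)
    assume n0: "n \<noteq> 0"
    then obtain m where m: "m \<in> mons n" "lead (tless p) n m (coef n m)"
      using tless.lead_exists[OF n0, of p] tot[OF an(2)] by blast
    note ms = tless.lead_mult[OF m(2) s(2)]
    have "s \<noteq> 0" "r \<noteq> 0" using r(2) s(2) by (auto simp: lead_def)
    then have "h' \<noteq> 0" using h'(2) n0 by auto
    then obtain k where k: "lead (tless p) h' k (coef h' k)"
      using tless.lead_exists[of h' p] tot[OF h'(1)] by blast
    have "m + sgl 3 p = k + sgl 2 p"
      using tless.lead_unique[OF ms[unfolded h'(2)] tless.lead_mult[OF k r(2)]] by simp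
    then have "expo (m + sgl 3 p) 2 = expo (k + sgl 2 p) 2" by simp
    then show False using an(4)[OF m(1)] by (simp add: lookup_single)
  qed
  then show ?thesis using an by (auto simp: ideal_in_single)
qed

section \<open>SAGBI bases and presentations\<close>

lemma (in mono_order) lead_cancel:
  fixes f g :: "('v, 'a::ab_group_add) mpoly"
  assumes f: "lead mless f m c" and g: "lead mless g m c" and k: "k \<in> mons (f - g)"
  shows "mless k m"
proof -
  have "k \<noteq> m" using f g k by (auto simp: lead_def in_keys_iff lookup_minus)
  moreover have "k \<in> mons f \<or> k \<in> mons g" using k mons_diff[of f g] by blast
  ultimately show ?thesis using f g unfolding lead_def by blast
qed

lemma LM_in_mons: "f \<noteq> 0 \<Longrightarrow> LM f \<in> mons f"
  using glead_LM[of f] by (auto simp: lead_def in_keys_iff)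

text \<open>The lead terms are those described by \<^const>\<open>Lam\<close>. The lemmas are used twice: with the norm of
  \<open>z\<close> as the last generator, and before with another invariant of the same lead monomial.\<close>

locale lead_gens =
  fixes p :: nat and bs :: "'a::field FV list"
  assumes p_gt_2: "p > 2" and p_odd: "odd p" and len: "length bs = 5"
    and lead0: "glead (bs ! 0) (xyzm 1 0 0) 1"
    and lead1: "glead (bs ! 1) (xyzm 0 (p\<^sup>2) 0) 1"
    and lead2: "glead (bs ! 2) (xyzm 0 (p\<^sup>2 + p) 0) 1"
    and lead3: "glead (bs ! 3) (xyzm 0 (p ^ 3 + p + 2) 0) 1"
    and lead4: "glead (bs ! 4) (xyzm 0 0 (p ^ 4)) 1"
begin

lemma p_pos: "p > 0"
  using p_gt_2 by simp

abbreviation val :: "(nat, 'a) mpoly \<Rightarrow> 'a FV"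
  where "val \<equiv> subst (\<lambda>i. bs ! i)"

lemma value_single: "val (sgl K c) = Const c * power_product bs K"
  by (simp add: subst_single power_product_def)

lemma lead_power_product:
  assumes "supp5 K" shows "glead (power_product bs K) (Lam p K) 1"
proof -
  have eq: "power_product bs K = (\<Prod>i\<in>{..<5}. bs ! i ^ expo K i)"
    unfolding power_product_def by (rule mon_eval_superset) (use assms in auto)
  define lam where "lam i = (if i = 0 then xyzm 1 0 0 else if i = 1 then xyzm 0 (p\<^sup>2) 0
     else if i = 2 then xyzm 0 (p\<^sup>2 + p) 0 else if i = 3 then xyzm 0 (p ^ 3 + p + 2) 0
     else xyzm 0 0 (p ^ 4))" for i :: nat
  have "glead (bs ! i) (lam i) 1" if "i \<in> {..<5}" for i
    using that lead0 lead1 lead2 lead3 lead4 by (auto simp: lam_def lessThan_5)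
  then have "glead (bs ! i ^ expo K i) (\<Sum>j<expo K i. lam i) (1 ^ expo K i)" if "i \<in> {..<5}" for i
    using grevlex.lead_power that by blast
  then have "glead (power_product bs K) (\<Sum>i\<in>{..<5}. \<Sum>j<expo K i. lam i) (\<Prod>i\<in>{..<5}. 1 ^ expo K i)"
    unfolding eq by (rule grevlex.lead_prod)
  moreover have "(\<Sum>i\<in>{..<5}. \<Sum>j<expo K i. lam i) = Lam p K"
    unfolding lessThan_5 lam_def by (simp add: sum_xyzm xyzm_add Lam_def algebra_simps)
  ultimately show ?thesis by simp
qed

lemma lead_Const_power_product:
  assumes "supp5 K" "c \<noteq> 0" shows "glead (Const c * power_product bs K) (Lam p K) c"
  using grevlex.lead_mult[OF grevlex.lead_single[OF assms(2), of 0] lead_power_product[OF assms(1)]]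
  by (simp add: Const_def)

text \<open>Distinct reduced exponent vectors give distinct lead monomials, so nothing cancels at
  the top of a combination of reduced products.\<close>

lemma lead_value_reduced:
  assumes "n \<noteq> 0" "\<And>K. K \<in> mons n \<Longrightarrow> reduced p K"
  obtains K where "K \<in> mons n" "glead (val n) (Lam p K) (coef n K)"
proof -
  have tot: "tless p K L \<or> tless p L K" if "K \<in> mons n" "L \<in> mons n" "K \<noteq> L" for K L
    using that assms(2) by (intro tless_total[OF p_pos]) (auto simp: reduced_def)
  obtain K where K: "K \<in> mons n" "lead (tless p) n K (coef n K)"
    using tless.lead_exists[OF assms(1) tot] by blast
  define n' where "n' = n - sgl K (coef n K)"
  have red: "reduced p K" using assms(2) K(1) by blast
  have n: "n = sgl K (coef n K) + n'" by (simp add: n'_def)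
  have "grevlex_less m (Lam p K)" if m: "m \<in> mons (val n')" for m
  proof -
    obtain L where L: "L \<in> mons n'" "m \<in> mons (val (sgl L (coef n' L)))"
    proof -
      have "val n' = (\<Sum>L\<in>mons n'. val (sgl L (coef n' L)))"
        by (subst poly_eq_sum_singles[of n']) (simp add: subst_ring_simps)
      with m mons_sum[of "\<lambda>L. val (sgl L (coef n' L))" "mons n'"]
      show ?thesis using that by auto
    qed
    have "L \<noteq> K" "L \<in> mons n" using L(1)
      by (auto simp: n'_def in_keys_iff lookup_minus lookup_single when_def split: if_splits)
    then have "tless p L K" "Lam p L \<noteq> Lam p K"
      using K(2) Lam_inj_reduced[OF p_odd p_gt_2] assms(2) red by (auto simp: lead_def)
    then have less: "grevlex_less (Lam p L) (Lam p K)" by (auto simp: tless_def)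
    have "supp5 L" using assms(2)[OF \<open>L \<in> mons n\<close>] by (simp add: reduced_def)
    from lead_power_product[OF this] L(2) have "m = Lam p L \<or> grevlex_less m (Lam p L)"
      using mons_Const_mult[of _ "power_product bs L"] unfolding value_single lead_def by blast
    then show ?thesis using less grevlex.trans by blast
  qed
  moreover have "glead (val (sgl K (coef n K))) (Lam p K) (coef n K)"
    unfolding value_single using K(1) red
    by (intro lead_Const_power_product) (auto simp: reduced_def in_keys_iff)
  ultimately have "glead (val (sgl K (coef n K)) + val n') (Lam p K) (coef n K)"
    by (intro grevlex.lead_lower)
  then show ?thesis using that[OF K(1)] n by (metis subst_add)
qed

lemma reduced_value_0:
  assumes "val n = 0" "\<And>K. K \<in> mons n \<Longrightarrow> reduced p K"
  shows "n = 0"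
  using lead_value_reduced[OF _ assms(2)] assms(1) glead_nonzero by metis

text \<open>Two relations with the lead terms \<open>T\<^sub>2\<^sup>p\<close> and \<open>T\<^sub>3\<^sup>p\<close> suffice to write every polynomial in the
  generators as a combination of reduced products.\<close>

lemma reduced_representative:
  assumes r: "r \<in> poly_ring 5" "val r = 0" "lead (tless p) r (sgl 2 p) 1"
    and s: "s \<in> poly_ring 5" "val s = 0" "lead (tless p) s (sgl 3 p) 1"
    and f: "f \<in> poly_ring 5"
  obtains n where "n \<in> poly_ring 5" "val f = val n" "\<And>K. K \<in> mons n \<Longrightarrow> reduced p K"
    "f - n \<in> ideal_in (poly_ring 5) [r, s]"
proof -
  define I :: "nat \<Rightarrow> nat mon" where "I i = sgl (if i = 0 then 2 else 3) p" for i :: nat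
  obtain c n where cn: "c \<in> ideal_in (poly_ring 5) [r, s]" "n \<in> poly_ring 5" "f = c + n"
    "\<And>K i. K \<in> mons n \<Longrightarrow> i < length [r, s] \<Longrightarrow> \<exists>v. expo K v < expo (I i) v"
    by (rule division[of p "[r, s]" I f])
       (use p_pos r s f in \<open>auto simp: less_Suc_eq I_def\<close>)
  have "reduced p K" if "K \<in> mons n" for K
    using cn(4)[OF that, of 0] cn(4)[OF that, of 1] poly_ringD[OF cn(2) that]
    by (auto simp: reduced_def I_def lookup_single when_def split: if_splits)
  moreover have "val c = 0"
    using cn(1) r(2) s(2) by (auto simp: ideal_in_pair subst_add subst_mult)
  ultimately show ?thesis using that[of n] cn by (simp add: subst_add)
qed

end

text \<open>When the five lead monomials generate the lead monomials of all elements of \<open>A\<close>, every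
  element subducts to zero. A relation obtained from a tete-a-tete whose left side is the larger
  for \<^const>\<open>tless\<close> is led by that side.\<close>

locale lead_generated = lead_gens +
  fixes A :: "'a FV set"
  assumes subalgebra: "is_subalgebra A" and gens: "set bs \<subseteq> A"
    and LMs: "\<And>f. f \<in> A \<Longrightarrow> f \<noteq> 0 \<Longrightarrow> \<exists>K. supp5 K \<and> LM f = Lam p K"
begin

lemma value_mem: "q \<in> poly_ring 5 \<Longrightarrow> val q \<in> A"
  using len gens poly_ringD by (intro subalgebra_subst[OF subalgebra]) fastforce

lemma power_product_mem: "supp5 K \<Longrightarrow> power_product bs K \<in> A"
  using value_mem[of "sgl K 1"] by (simp add: value_single poly_ring_single)

text \<open>Cancelling the lead term by a product of generators stays in \<open>A\<close> and lowers the lead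
  monomial, and the order is well-founded.\<close>

lemma subduction_exists: "f \<in> A \<Longrightarrow> \<exists>q. subducts_to_zero bs f q"
proof (induction "LM f" arbitrary: f rule: wf_induct_rule[OF wf_grevlex_xyz])
  case (1 f)
  show ?case
  proof (cases "f = 0")
    case True
    then show ?thesis using subducts_to_zero.finish by blast
  next
    case False
    define c where "c = coef f (LM f)"
    have lf: "glead f (LM f) c" unfolding c_def by (rule glead_LM[OF False])
    obtain K where K: "supp5 K" "LM f = Lam p K" using LMs[OF 1(2) False] by blast
    have lk: "glead (Const c * power_product bs K) (LM f) c"
      unfolding K(2) by (rule lead_Const_power_product[OF K(1)]) (use lf in \<open>simp add: lead_def\<close>)
    let ?f = "f - Const c * power_product bs K"
    have mem: "?f \<in> A"
      using 1(2) power_product_mem[OF K(1)] subalgebra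
      by (intro subalgebra_diff subalgebra_mult subalgebra_Const)
    have "\<exists>q. subducts_to_zero bs ?f q"
    proof (cases "?f = 0")
      case True
      then show ?thesis using subducts_to_zero.finish by metis
    next
      case False
      then have "grevlex_less (LM ?f) (LM f)"
        by (intro grevlex.lead_cancel[OF lf lk] LM_in_mons)
      then show ?thesis using 1(1)[OF _ mem] by simp
    qed
    then obtain q where "subducts_to_zero bs ?f q" by blast
    moreover have "LT f = LT (Const c * power_product bs K)"
      using LT_eqI[OF lf] LT_eqI[OF lk] by simp
    ultimately show ?thesis
      using subducts_to_zero.cancel[OF False] K(1) len by metis
  qed
qed

text \<open>The lead monomials decrease along a subduction, so all products that it collects are
  bounded by the lead monomial at the start.\<close>

lemma subducts_value:
  assumes "subducts_to_zero bs f q"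
  shows "q \<in> poly_ring 5 \<and> val q = f \<and>
    (\<forall>K\<in>mons q. f \<noteq> 0 \<and> (Lam p K = LM f \<or> grevlex_less (Lam p K) (LM f)))"
  using assms
proof (induction rule: subducts_to_zero.induct)
  case finish
  show ?case by (simp add: subalgebra_0[OF poly_ring_subalgebra] subst_ring_simps)
next
  case (cancel f K a q)
  have K: "supp5 K" using cancel(2) len by simp
  have lf: "glead f (LM f) (coef f (LM f))" by (rule glead_LM[OF cancel(1)])
  have a: "a \<noteq> 0"
  proof
    assume "a = 0"
    then have "LT f = 0" using cancel(3) by (simp add: LT_def)
    then show False using LT_eqI[OF lf] lf
      by (metis lead_def lookup_single_eq lookup_zero)
  qed
  note lk = lead_Const_power_product[OF K a]
  have eq: "sgl (LM f) (coef f (LM f)) = sgl (Lam p K) a"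
    using cancel(3) LT_eqI[OF lf] LT_eqI[OF lk] by simp
  then have LMf: "LM f = Lam p K" "coef f (LM f) = a"
    using a by (metis keys_single lookup_single_eq singleton_inject lookup_zero keys_zero single_zero)+
  let ?f = "f - Const a * power_product bs K"
  have "Lam p L = LM f \<or> grevlex_less (Lam p L) (LM f)" if "L \<in> mons (sgl K a + q)" for L
  proof -
    consider "L = K" | "L \<in> mons q"
      using \<open>L \<in> mons (sgl K a + q)\<close> Poly_Mapping.keys_add[of "sgl K a" q]
      by (auto split: if_splits)
    then show ?thesis
    proof cases
      case 2
      then have f0: "?f \<noteq> 0" and le: "Lam p L = LM ?f \<or> grevlex_less (Lam p L) (LM ?f)"
        using cancel.IH by auto
      have "grevlex_less (LM ?f) (LM f)"
        using grevlex.lead_cancel[OF lf _ LM_in_mons[OF f0]] lk LMf by simp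
      then show ?thesis using le grevlex.trans by metis
    qed (simp add: LMf)
  qed
  moreover have "sgl K a + q \<in> poly_ring 5"
    using cancel.IH K by (intro subalgebra_add[OF poly_ring_subalgebra] poly_ring_single) auto
  moreover have "val (sgl K a + q) = f"
    using cancel.IH by (simp add: subst_add value_single)
  ultimately show ?case using cancel(1) by blast
qed

lemma subduction_relation_exists:
  assumes "supp5 I" "supp5 J" "Lam p I = Lam p J"
  shows "\<exists>r. subduction_relation bs I J r"
proof -
  have "power_product bs I - Const 1 * power_product bs J \<in> A"
    using power_product_mem assms subalgebra
    by (intro subalgebra_diff subalgebra_mult subalgebra_Const)
  then obtain q where "subducts_to_zero bs (power_product bs I - Const 1 * power_product bs J) q"
    using subduction_exists by blast
  moreover have "tete_a_tete bs I J"
    unfolding tete_a_tete_def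
    using assms len LM_eqI[OF lead_power_product] by simp
  moreover have "LT (power_product bs I) = LT (Const 1 * power_product bs J)"
    using LT_eqI[OF lead_power_product[OF assms(1)]] LT_eqI[OF lead_power_product[OF assms(2)]]
      assms(3) by simp
  ultimately show ?thesis unfolding subduction_relation_def by blast
qed

text \<open>Both products of a tete-a-tete are monic, which forces the scalar \<open>c\<close> to be one. The
  products collected by the subduction then lie strictly below the common lead monomial, so \<open>T\<^sup>I\<close>
  is the largest term of the relation, whichever subduction was chosen.\<close>

lemma subduction_relation_lead:
  assumes "subduction_relation bs I J r" and less: "tless p J I" "Lam p I = Lam p J"
  shows "r \<in> poly_ring 5 \<and> val r = 0 \<and> lead (tless p) r I 1"
proof -
  obtain c q where I: "supp5 I" "supp5 J"
    and LT: "LT (power_product bs I) = LT (Const c * power_product bs J)"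
    and q: "subducts_to_zero bs (power_product bs I - Const c * power_product bs J) q"
    and r: "r = sgl I 1 - sgl J c - q"
    using assms(1) len unfolding subduction_relation_def tete_a_tete_def by auto
  let ?f = "power_product bs I - Const c * power_product bs J"
  note lI = lead_power_product[OF I(1)]
  have "c \<noteq> 0"
  proof
    assume "c = 0"
    then have "LT (power_product bs I) = 0" using LT by (simp add: LT_def)
    then show False using LT_eqI[OF lI] by (metis lookup_single_eq lookup_zero zero_neq_one)
  qed
  note lJ = lead_Const_power_product[OF I(2) this]
  have "sgl (Lam p I) 1 = sgl (Lam p I) c"
    using LT LT_eqI[OF lI] LT_eqI[OF lJ] less(2) by simp
  then have c: "c = 1" by (metis lookup_single_eq)
  note q' = subducts_value[OF q]
  have "tless p K I" if "K \<in> mons q" for K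
  proof -
    have f0: "?f \<noteq> 0" and le: "Lam p K = LM ?f \<or> grevlex_less (Lam p K) (LM ?f)"
      using q' that by auto
    have "grevlex_less (LM ?f) (Lam p I)"
      using grevlex.lead_cancel[OF lI _ LM_in_mons[OF f0]] lJ less(2) c by simp
    then show ?thesis using le grevlex.trans unfolding tless_def by metis
  qed
  then have "tless p K I" if "K \<in> mons (- sgl J c - q)" for K
    using that mons_diff[of "- sgl J c" q] less(1) by (auto split: if_splits)
  then have "lead (tless p) (sgl I 1 + (- sgl J c - q)) I 1"
    by (intro tless.lead_lower tless.lead_single) auto
  moreover have "r = sgl I 1 + (- sgl J c - q)" by (simp add: r)
  moreover have "r \<in> poly_ring 5"
    unfolding r using I q' by (intro subalgebra_diff[OF poly_ring_subalgebra] poly_ring_single) auto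
  moreover have "val r = 0"
    using q' by (simp add: r subst_ring_simps value_single)
  ultimately show ?thesis by simp
qed

text \<open>Modulo the two relations every relation is equivalent to one with reduced terms, and a
  reduced relation vanishes because its terms have distinct lead monomials.\<close>

lemma presentation:
  assumes r: "r \<in> poly_ring 5" "val r = 0" "lead (tless p) r (sgl 2 p) 1"
    and s: "s \<in> poly_ring 5" "val s = 0" "lead (tless p) s (sgl 3 p) 1"
  shows "ci_presentation A bs [r, s]"
proof -
  have "val ` poly_ring 5 = A"
    using value_mem subduction_exists subducts_value by (auto simp: image_iff) metis
  moreover have rel: "relations bs = ideal_in (poly_ring 5) [r, s]"
  proof (intro equalityI subsetI)
    fix g assume "g \<in> relations bs"
    then have g: "g \<in> poly_ring 5" "val g = 0" by (auto simp: relations_def len)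
    obtain n where n: "n \<in> poly_ring 5" "val g = val n" "\<And>K. K \<in> mons n \<Longrightarrow> reduced p K"
      "g - n \<in> ideal_in (poly_ring 5) [r, s]"
      using reduced_representative[OF r s g(1)] by blast
    then show "g \<in> ideal_in (poly_ring 5) [r, s]"
      using reduced_value_0[of n] g(2) by simp
  next
    fix g assume "g \<in> ideal_in (poly_ring 5) [r, s]"
    then show "g \<in> relations bs"
      using r s unfolding relations_def ideal_in_pair len
      by (auto simp: subst_add subst_mult intro!: subalgebra_add[OF poly_ring_subalgebra]
          subalgebra_mult[OF poly_ring_subalgebra])
  qed
  moreover have "regular_sequence (poly_ring 5) [r, s]"
    unfolding regular_sequence_def
  proof (intro conjI allI impI ballI)
    show "set [r, s] \<subseteq> poly_ring 5" using r s by simp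
    have "1 \<notin> relations bs" by (simp add: relations_def subst_1)
    then show "ideal_in (poly_ring 5) [r, s] \<noteq> poly_ring 5"
      unfolding rel[symmetric] using subalgebra_1[OF poly_ring_subalgebra[of 5]] by metis
    fix i g assume i: "i < length [r, s]" and g: "g \<in> poly_ring 5"
      and gi: "g * [r, s] ! i \<in> ideal_in (poly_ring 5) (take i [r, s])"
    have "r \<noteq> 0" using r(3) by (auto simp: lead_def)
    consider "i = 0" | "i = 1" using i by fastforce
    then show "g \<in> ideal_in (poly_ring 5) (take i [r, s])"
    proof cases
      case 1
      then show ?thesis using gi \<open>r \<noteq> 0\<close> by (simp add: ideal_in_Nil)
    next
      case 2
      then show ?thesis using gi relations_regular[OF p_pos r(1,3) s(1,3) g] by simp
    qed
  qed
  ultimately show ?thesis unfolding ci_presentation_def len by simp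
qed

text \<open>The span of the lead monomials of \<open>A\<close> is itself a subalgebra, and each of these monomials
  is a product of those of the generators.\<close>

lemma sagbi: "sagbi_basis (set bs) A"
proof -
  interpret span: module "\<lambda>c f. Const c * f :: 'a FV"
    by standard (simp_all add: distrib_left distrib_right Const_add Const_mult mult.assoc)
  let ?L = "lead_monomials A"
  have span: "lin_span S = span.span S" for S by (simp add: lin_span_def)
  have "LM (1 :: 'a FV) = 0" by (rule LM_eqI[OF grevlex.lead_1])
  then have one: "sgl 0 1 \<in> ?L"
    unfolding lead_monomials_def
    by (intro CollectI exI[of _ "1 :: 'a FV"] conjI) (use subalgebra_1[OF subalgebra] in \<open>simp_all only: one_neq_zero not_False_eq_True\<close>)
  have mult: "f * g \<in> ?L" if fg: "f \<in> ?L" "g \<in> ?L" for f g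
  proof -
    obtain u v where uv: "u \<in> A" "u \<noteq> 0" "f = sgl (LM u) 1" "v \<in> A" "v \<noteq> 0" "g = sgl (LM v) 1"
      using fg unfolding lead_monomials_def by blast
    then have "f * g = sgl (LM (u * v)) 1"
      using LM_eqI[OF grevlex.lead_mult[OF glead_LM[OF uv(2)] glead_LM[OF uv(5)]]]
      by (simp add: mult_single)
    then show ?thesis
      unfolding lead_monomials_def using uv subalgebra_mult[OF subalgebra, of u v]
      by (intro CollectI exI[of _ "u * v"]) simp
  qed
  have mult1: "f * g \<in> span.span ?L" if "f \<in> ?L" "g \<in> span.span ?L" for f g
    using that(2)
  proof (induction rule: span.span_induct_alt)
    case (step c h k)
    have "f * (Const c * h + k) = Const c * (f * h) + f * k" by (simp add: algebra_simps)
    then show ?case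
      using step mult[OF that(1)] by (simp add: span.span_add span.span_scale span.span_base)
  qed (simp add: span.span_zero)
  have mult2: "f * g \<in> span.span ?L" if "f \<in> span.span ?L" "g \<in> span.span ?L" for f g
    using that(1)
  proof (induction rule: span.span_induct_alt)
    case (step c h k)
    have "(Const c * h + k) * g = Const c * (h * g) + k * g" by (simp add: algebra_simps)
    then show ?case
      using step mult1[OF _ that(2)] by (simp add: span.span_add span.span_scale)
  qed (simp add: span.span_zero)
  have sub: "is_subalgebra (span.span ?L)"
    unfolding is_subalgebra_def
  proof (intro conjI ballI)
    show "range Const \<subseteq> span.span ?L"
      using span.span_scale[OF span.span_base[OF one]] by (auto simp: Const_def)
  qed (auto intro: span.span_add mult2)
  have "lead_monomials (set bs) \<subseteq> span.span ?L"
    using gens by (auto simp: lead_monomials_def intro!: span.span_base)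
  then have le: "is_subalgebra hull (lead_monomials (set bs)) \<subseteq> span.span ?L"
    using sub by (intro hull_minimal)
  have ge: "?L \<subseteq> H" if H: "is_subalgebra H" "lead_monomials (set bs) \<subseteq> H" for H
  proof
    fix u assume "u \<in> ?L"
    then obtain f where f: "f \<in> A" "f \<noteq> 0" "u = sgl (LM f) 1"
      by (auto simp: lead_monomials_def)
    then obtain K where K: "supp5 K" "LM f = Lam p K" using LMs by blast
    have Hi: "sgl (LM (bs ! i)) 1 \<in> H" if "i < 5" for i
    proof -
      have "bs ! i \<noteq> 0"
      proof -
        have "i \<in> {0, 1, 2, 3, 4}" using that by auto
        then show ?thesis
          using lead0 lead1 lead2 lead3 lead4 by (auto dest: glead_nonzero)
      qed
      moreover have "bs ! i \<in> set bs" using that len by simp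
      ultimately show ?thesis using H(2) unfolding lead_monomials_def by blast
    qed
    have "sgl (xyzm 1 0 0) 1 \<in> H" "sgl (xyzm 0 (p\<^sup>2) 0) 1 \<in> H" "sgl (xyzm 0 (p\<^sup>2 + p) 0) 1 \<in> H"
      "sgl (xyzm 0 (p ^ 3 + p + 2) 0) 1 \<in> H" "sgl (xyzm 0 0 (p ^ 4)) 1 \<in> H"
      using LM_eqI[OF lead0] LM_eqI[OF lead1] LM_eqI[OF lead2] LM_eqI[OF lead3] LM_eqI[OF lead4]
        Hi[of 0] Hi[of 1] Hi[of 2] Hi[of 3] Hi[of 4] by simp_all
    then have "sgl (xyzm 1 0 0) 1 ^ expo K 0 * sgl (xyzm 0 (p\<^sup>2) 0) 1 ^ expo K 1 *
        sgl (xyzm 0 (p\<^sup>2 + p) 0) 1 ^ expo K 2 * sgl (xyzm 0 (p ^ 3 + p + 2) 0) 1 ^ expo K 3 *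
        sgl (xyzm 0 0 (p ^ 4)) 1 ^ expo K 4 \<in> H"
      by (intro subalgebra_mult[OF H(1)] subalgebra_power[OF H(1)])
    also have "sgl (xyzm 1 0 0) 1 ^ expo K 0 * sgl (xyzm 0 (p\<^sup>2) 0) 1 ^ expo K 1 *
        sgl (xyzm 0 (p\<^sup>2 + p) 0) 1 ^ expo K 2 * sgl (xyzm 0 (p ^ 3 + p + 2) 0) 1 ^ expo K 3 *
        sgl (xyzm 0 0 (p ^ 4)) 1 ^ expo K 4 = sgl (Lam p K) (1 :: 'a)"
      by (simp add: sgl_mult_power sum_xyzm mult_single xyzm_add Lam_def algebra_simps)
    finally show "u \<in> H" using f K by simp
  qed
  have "span.span ?L \<subseteq> H" if H: "is_subalgebra H" "lead_monomials (set bs) \<subseteq> H" for H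
  proof
    fix f assume "f \<in> span.span ?L"
    then show "f \<in> H"
    proof (induction rule: span.span_induct_alt)
      case (step c h k)
      then show ?case using ge[OF H] subalgebra_add[OF H(1)] subalgebra_mult[OF H(1)]
          subalgebra_Const[OF H(1)] by blast
    qed (simp add: subalgebra_0[OF H(1)])
  qed
  then have "span.span ?L \<subseteq> is_subalgebra hull (lead_monomials (set bs))"
    by (auto simp: hull_def)
  with le have "is_subalgebra hull (lead_monomials (set bs)) = lin_span ?L"
    unfolding span by blast
  moreover have "0 \<notin> set bs"
  proof
    assume "0 \<in> set bs"
    then obtain i where "i < 5" "bs ! i = 0" using len by (metis in_set_conv_nth)
    then have "i \<in> {0, 1, 2, 3, 4}" by auto
    then show False
      using \<open>bs ! i = 0\<close> lead0 lead1 lead2 lead3 lead4 by (auto dest: glead_nonzero)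
  qed
  ultimately show ?thesis using gens by (simp add: sagbi_basis_def)
qed

end

section \<open>Homogeneous polynomials and divisibility by x\<close>

definition hom_deg :: "nat \<Rightarrow> ('v, 'a::zero) mpoly \<Rightarrow> bool" where
  "hom_deg n f \<longleftrightarrow> (\<forall>m\<in>mons f. total_degree m = n)"

lemma hom_deg_add: "hom_deg n f \<Longrightarrow> hom_deg n g \<Longrightarrow> hom_deg n (f + g)"
  using Poly_Mapping.keys_add[of f g] by (auto simp: hom_deg_def)

lemma hom_deg_diff: "hom_deg n f \<Longrightarrow> hom_deg n g \<Longrightarrow> hom_deg n (f - g)"
  for f g :: "('v, 'a::ab_group_add) mpoly"
  using mons_diff[of f g] by (auto simp: hom_deg_def)

lemma hom_deg_sum: "(\<And>i. i \<in> I \<Longrightarrow> hom_deg n (f i)) \<Longrightarrow> hom_deg n (sum f I)"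
  using mons_sum[of f I] by (auto simp: hom_deg_def)

lemma hom_deg_mult: "hom_deg n f \<Longrightarrow> hom_deg k g \<Longrightarrow> hom_deg (n + k) (f * g)"
  for f g :: "('v, 'a::comm_ring_1) mpoly"
proof -
  assume fg: "hom_deg n f" "hom_deg k g"
  show ?thesis
    unfolding hom_deg_def
  proof
    fix m assume "m \<in> mons (f * g)"
    then obtain a b where "a \<in> mons f" "b \<in> mons g" "m = a + b"
      using keys_mult[of f g] by blast
    then show "total_degree m = n + k" using fg by (simp add: hom_deg_def)
  qed
qed

lemma hom_deg_Const [simp]: "hom_deg 0 (Const c)"
  by (simp add: hom_deg_def Const_def)

lemma hom_deg_1 [simp]: "hom_deg 0 (1 :: ('v, 'a::comm_ring_1) mpoly)"
  using hom_deg_Const[of "1::'a"] by simp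

lemma hom_deg_Var [simp]: "hom_deg 1 (Var v)"
  by (simp add: hom_deg_def Var_def)

lemma hom_deg_Const_mult: "hom_deg n f \<Longrightarrow> hom_deg n (Const c * f)"
  for f :: "('v, 'a::comm_ring_1) mpoly"
  using hom_deg_mult[OF hom_deg_Const, of n f c] by simp

lemma hom_deg_power: "hom_deg n f \<Longrightarrow> hom_deg (k * n) (f ^ k)"
  for f :: "('v, 'a::comm_ring_1) mpoly"
  by (induction k) (auto intro: hom_deg_mult)

lemma hom_deg_Var_power: "hom_deg k (Var v ^ k :: ('v, 'a::comm_ring_1) mpoly)"
  using hom_deg_power[OF hom_deg_Var, of k v] by simp

lemma hom_deg_prod:
  "(\<And>i. i \<in> I \<Longrightarrow> hom_deg (n i) (f i)) \<Longrightarrow> hom_deg (sum n I) (prod f I)"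
  for f :: "'i \<Rightarrow> ('v, 'a::comm_ring_1) mpoly"
  by (induction I rule: infinite_finite_induct) (auto intro: hom_deg_mult)

lemma hom_deg_subst:
  fixes f :: "('v, 'a::comm_ring_1) mpoly"
  assumes "hom_deg n f" "\<And>v. hom_deg 1 (s v)"
  shows "hom_deg n (subst s f)"
  unfolding subst_def
proof (intro hom_deg_sum hom_deg_Const_mult)
  fix m assume "m \<in> mons f"
  have "hom_deg (\<Sum>v\<in>Poly_Mapping.keys m. expo m v * 1) (mon_eval s m)"
    unfolding mon_eval_def by (intro hom_deg_prod hom_deg_power assms(2))
  then show "hom_deg n (mon_eval s m)"
    using assms(1) \<open>m \<in> mons f\<close> by (simp add: hom_deg_def total_degree_def)
qed

lemma xv_power: "xv ^ k = sgl (xyzm k 0 0) (1 :: 'a::comm_ring_1)"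
  by (simp add: Var_def sgl_mult_power sgl_xyzm sum_xyzm)

lemma yv_power: "yv ^ k = sgl (xyzm 0 k 0) (1 :: 'a::comm_ring_1)"
  by (simp add: Var_def sgl_mult_power sgl_xyzm sum_xyzm)

lemma zv_power: "zv ^ k = sgl (xyzm 0 0 k) (1 :: 'a::comm_ring_1)"
  by (simp add: Var_def sgl_mult_power sgl_xyzm sum_xyzm)

lemma coef_xv_power_mult [simp]:
  "coef (xv ^ k * f) (xyzm (k + a) i j) = coef f (xyzm a i j)"
  for f :: "'a::comm_ring_1 FV"
  using coef_single_mult[of "xyzm k 0 0" 1 f "xyzm a i j"] by (simp add: xv_power xyzm_add)

lemma xv_power_nonzero [simp]: "xv ^ k \<noteq> (0 :: 'a::field FV)"
proof
  assume "xv ^ k = (0 :: 'a FV)"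
  then have "coef (sgl (xyzm k 0 0) (1 :: 'a)) (xyzm k 0 0) = coef 0 (xyzm k 0 0)"
    by (simp only: xv_power)
  then show False unfolding lookup_single_eq lookup_zero by simp
qed

lemma mons_xv_power_mult:
  assumes "m \<in> mons (xv ^ k * f)"
  shows "expo m VX \<ge> k \<and> xyzm (expo m VX - k) (expo m VY) (expo m VZ) \<in> mons (f :: 'a::field FV)"
proof -
  obtain b where "b \<in> mons f" "m = xyzm k 0 0 + b"
    using assms keys_mult[of "sgl (xyzm k 0 0) (1::'a)" f] unfolding xv_power keys_single by auto
  then show ?thesis by simp
qed

lemma mons_xv_power_multI:
  assumes "m \<in> mons f"
  shows "xyzm (k + expo m VX) (expo m VY) (expo m VZ) \<in> mons (xv ^ k * (f :: 'a::field FV))"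
  using assms by (simp add: in_keys_iff)

lemma xv_power_dvdI:
  fixes f :: "'a::field FV"
  assumes "\<And>m. m \<in> mons f \<Longrightarrow> expo m VX \<ge> k"
  shows "xv ^ k dvd f"
proof -
  have "f = (\<Sum>m\<in>mons f. sgl m (coef f m))" by (rule poly_eq_sum_singles)
  also have "\<dots> = (\<Sum>m\<in>mons f. xv ^ k * sgl (xyzm (expo m VX - k) (expo m VY) (expo m VZ)) (coef f m))"
    using assms by (intro sum.cong refl) (simp add: xv_power mult_single xyzm_add)
  finally show ?thesis unfolding sum_distrib_left[symmetric] by (rule dvdI)
qed

text \<open>Quotients by powers of \<open>x\<close> inherit homogeneity; this gives the degrees of the invariants
  that are defined as such quotients.\<close>

lemma hom_deg_cancel_xv_power:
  assumes "hom_deg (k + n) (xv ^ k * f)"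
  shows "hom_deg n (f :: 'a::field FV)"
  unfolding hom_deg_def
proof
  fix m assume "m \<in> mons f"
  from mons_xv_power_multI[OF this, of k] assms
  have "total_degree (xyzm (k + expo m VX) (expo m VY) (expo m VZ)) = k + n"
    unfolding hom_deg_def by blast
  then show "total_degree m = n" by (simp add: total_degree_xyz)
qed

text \<open>In a homogeneous polynomial, a monomial without \<open>x\<close> exceeds all those with \<open>x\<close>.\<close>

lemma glead_homI:
  fixes f g :: "'a::field FV"
  assumes "hom_deg (i + k) f" "c \<noteq> 0" "f = Const c * sgl (xyzm 0 i k) 1 + xv * g"
  shows "glead f (xyzm 0 i k) c"
proof -
  have x: "expo m VX \<ge> 1" if "m \<in> mons (xv * g)" for m
    using mons_xv_power_mult[of m 1 g] that by simp
  then have nx: "xyzm 0 i k \<notin> mons (xv * g)" by fastforce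
  have "Const c * sgl (xyzm 0 i k) 1 = sgl (xyzm 0 i k) c" by (rule single_eq_Const_mult[symmetric])
  then have f: "f = sgl (xyzm 0 i k) c + xv * g" using assms(3) by simp
  have "grevlex_less m (xyzm 0 i k)" if m: "m \<in> mons f" "m \<noteq> xyzm 0 i k" for m
  proof -
    have "m \<in> mons (xv * g)"
      using m Poly_Mapping.keys_add[of "sgl (xyzm 0 i k) c" "xv * g"] f by (auto split: if_splits)
    then show ?thesis
      using x[of m] m assms(1) by (simp add: hom_deg_def grevlex_xyz)
  qed
  moreover have "coef f (xyzm 0 i k) = c"
    using nx by (simp add: f lookup_add in_keys_iff)
  ultimately show ?thesis using assms(2) by (simp add: lead_def)
qed

lemma glead_y_homI:
  fixes f :: "'a::field FV"
  assumes "hom_deg i f" "xv dvd f - yv ^ i"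
  shows "glead f (xyzm 0 i 0) 1"
proof -
  obtain g where "f - yv ^ i = xv * g" using assms(2) by (rule dvdE)
  then have "f = Const 1 * sgl (xyzm 0 i 0) 1 + xv * g" by (simp add: yv_power algebra_simps)
  then show ?thesis using glead_homI[of i 0 f 1 g] assms(1) by simp
qed

subsection \<open>Degree in z\<close>

definition zdeg_le :: "nat \<Rightarrow> 'a::zero FV \<Rightarrow> bool" where
  "zdeg_le n f \<longleftrightarrow> (\<forall>m\<in>mons f. expo m VZ \<le> n)"

lemma zdeg_le_0 [simp]: "zdeg_le n 0"
  by (simp add: zdeg_le_def)

lemma zdeg_le_mono: "zdeg_le n f \<Longrightarrow> n \<le> k \<Longrightarrow> zdeg_le k f"
  by (auto simp: zdeg_le_def)

lemma zdeg_le_add: "zdeg_le n f \<Longrightarrow> zdeg_le n g \<Longrightarrow> zdeg_le n (f + g)"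
  using Poly_Mapping.keys_add[of f g] by (auto simp: zdeg_le_def)

lemma zdeg_le_diff: "zdeg_le n f \<Longrightarrow> zdeg_le n g \<Longrightarrow> zdeg_le n (f - g)"
  for f g :: "'a::ab_group_add FV"
  using mons_diff[of f g] by (auto simp: zdeg_le_def)

lemma zdeg_le_mult:
  fixes f g :: "'a::comm_ring_1 FV"
  assumes "zdeg_le n f" "zdeg_le k g"
  shows "zdeg_le (n + k) (f * g)"
  unfolding zdeg_le_def
proof
  fix m assume "m \<in> mons (f * g)"
  then obtain a b where "a \<in> mons f" "b \<in> mons g" "m = a + b"
    using keys_mult[of f g] by blast
  then show "expo m VZ \<le> n + k" using assms by (simp add: zdeg_le_def add_mono)
qed

lemma zdeg_le_power: "zdeg_le n f \<Longrightarrow> zdeg_le (k * n) (f ^ k)"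
  for f :: "'a::comm_ring_1 FV"
proof (induction k)
  case 0
  have "zdeg_le 0 (1 :: 'a FV)" using keys_one by (auto simp: zdeg_le_def)
  then show ?case by simp
next
  case (Suc k)
  then show ?case using zdeg_le_mult[of n f "k * n" "f ^ k"] by simp
qed

lemma zdeg_le_Const [simp]: "zdeg_le n (Const c)"
  by (simp add: zdeg_le_def Const_def)

lemma zdeg_le_Var [simp]: "zdeg_le n xv" "zdeg_le n yv" "zdeg_le 1 zv"
  by (simp_all add: zdeg_le_def Var_def sgl_xyzm)

lemma zdeg_le_free_power: "zdeg_le 0 f \<Longrightarrow> zdeg_le n (f ^ k)"
  for f :: "'a::comm_ring_1 FV"
  using zdeg_le_power[of 0 f k] zdeg_le_mono by fastforce

lemma zdeg_le_mult_free:
  "zdeg_le 0 g \<Longrightarrow> zdeg_le n f \<Longrightarrow> zdeg_le n (f * g)"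
  "zdeg_le 0 g \<Longrightarrow> zdeg_le n f \<Longrightarrow> zdeg_le n (g * f)"
  for f g :: "'a::comm_ring_1 FV"
  using zdeg_le_mult[of n f 0 g] zdeg_le_mult[of 0 g n f] by simp_all

lemma zdeg_le_prod:
  "(\<And>i. i \<in> I \<Longrightarrow> zdeg_le 0 (f i)) \<Longrightarrow> zdeg_le 0 (prod f I)"
  for f :: "'i \<Rightarrow> 'a::comm_ring_1 FV"
proof (induction I rule: infinite_finite_induct)
  case (insert i I)
  then show ?case by (auto intro: zdeg_le_mult_free)
qed (use zdeg_le_power[of 0 "0 :: 'a FV" 0] in auto)

subsection \<open>Homogeneous components\<close>

text \<open>Invariants need not be homogeneous, but the group preserves degrees, so that their
  homogeneous components are again invariant.\<close>

definition component :: "nat \<Rightarrow> ('v, 'a::comm_ring_1) mpoly \<Rightarrow> ('v, 'a) mpoly" where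
  "component n f = (\<Sum>m\<in>{m\<in>mons f. total_degree m = n}. sgl m (coef f m))"

lemma coef_component: "coef (component n f) m = (if total_degree m = n then coef f m else 0)"
  unfolding component_def
  by (simp add: lookup_sum lookup_single when_def) (auto simp: in_keys_iff)

lemma hom_deg_component: "hom_deg n (component n f)"
  by (auto simp: hom_deg_def in_keys_iff coef_component split: if_splits)

lemma component_hom: "hom_deg k f \<Longrightarrow> component n f = (if n = k then f else 0)"
  by (rule poly_mapping_eqI) (auto simp: coef_component hom_deg_def in_keys_iff)

lemma component_sum: "component n (sum f I) = (\<Sum>i\<in>I. component n (f i))"
  by (rule poly_mapping_eqI) (simp add: coef_component lookup_sum)

lemma sum_components: "f = (\<Sum>n\<in>total_degree ` mons f. component n f)"
proof (rule poly_mapping_eqI)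
  fix m
  show "coef f m = coef (\<Sum>n\<in>total_degree ` mons f. component n f) m"
    by (simp add: lookup_sum coef_component) (auto simp: in_keys_iff)
qed

lemma component_subst:
  fixes f :: "('v, 'a::comm_ring_1) mpoly"
  assumes "\<And>v. hom_deg 1 (s v)"
  shows "component n (subst s f) = subst s (component n f)"
proof -
  have h: "hom_deg k (subst s (component k f))" for k
    by (rule hom_deg_subst[OF hom_deg_component assms])
  have "component n (subst s f) = component n (\<Sum>k\<in>total_degree ` mons f. subst s (component k f))"
    by (subst sum_components[of f]) (simp add: subst_ring_simps)
  also have "\<dots> = (\<Sum>k\<in>total_degree ` mons f. if n = k then subst s (component k f) else 0)"
    unfolding component_sum by (intro sum.cong refl component_hom h)
  also have "\<dots> = subst s (component n f)"
  proof (cases "n \<in> total_degree ` mons f")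
    case False
    then have "component n f = 0"
      by (intro poly_mapping_eqI) (auto simp: coef_component in_keys_iff)
    then show ?thesis using False by (simp add: subst_ring_simps)
  qed simp
  finally show ?thesis .
qed

section \<open>Polynomials with many roots\<close>

lemma poly_vanish_card:
  fixes f :: "'a::idom poly"
  assumes "finite S" "\<And>s. s \<in> S \<Longrightarrow> poly f s = 0" "degree f < card S"
  shows "f = 0"
proof (rule ccontr)
  assume "f \<noteq> 0"
  then have "card S \<le> card {x. poly f x = 0}"
    using assms(1,2) by (intro card_mono poly_roots_finite) auto
  also have "\<dots> \<le> degree f" by (rule card_poly_roots_bound[OF \<open>f \<noteq> 0\<close>])
  finally show False using assms(3) by simp
qed

section \<open>The action and its invariants\<close>

text \<open>The group acts through pairs \<open>(c, e)\<close>: \<open>c\<close> is the translation of \<open>y\<close>, and \<open>- e\<close> that of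
  \<open>delta\<close>, in units of \<open>x\<close> and \<open>x\<^sup>2\<close>.\<close>

definition trans_var :: "'a \<Rightarrow> 'a \<Rightarrow> xyz \<Rightarrow> 'a::comm_ring_1 FV" where
  "trans_var c e v = (case v of
       VX \<Rightarrow> xv
     | VY \<Rightarrow> yv + Const c * xv
     | VZ \<Rightarrow> zv + Const (2 * c) * yv + Const (c\<^sup>2 + e) * xv)"

lemma subst_numeral [simp]: "subst s (numeral n) = (numeral n :: ('w, 'a::comm_ring_1) mpoly)"
  using subst_Const[of s "numeral n :: 'a"] unfolding Const_numeral .

definition act :: "'a \<Rightarrow> 'a \<Rightarrow> 'a FV \<Rightarrow> 'a::comm_ring_1 FV" where
  "act c e = subst (trans_var c e)"

lemma act_Var [simp]:
  "act c e xv = xv" "act c e yv = yv + Const c * xv"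
  "act c e zv = zv + Const (2 * c) * yv + Const (c\<^sup>2 + e) * xv"
  by (simp_all add: act_def trans_var_def)

lemma act_Const [simp]: "act c e (Const a) = Const a"
  by (simp add: act_def)

lemma act_ring_simps:
  "act c e (f + g) = act c e f + act c e g" "act c e (f * g) = act c e f * act c e g"
  "act c e (f - g) = act c e f - act c e g" "act c e (f ^ n) = act c e f ^ n"
  "act c e (sum h I) = (\<Sum>i\<in>I. act c e (h i))" "act c e (prod h I) = (\<Prod>i\<in>I. act c e (h i))"
  "act c e 1 = 1" "act c e 0 = 0"
  by (simp_all add: act_def subst_add subst_mult subst_1 subst_ring_simps)

text \<open>The maps compose additively, because they describe a representation of the group
  \<open>F\<^sup>2\<close>.\<close>

lemma act_act: "act c e (act c' e' f) = act (c + c') (e + e') f"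
proof -
  have "subst (trans_var c e) (trans_var c' e' v) = trans_var (c + c') (e + e') v" for v
    by (cases v) (simp_all add: trans_var_def subst_add subst_mult Const_add Const_mult
        power2_eq_square algebra_simps)
  then show ?thesis by (simp add: act_def subst_subst)
qed

lemma act_0: "act 0 0 f = f"
proof -
  have "trans_var 0 0 v = Var v" for v by (cases v) (simp_all add: trans_var_def)
  then have "trans_var 0 (0 :: 'a) = Var" by (rule ext)
  then show ?thesis by (simp add: act_def subst_ident)
qed

lemma hom_deg_trans_var: "hom_deg 1 (trans_var c e v)"
  unfolding trans_var_def
  by (cases v) (auto intro!: hom_deg_add hom_deg_Const_mult hom_deg_Var[unfolded One_nat_def])

lemma peval_act:
  assumes "is_hom h"
  shows "peval h s (act c e f) = peval h (\<lambda>v. case v of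
      VX \<Rightarrow> s VX
    | VY \<Rightarrow> s VY + h c * s VX
    | VZ \<Rightarrow> s VZ + h (2 * c) * s VY + h (c\<^sup>2 + e) * s VX) f"
proof -
  have "peval h s (trans_var c e v) = (case v of
      VX \<Rightarrow> s VX
    | VY \<Rightarrow> s VY + h c * s VX
    | VZ \<Rightarrow> s VZ + h (2 * c) * s VY + h (c\<^sup>2 + e) * s VX)" for v
    using assms by (cases v) (simp_all add: trans_var_def peval_add peval_mult)
  then show ?thesis by (simp add: act_def peval_subst[OF assms])
qed

lemma mon_eval_xyz: "mon_eval s m = s VX ^ expo m VX * s VY ^ expo m VY * s VZ ^ expo m VZ"
  using mon_eval_superset[OF finite subset_UNIV, of s m] by (simp add: xyz_UNIV mult.assoc)

text \<open>The value at \<open>x = 1\<close>, nested so that the coefficient of a power of \<open>z\<close> is a polynomial in \<open>y\<close>.\<close>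

definition dehom :: "'a::comm_ring_1 FV \<Rightarrow> 'a poly poly" where
  "dehom = peval (\<lambda>c. [:[:c:]:]) (case_xyz 1 [:[:0, 1:]:] [:0, 1:])"

lemma is_hom_pCons2: "is_hom (\<lambda>c. [:[:c:]:] :: 'a::comm_ring_1 poly poly)"
  by (simp add: is_hom_def one_pCons)

lemma is_hom_dehom: "is_hom dehom"
  unfolding dehom_def by (rule is_hom_peval[OF is_hom_pCons2])

lemma dehom_Var [simp]: "dehom xv = 1" "dehom yv = [:[:0, 1:]:]" "dehom zv = [:0, 1:]"
  and dehom_Const [simp]: "dehom (Const c) = [:[:c:]:]"
  by (simp_all add: dehom_def is_hom_pCons2)

lemma dehom_ring_simps:
  fixes f g :: "'a::comm_ring_1 FV" and h :: "'i \<Rightarrow> 'a FV"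
  shows
  "dehom (f + g) = dehom f + dehom g" "dehom (f * g) = dehom f * dehom g"
  "dehom (f - g) = dehom f - dehom g" "dehom (f ^ n) = dehom f ^ n"
  "dehom (prod h I) = (\<Prod>i\<in>I. dehom (h i))"
proof -
  have hom: "is_hom (dehom :: 'a FV \<Rightarrow> _)" by (rule is_hom_dehom)
  show "dehom (f + g) = dehom f + dehom g" "dehom (f * g) = dehom f * dehom g"
    using hom by (simp_all add: is_hom_def)
  show "dehom (f - g) = dehom f - dehom g" "dehom (f ^ n) = dehom f ^ n"
    "dehom (prod h I) = (\<Prod>i\<in>I. dehom (h i))"
    using hom by (simp_all add: is_hom_diff is_hom_power is_hom_prod)
qed

lemma X_power: "[:0, 1:] ^ i = monom (1 :: 'b::comm_ring_1) i"
  by (simp add: monom_altdef)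

lemma coeff_linear_power: "j \<le> k \<Longrightarrow> coeff ([:e, 1:] ^ j) k = (if j = k then 1 else 0)"
  for e :: "'b::idom"
  using lead_coeff_power[of "[:e, 1:]" j] degree_power_eq[of "[:e, 1:]" j]
  by (auto simp: coeff_eq_0)

text \<open>The coefficient at the highest power of \<open>z\<close> does not see the shift \<open>e\<close> of \<open>z\<close>.\<close>

lemma coeff_top_z:
  fixes f :: "'a::field FV"
  assumes "zdeg_le k f" "s VX = 1" "s VY = [:u:]" "s VZ = [:e, 1:]"
  shows "coeff (peval (\<lambda>c. [:[:c:]:]) s f) k =
    (\<Sum>m\<in>{m\<in>mons f. expo m VZ = k}. smult (coef f m) (u ^ expo m VY))"
proof -
  have "coeff (peval (\<lambda>c. [:[:c:]:]) s f) k =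
      (\<Sum>m\<in>mons f. coeff ([:[:coef f m:]:] * ([:u:] ^ expo m VY * [:e, 1:] ^ expo m VZ)) k)"
    by (simp add: peval_def mon_eval_xyz assms coeff_sum)
  also have "\<dots> = (\<Sum>m\<in>mons f. if expo m VZ = k then smult (coef f m) (u ^ expo m VY) else 0)"
  proof (intro sum.cong refl)
    fix m assume "m \<in> mons f"
    then have "expo m VZ \<le> k" using assms(1) by (simp add: zdeg_le_def)
    then show "coeff ([:[:coef f m:]:] * ([:u:] ^ expo m VY * [:e, 1:] ^ expo m VZ)) k =
        (if expo m VZ = k then smult (coef f m) (u ^ expo m VY) else 0)"
      by (simp add: coeff_linear_power poly_const_pow)
  qed
  finally show ?thesis by (simp add: sum.If_cases Int_def conj_commute)
qed

text \<open>Dehomogenization loses no term of a homogeneous polynomial, as the exponent of \<open>x\<close> is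
  determined by the other two.\<close>

lemma coeff_dehom_top:
  fixes f :: "'a::field FV"
  assumes "hom_deg n f" "zdeg_le k f" "m \<in> mons f" "expo m VZ = k"
  shows "coeff (dehom f) k \<noteq> 0"
proof -
  have "coeff (coeff (dehom f) k) (expo m VY) =
      (\<Sum>l\<in>{l\<in>mons f. expo l VZ = k}. coef f l * coeff ([:0, 1:] ^ expo l VY) (expo m VY))"
    unfolding dehom_def using coeff_top_z[OF assms(2), of "case_xyz 1 [:[:0, 1:]:] [:0, 1:]" "[:0, 1:]" 0]
    by (simp add: coeff_sum)
  also have "\<dots> = (\<Sum>l\<in>{l\<in>mons f. expo l VZ = k}. if l = m then coef f m else 0)"
  proof (intro sum.cong refl)
    fix l assume l: "l \<in> {l\<in>mons f. expo l VZ = k}"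
    have "l = m" if "expo l VY = expo m VY"
    proof (rule xyz_mon_eqI)
      have "total_degree l = total_degree m" using l assms(1,3) by (simp add: hom_deg_def)
      then show "expo l VX = expo m VX" using l that assms(4) by (simp add: total_degree_xyz)
    qed (use l that assms(4) in simp_all)
    moreover have "coeff ([:0, 1:] ^ expo l VY) (expo m VY) = (if expo l VY = expo m VY then 1 else (0::'a))"
      by (simp add: X_power)
    ultimately show "coef f l * coeff ([:0, 1:] ^ expo l VY) (expo m VY) = (if l = m then coef f m else 0)"
      by auto
  qed
  also have "\<dots> = coef f m" using assms(3,4) by simp
  finally show ?thesis using assms(3) by (auto simp: in_keys_iff)
qed

text \<open>A finite additive group \<open>W\<close> of translations of \<open>y\<close>, on which the second parameter of the
  action is an additive function of the first. Distinct elements of \<open>W\<close> give distinct conjugates of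
  \<open>y\<close>, so that the order of the group is the degree of the norm of \<open>y\<close>.\<close>

locale translation_group =
  fixes p :: nat and W :: "'a::field set" and phi :: "'a \<Rightarrow> 'a"
  assumes p_prime: "prime p" and p_gt_2: "p > 2" and char_p: "CHAR('a) = p"
    and fin_W: "finite W" and card_W: "card W = p ^ 4"
    and W_0: "0 \<in> W" and W_add: "u \<in> W \<Longrightarrow> v \<in> W \<Longrightarrow> u + v \<in> W" and W_uminus: "u \<in> W \<Longrightarrow> - u \<in> W"
    and phi_add: "u \<in> W \<Longrightarrow> v \<in> W \<Longrightarrow> phi (u + v) = phi u + phi v"
begin

lemma two_nonzero: "(2 :: 'a) \<noteq> 0"
proof
  assume "(2 :: 'a) = 0"
  then have "of_nat 2 = (0 :: 'a)" by simp
  then have "p dvd 2" using char_p of_nat_eq_0_iff_char_dvd by metis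
  then show False using p_gt_2 by (auto dest: dvd_imp_le)
qed

lemma p_odd: "odd p"
  using p_prime p_gt_2 prime_odd_nat by blast

definition Inv :: "'a FV set" where
  "Inv = {f. \<forall>w\<in>W. act w (phi w) f = f}"

lemma InvD: "f \<in> Inv \<Longrightarrow> w \<in> W \<Longrightarrow> act w (phi w) f = f"
  by (simp add: Inv_def)

lemma Inv_subalgebra: "is_subalgebra Inv"
  by (auto simp: is_subalgebra_def Inv_def act_ring_simps)

lemma xv_Inv: "xv \<in> Inv"
  by (simp add: Inv_def)

lemma Inv_cancel_xv: "xv ^ k * f \<in> Inv \<Longrightarrow> f \<in> Inv"
  unfolding Inv_def
proof (intro CollectI ballI)
  fix w assume "xv ^ k * f \<in> {f. \<forall>w\<in>W. act w (phi w) f = f}" "w \<in> W"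
  then have "xv ^ k * act w (phi w) f = xv ^ k * f" by (auto simp: act_ring_simps)
  then show "act w (phi w) f = f" by (simp only: mult_cancel_left xv_power_nonzero) simp
qed

lemma Inv_component: "f \<in> Inv \<Longrightarrow> component n f \<in> Inv"
  unfolding Inv_def act_def
proof (intro CollectI ballI)
  fix w assume f: "f \<in> {f. \<forall>w\<in>W. subst (trans_var w (phi w)) f = f}" "w \<in> W"
  have "component n (subst (trans_var w (phi w)) f) = subst (trans_var w (phi w)) (component n f)"
    by (rule component_subst[OF hom_deg_trans_var])
  then show "subst (trans_var w (phi w)) (component n f) = component n f" using f by simp
qed

lemma sum_W_shift: "w \<in> W \<Longrightarrow> bij_betw ((+) w) W W"
  by (rule bij_betwI[of _ _ _ "(+) (- w)"]) (auto intro: W_add W_uminus)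

definition Ny :: "'a FV" where "Ny = (\<Prod>w\<in>W. yv + Const w * xv)"

definition Nz :: "'a FV" where "Nz = (\<Prod>w\<in>W. act w (phi w) zv)"

lemma Ny_Inv: "Ny \<in> Inv"
  unfolding Inv_def
proof (intro CollectI ballI)
  fix w assume w: "w \<in> W"
  have "act w (phi w) Ny = (\<Prod>u\<in>W. yv + Const (w + u) * xv)"
    by (simp add: Ny_def act_ring_simps Const_add algebra_simps)
  also have "\<dots> = Ny"
    unfolding Ny_def by (rule prod.reindex_bij_betw[OF sum_W_shift[OF w]])
  finally show "act w (phi w) Ny = Ny" .
qed

lemma Nz_Inv: "Nz \<in> Inv"
  unfolding Inv_def
proof (intro CollectI ballI)
  fix w assume w: "w \<in> W"
  have "act w (phi w) Nz = (\<Prod>u\<in>W. act (w + u) (phi (w + u)) zv)"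
    unfolding Nz_def act_ring_simps act_act using w by (intro prod.cong) (simp_all add: phi_add)
  also have "\<dots> = Nz"
    unfolding Nz_def by (rule prod.reindex_bij_betw[OF sum_W_shift[OF w]])
  finally show "act w (phi w) Nz = Nz" .
qed

lemma hom_deg_Ny: "hom_deg (p ^ 4) Ny"
proof -
  have "hom_deg (\<Sum>w\<in>W. 1) Ny"
    unfolding Ny_def by (intro hom_deg_prod hom_deg_add hom_deg_Var hom_deg_Const_mult)
  then show ?thesis by (simp add: card_W)
qed

lemma zdeg_Ny: "zdeg_le 0 Ny"
  unfolding Ny_def by (intro zdeg_le_prod zdeg_le_add zdeg_le_mult_free) simp_all

lemma glead_Nz: "glead Nz (xyzm 0 0 (p ^ 4)) 1"
proof -
  have "glead (act w (phi w) zv) (xyzm 0 0 1) 1" for w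
  proof -
    have "Const (2 * w) * yv = sgl (xyzm 0 1 0) (2 * w)" "Const (w\<^sup>2 + phi w) * xv = sgl (xyzm 1 0 0) (w\<^sup>2 + phi w)"
      by (simp_all add: Const_def Var_def mult_single sgl_xyzm)
    moreover have "zv = sgl (xyzm 0 0 1) (1 :: 'a)" by (simp add: Var_def sgl_xyzm)
    ultimately have "act w (phi w) zv = sgl (xyzm 0 0 1) 1 + sgl (xyzm 0 1 0) (2 * w) + sgl (xyzm 1 0 0) (w\<^sup>2 + phi w)"
      unfolding act_Var by simp
    also have "glead \<dots> (xyzm 0 0 1) 1"
      by (intro grevlex.lead_lower grevlex.lead_single) (auto simp: grevlex_xyz split: if_splits)
    finally show ?thesis .
  qed
  then have "glead Nz (\<Sum>w\<in>W. xyzm 0 0 1) (\<Prod>w\<in>W. 1)"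
    unfolding Nz_def by (intro grevlex.lead_prod)
  moreover have "(\<Sum>w\<in>W. xyzm 0 0 1) = xyzm 0 0 (card W)"
    using fin_W by (induction W rule: finite_induct) (simp_all add: xyzm_0 xyzm_add)
  ultimately show ?thesis by (simp add: card_W)
qed

text \<open>Modulo \<open>x\<close> the group acts by \<open>z \<mapsto> z + 2wy\<close>. A homogeneous invariant whose degree in \<open>z\<close>
  modulo \<open>x\<close> is less than the number of these translations is therefore constant in \<open>z\<close>.\<close>

lemma invariant_mod_x:
  assumes u: "u \<in> Inv" "hom_deg n u"
    and z: "\<And>m. m \<in> mons u \<Longrightarrow> expo m VX = 0 \<Longrightarrow> expo m VZ < p ^ 4"
  obtains c where "xv dvd u - Const c * yv ^ n"
proof -
  \<comment> \<open>The value at \<open>x = 0\<close>, \<open>y = 1\<close> as a polynomial in \<open>z\<close>: it has \<open>p\<^sup>4\<close> periods, but lower degree.\<close>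
  define s :: "xyz \<Rightarrow> 'a poly" where "s = case_xyz 0 1 [:0, 1:]"
  have hC: "is_hom (\<lambda>c. [:c:] :: 'a poly)" by (simp add: is_hom_def one_pCons)
  have hI: "is_hom (\<lambda>c. c :: 'a)" by (simp add: is_hom_def)
  have hP: "is_hom (\<lambda>q. poly q (t :: 'a))" for t by (simp add: is_hom_def)
  define v where "v = peval (\<lambda>c. [:c:]) s u"
  have v: "poly v t = peval (\<lambda>c. c) (case_xyz 0 1 t) u" for t
  proof -
    have "poly v t = peval (\<lambda>a. poly [:a:] t) (\<lambda>w. poly (s w) t) u"
      unfolding v_def by (rule is_hom_comp_peval[OF hP hC])
    also have "(\<lambda>w. poly (s w) t) = case_xyz 0 1 t" by (auto simp: s_def fun_eq_iff split: xyz.split)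
    finally show ?thesis by simp
  qed
  have per: "poly v (2 * w) = poly v 0" if "w \<in> W" for w
  proof -
    have "poly v 0 = peval (\<lambda>c. c) (case_xyz 0 1 0) (act w (phi w) u)"
      using InvD[OF u(1) that] by (simp add: v)
    also have "\<dots> = peval (\<lambda>c. c) (case_xyz 0 1 (2 * w)) u"
      unfolding peval_act[OF hI]
      by (rule arg_cong[where f = "\<lambda>s. peval (\<lambda>c. c) s u"]) (auto simp: fun_eq_iff split: xyz.split)
    finally show ?thesis by (simp add: v)
  qed
  have cv: "coeff v k = (\<Sum>m\<in>{m\<in>mons u. expo m VX = 0 \<and> expo m VZ = k}. coef u m)" for k
  proof -
    have "coeff v k = (\<Sum>m\<in>mons u. if expo m VX = 0 \<and> expo m VZ = k then coef u m else 0)"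
      by (simp add: v_def s_def peval_def mon_eval_xyz coeff_sum power_0_left X_power
          if_distrib[of "\<lambda>x. coeff x _"] if_distrib[of "\<lambda>x. x * _"] if_distrib[of "\<lambda>x. smult _ x"] cong: if_cong)
         (intro sum.cong refl, auto)
    then show ?thesis by (simp add: sum.If_cases Int_def)
  qed
  have "degree v < p ^ 4"
  proof (rule ccontr)
    assume d: "\<not> degree v < p ^ 4"
    then have S: "{m\<in>mons u. expo m VX = 0 \<and> expo m VZ = degree v} = {}"
      using z by fastforce
    have "coeff v (degree v) = 0" unfolding cv S by simp
    then have "v = 0" by simp
    then show False using d p_gt_2 by simp
  qed
  moreover have "card ((\<lambda>w. 2 * w) ` W) = p ^ 4"
    using card_image[of "\<lambda>w. 2 * w" W] two_nonzero by (simp add: inj_on_def card_W)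
  ultimately have "v - [:poly v 0:] = 0"
    using per fin_W p_gt_2
    by (intro poly_vanish_card[of "(\<lambda>w. 2 * w) ` W"]) (auto intro!: le_less_trans[OF degree_diff_le])
  then have v0: "v = [:poly v 0:]" by simp
  have "coef u m = 0" if "m \<in> mons u" "expo m VX = 0" "expo m VZ > 0" for m
  proof -
    have "l = m" if l: "l \<in> mons u" "expo l VX = 0" "expo l VZ = expo m VZ" for l
    proof (rule xyz_mon_eqI)
      have "total_degree l = total_degree m"
        using l \<open>m \<in> mons u\<close> u(2) by (simp add: hom_deg_def)
      then show "expo l VY = expo m VY"
        using l \<open>expo m VX = 0\<close> by (simp add: total_degree_xyz)
    qed (use l \<open>expo m VX = 0\<close> in simp_all)
    then have "{l\<in>mons u. expo l VX = 0 \<and> expo l VZ = expo m VZ} = {m}"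
      using that by blast
    then have "coeff v (expo m VZ) = coef u m" unfolding cv by simp
    moreover have "coeff v (expo m VZ) = 0"
      using that(3) by (subst v0) (simp add: coeff_pCons split: nat.split)
    ultimately show ?thesis by simp
  qed
  then have nz: "m = xyzm 0 n 0" if "m \<in> mons u" "expo m VX = 0" for m
  proof -
    have "expo m VZ = 0" using \<open>\<And>m. \<lbrakk>m \<in> mons u; expo m VX = 0; expo m VZ > 0\<rbrakk> \<Longrightarrow> coef u m = 0\<close>[OF that] that(1)
      by (auto simp: in_keys_iff)
    moreover have "total_degree m = n" using that(1) u(2) by (simp add: hom_deg_def)
    ultimately show ?thesis using that(2) by (intro xyz_mon_eqI) (simp_all add: total_degree_xyz)
  qed
  define c where "c = coef u (xyzm 0 n 0)"
  have "expo m VX \<ge> 1" if "m \<in> mons (u - Const c * yv ^ n)" for m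
  proof (rule ccontr)
    assume m0: "\<not> expo m VX \<ge> 1"
    have "m \<noteq> xyzm 0 n 0" using that by (auto simp: in_keys_iff lookup_minus yv_power c_def)
    moreover have "m \<in> mons u"
      using that calculation by (auto simp: in_keys_iff lookup_minus yv_power lookup_single)
    ultimately show False using nz m0 by simp
  qed
  then have "xv ^ 1 dvd u - Const c * yv ^ n" by (intro xv_power_dvdI)
  then show ?thesis using that by simp
qed

section \<open>Invariants after inverting x\<close>

text \<open>The norm of \<open>y\<close> at \<open>x = 1\<close>.\<close>

definition nW :: "'a poly" where "nW = (\<Prod>w\<in>W. [:w, 1:])"

lemma dehom_Ny: "dehom Ny = [:nW:]"
proof -
  have "dehom Ny = (\<Prod>w\<in>W. [:[:w, 1:]:])"
    by (simp add: Ny_def dehom_ring_simps one_pCons)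
  also have "\<dots> = [:nW:]"
    unfolding nW_def by (induction W rule: infinite_finite_induct) (simp_all add: one_pCons)
  finally show ?thesis .
qed

lemma degree_nW: "degree nW = p ^ 4"
  unfolding nW_def by (subst degree_prod_sum_eq) (simp_all add: card_W)

lemma nW_nonzero: "nW \<noteq> 0"
  using degree_nW p_gt_2 by auto

lemma pcompose_nW: "w \<in> W \<Longrightarrow> pcompose nW [:w, 1:] = nW"
proof -
  assume w: "w \<in> W"
  have "pcompose nW [:w, 1:] = (\<Prod>u\<in>W. [:w + u, 1:])"
    by (simp add: nW_def pcompose_prod pcompose_pCons add.commute)
  also have "\<dots> = nW" unfolding nW_def by (rule prod.reindex_bij_betw[OF sum_W_shift[OF w]])
  finally show ?thesis .
qed

text \<open>A polynomial in \<open>y\<close> invariant under the translations by \<open>W\<close> is a polynomial in the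
  norm of \<open>y\<close>: subtracting its value at zero makes it divisible by the norm, and the quotient is
  again invariant.\<close>

lemma invariant_in_y:
  assumes B: "is_subalgebra B" "xv \<in> B" "Ny \<in> B"
    and l: "\<And>w. w \<in> W \<Longrightarrow> pcompose l [:w, 1:] = l"
  shows "\<exists>D g. hom_deg D g \<and> g \<in> B \<and> g \<in> Inv \<and> zdeg_le 0 g \<and> dehom g = [:l:]"
  using l
proof (induction "degree l" arbitrary: l rule: less_induct)
  case less
  show ?case
  proof (cases "degree l = 0")
    case True
    then obtain c where "l = [:c:]" by (rule degree_eq_zeroE)
    then show ?thesis
      by (intro exI[of _ 0] exI[of _ "Const c"])
         (simp add: subalgebra_Const[OF B(1)] subalgebra_Const[OF Inv_subalgebra])
  next
    case False
    define r where "r = (l - [:poly l 0:]) mod nW"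
    define q where "q = (l - [:poly l 0:]) div nW"
    have eq: "l - [:poly l 0:] = nW * q + r" by (simp add: q_def r_def)
    have rootn: "poly nW (- w) = 0" if "w \<in> W" for w
      using that fin_W by (auto simp: nW_def poly_prod intro!: bexI[of _ w])
    have rootl: "poly l (- w) = poly l 0" if "w \<in> W" for w
      using arg_cong[OF less.prems[OF W_uminus[OF that]], of "\<lambda>f. poly f 0"]
      by (simp add: poly_pcompose)
    have "poly r w = 0" if wW: "w \<in> uminus ` W" for w
    proof -
      obtain u where "u \<in> W" "w = - u" using wW by auto
      then have "poly (l - [:poly l 0:]) w = 0" "poly nW w = 0" using rootl rootn by auto
      then show ?thesis unfolding eq by simp
    qed
    moreover have "degree r < card (uminus ` W)"
      using degree_mod_less'[OF nW_nonzero, of "l - [:poly l 0:]"] p_gt_2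
      by (cases "r = 0") (auto simp: r_def degree_nW card_image card_W)
    ultimately have "r = 0" using fin_W by (intro poly_vanish_card[of "uminus ` W"]) auto
    then have eq': "l = nW * q + [:poly l 0:]" using eq by (simp add: algebra_simps)
    have qinv: "pcompose q [:w, 1:] = q" if "w \<in> W" for w
    proof -
      have "nW * pcompose q [:w, 1:] + [:poly l 0:] = pcompose (nW * q + [:poly l 0:]) [:w, 1:]"
        using pcompose_nW[OF that] by (simp add: pcompose_add pcompose_mult)
      also have "\<dots> = nW * q + [:poly l 0:]" using less.prems[OF that] eq' by simp
      finally show ?thesis using nW_nonzero by simp
    qed
    have "q \<noteq> 0"
    proof
      assume "q = 0"
      then have "l = [:poly l 0:]" using eq' by simp
      then have "degree l = degree [:poly l 0:]" by (rule arg_cong)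
      then show False using False by simp
    qed
    then have "degree (nW * q) = p ^ 4 + degree q"
      by (simp add: degree_mult_eq nW_nonzero degree_nW)
    moreover have "degree l = degree (nW * q)"
      using calculation p_gt_2 by (subst eq') (rule degree_add_eq_left, simp)
    ultimately have "degree q < degree l" using p_gt_2 by simp
    from less.hyps[OF this qinv] obtain D g where g: "hom_deg D g" "g \<in> B" "g \<in> Inv" "zdeg_le 0 g"
      "dehom g = [:q:]" by blast
    let ?g = "Ny * g + Const (poly l 0) * xv ^ (p ^ 4 + D)"
    have "hom_deg (p ^ 4 + D) ?g"
      by (intro hom_deg_add hom_deg_mult hom_deg_Ny g(1) hom_deg_Const_mult hom_deg_Var_power)
    moreover have "?g \<in> B"
      using g B by (intro subalgebra_add subalgebra_mult subalgebra_Const subalgebra_power)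
    moreover have "?g \<in> Inv"
      using g Inv_subalgebra xv_Inv Ny_Inv
      by (intro subalgebra_add subalgebra_mult subalgebra_Const subalgebra_power)
    moreover have "zdeg_le 0 ?g"
      using g zdeg_Ny by (intro zdeg_le_add zdeg_le_mult_free zdeg_le_free_power) simp_all
    moreover have "dehom ?g = [:l:]"
      by (subst eq') (simp add: dehom_ring_simps dehom_Ny g)
    ultimately show ?thesis by blast
  qed
qed

text \<open>An invariant linear in \<open>z\<close> with a power of \<open>x\<close> as coefficient of \<open>z\<close> serves to remove the
  highest power of \<open>z\<close>, whose coefficient is invariant as a polynomial in \<open>y\<close>.\<close>

lemma localization_hom:
  assumes B: "is_subalgebra B" "xv \<in> B" "Ny \<in> B" "g1 \<in> B"
    and g1: "g1 \<in> Inv" "hom_deg (e + 1) g1" "g1 = Const b * zv * xv ^ e + h" "zdeg_le 0 h" "b \<noteq> 0"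
  shows "f \<in> Inv \<Longrightarrow> hom_deg n f \<Longrightarrow> \<forall>m\<in>mons f. expo m VZ < k \<Longrightarrow> \<exists>j. xv ^ j * f \<in> B"
proof (induction k arbitrary: f n)
  case 0
  then have "f = 0" by (metis ex_in_conv less_zeroE mons_eq_empty_iff)
  then show ?case using subalgebra_0[OF B(1)] by simp
next
  case (Suc k)
  then have zf: "zdeg_le k f" by (auto simp: zdeg_le_def less_Suc_eq_le)
  define l where "l = coeff (dehom f) k"
  let ?s = "case_xyz 1 [:[:0, 1:]:] [:0, 1:] :: xyz \<Rightarrow> 'a poly poly"
  have l: "l = (\<Sum>m\<in>{m\<in>mons f. expo m VZ = k}. smult (coef f m) ([:0, 1:] ^ expo m VY))"
    unfolding l_def dehom_def by (rule coeff_top_z[OF zf, where e = 0]) simp_all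
  have pc: "pcompose ([:0, 1:] ^ i) q = q ^ i" for i and q :: "'a poly"
    by (induction i) (simp_all add: pcompose_mult pcompose_pCons pcompose_1)
  have linv: "pcompose l [:w, 1:] = l" if "w \<in> W" for w
  proof -
    have "l = coeff (peval (\<lambda>c. [:[:c:]:]) ?s (act w (phi w) f)) k"
      using InvD[OF Suc.prems(1) that] by (simp add: l_def dehom_def)
    also have "\<dots> = (\<Sum>m\<in>{m\<in>mons f. expo m VZ = k}. smult (coef f m) ([:w, 1:] ^ expo m VY))"
      unfolding peval_act[OF is_hom_pCons2]
      by (rule coeff_top_z[OF zf, where e = "[:w\<^sup>2 + phi w, 2 * w:]"]) (simp_all add: one_pCons)
    also have "\<dots> = pcompose l [:w, 1:]"
      by (simp add: l pcompose_sum pcompose_smult pc)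
    finally show ?thesis by simp
  qed
  obtain D g where g: "hom_deg D g" "g \<in> B" "g \<in> Inv" "zdeg_le 0 g" "dehom g = [:l:]"
    using invariant_in_y[OF B(1-3) linv] by blast
  \<comment> \<open>The invariant \<open>G\<close> has the same coefficient \<open>l\<close> at the power \<open>k\<close> of \<open>z\<close> when \<open>x = 1\<close>; the
    powers of \<open>x\<close> in \<open>f'\<close> make the two degrees agree.\<close>
  define G where "G = Const (inverse b ^ k) * (g * g1 ^ k)"
  define N where "N = D + k * (e + 1)"
  have hG: "hom_deg N G"
    unfolding G_def N_def by (intro hom_deg_Const_mult hom_deg_mult g(1) hom_deg_power g1(2))
  have "zdeg_le 1 (Const b * zv * xv ^ e :: 'a FV)"
    by (rule zdeg_le_mult_free(1)[OF zdeg_le_free_power[OF zdeg_le_Var(1)] zdeg_le_mult_free(2)])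
       (rule zdeg_le_Const zdeg_le_Var)+
  then have zg1: "zdeg_le 1 g1"
    unfolding g1(3) by (rule zdeg_le_add) (rule zdeg_le_mono[OF g1(4)], simp)
  have zG: "zdeg_le k G"
    unfolding G_def using zdeg_le_power[OF zg1, of k] g(4)
    by (intro zdeg_le_mult_free) simp_all
  define f' where "f' = xv ^ N * f - xv ^ n * G"
  have zx: "zdeg_le 0 (xv ^ i :: 'a FV)" for i
    by (intro zdeg_le_free_power) simp
  have zf': "zdeg_le k f'"
    unfolding f'_def using zf zG zx by (intro zdeg_le_diff zdeg_le_mult_free)
  have "hom_deg (N + n) (xv ^ N * f)" "hom_deg (n + N) (xv ^ n * G)"
    by (intro hom_deg_mult hom_deg_Var_power hG Suc.prems(2))+
  then have hf': "hom_deg (N + n) f'"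
    unfolding f'_def by (intro hom_deg_diff) (simp_all add: add.commute)
  have inv: "f' \<in> Inv" "G \<in> Inv" and GB: "G \<in> B"
    unfolding f'_def G_def using Inv_subalgebra xv_Inv Suc.prems(1) g g1 B
    by (auto intro!: subalgebra_diff subalgebra_mult subalgebra_Const subalgebra_power)
  have "coeff (dehom f') k = 0"
  proof -
    have dh: "dehom h = [:coeff (dehom h) 0:]"
    proof (rule poly_eqI)
      fix i show "coeff (dehom h) i = coeff [:coeff (dehom h) 0:] i"
      proof (cases i)
        case (Suc j)
        have "coeff (dehom h) (Suc j) = (\<Sum>m\<in>{m\<in>mons h. expo m VZ = Suc j}. smult (coef h m) ([:0, 1:] ^ expo m VY))"
          unfolding dehom_def
          by (rule coeff_top_z[OF zdeg_le_mono[OF g1(4)], where e = 0]) simp_all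
        also have "{m\<in>mons h. expo m VZ = Suc j} = {}" using g1(4) by (auto simp: zdeg_le_def)
        finally show ?thesis using Suc by simp
      qed simp
    qed
    define h0 where "h0 = coeff (dehom h) 0"
    have "dehom g1 = [:[:b:]:] * [:0, 1:] + [:h0:]"
      unfolding g1(3) h0_def using dh by (simp add: dehom_ring_simps)
    then have dg1: "dehom g1 = [:h0, [:b:]:]" by simp
    have "degree (dehom g1 ^ k) = k"
      using g1(5) by (simp add: dg1 degree_power_eq)
    then have "coeff (dehom g1 ^ k) k = lead_coeff (dehom g1) ^ k"
      using lead_coeff_power[of "dehom g1" k] by simp
    then have "coeff (dehom g1 ^ k) k = [:b:] ^ k" using g1(5) by (simp add: dg1)
    then have "coeff (dehom G) k = [:inverse b ^ k:] * (l * [:b:] ^ k)"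
      by (simp add: G_def dehom_ring_simps g(5))
    also have "\<dots> = l"
      using g1(5) by (simp add: poly_const_pow) (simp flip: power_mult_distrib)
    finally show ?thesis
      by (simp add: f'_def dehom_ring_simps l_def)
  qed
  then have "expo m VZ < k" if "m \<in> mons f'" for m
    using coeff_dehom_top[OF hf' zf' that] zf' that by (force simp: zdeg_le_def le_less)
  then obtain j where j: "xv ^ j * f' \<in> B" using Suc.IH[OF inv(1) hf'] by blast
  have "xv ^ (j + N) * f = xv ^ j * f' + xv ^ (j + n) * G"
    by (simp add: f'_def algebra_simps power_add)
  also have "\<dots> \<in> B"
    by (intro subalgebra_add[OF B(1)] subalgebra_mult[OF B(1) subalgebra_power[OF B(1,2)]] j GB)
  finally show ?case by blast
qed

text \<open>The general case follows by a common power of \<open>x\<close> for all homogeneous components.\<close>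

lemma localization:
  assumes B: "is_subalgebra B" "xv \<in> B" "Ny \<in> B" "g1 \<in> B"
    and g1: "g1 \<in> Inv" "hom_deg (e + 1) g1" "g1 = Const b * zv * xv ^ e + h" "zdeg_le 0 h" "b \<noteq> 0"
    and f: "f \<in> Inv"
  shows "\<exists>j. xv ^ j * f \<in> B"
proof -
  have c: "\<exists>j. xv ^ j * component n f \<in> B" for n
  proof -
    obtain k where "\<forall>m\<in>mons (component n f). expo m VZ < k"
      using finite_nat_set_iff_bounded[of "(\<lambda>m. expo m VZ) ` mons (component n f)"] by auto
    then show ?thesis
      using localization_hom[OF B g1 Inv_component[OF f] hom_deg_component] by blast
  qed
  have "\<exists>j. xv ^ j * (\<Sum>n\<in>S. component n f) \<in> B" if "finite S" for S
    using that
  proof (induction S)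
    case empty
    then show ?case using subalgebra_0[OF B(1)] by simp
  next
    case (insert n S)
    then obtain i j where ij: "xv ^ i * component n f \<in> B" "xv ^ j * (\<Sum>n\<in>S. component n f) \<in> B"
      using c by blast
    have "xv ^ (i + j) * (\<Sum>n\<in>insert n S. component n f) =
        xv ^ j * (xv ^ i * component n f) + xv ^ i * (xv ^ j * (\<Sum>n\<in>S. component n f))"
      using insert by (simp add: power_add algebra_simps)
    also have "\<dots> \<in> B"
      by (intro subalgebra_add[OF B(1)] subalgebra_mult[OF B(1) subalgebra_power[OF B(1,2)]] ij)
    finally show ?case by blast
  qed
  from this[of "total_degree ` mons f"] show ?thesis
    using sum_components[of f] by simp
qed

end

section \<open>The generating invariants\<close>

lemma CHAR_mpoly: "CHAR(('v, 'a::comm_ring_1) mpoly) = CHAR('a)"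
proof (rule CHAR_eqI)
  show "of_nat CHAR('a) = (0 :: ('v, 'a) mpoly)"
    by (simp flip: Const_of_nat)
  show "CHAR('a) dvd n" if "of_nat n = (0 :: ('v, 'a) mpoly)" for n
    using that by (simp add: of_nat_eq_0_iff_char_dvd flip: Const_of_nat)
qed

lemma hom_deg_delta: "hom_deg 2 delta"
proof -
  have "hom_deg (2 * 1) (yv\<^sup>2 :: 'a FV)" "hom_deg (1 + 1) (xv * zv :: 'a FV)"
    by (intro hom_deg_power hom_deg_mult hom_deg_Var)+
  then show ?thesis
    unfolding delta_def by (intro hom_deg_diff) (simp_all add: numeral_2_eq_2)
qed

lemma zdeg_delta: "zdeg_le 1 delta"
  unfolding delta_def
  by (intro zdeg_le_diff zdeg_le_free_power zdeg_le_mult_free(2) zdeg_le_Var)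

lemma hom_deg_eqI: "hom_deg n f \<Longrightarrow> n = k \<Longrightarrow> hom_deg k f"
  by simp

lemma Const_cancel: "c \<noteq> 0 \<Longrightarrow> Const c * Const (inverse c) = (1 :: ('v, 'a::field) mpoly)"
  by (simp flip: Const_mult)

text \<open>On \<open>W\<close> the second parameter of the action is a linearized polynomial of degree exactly
  \<open>p\<^sup>2\<close> in the first, and \<open>kernel\<close> is the linearized polynomial of degree \<open>p\<^sup>4\<close> that vanishes on \<open>W\<close>.
  The coefficients of the generators are expressed by \<open>r0\<close>, \<open>r1\<close>, \<open>r2\<close> and \<open>n3\<close> instead of minors.\<close>

locale linearized_family = translation_group p W phi
  for p :: nat and W :: "'a::field set" and phi +
  fixes r0 r1 r2 n0 n1 n2 n3 :: 'a
  assumes r1: "r1 \<noteq> 0" and r2: "r2 \<noteq> 0"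
    and phi: "w \<in> W \<Longrightarrow> phi w = r0 * w + r1 * w ^ p + r2 * w ^ p\<^sup>2"
    and kernel: "w \<in> W \<Longrightarrow> w ^ p ^ 4 + n3 * w ^ p ^ 3 + n2 * w ^ p\<^sup>2 + n1 * w ^ p + n0 * w = 0"
begin

lemma frob: "(u + v :: 'a FV) ^ p ^ n = u ^ p ^ n + v ^ p ^ n"
  by (rule freshmans_dream') (simp_all add: CHAR_mpoly char_p p_prime)

lemma frob_diff: "(u - v :: 'a FV) ^ p ^ n = u ^ p ^ n - v ^ p ^ n"
  using frob[of "u - v" v n] by (simp add: algebra_simps)

lemmas frob1 = frob[where n = 1, simplified] and frob1_diff = frob_diff[where n = 1, simplified]

text \<open>The norm of \<open>y\<close> is the homogenization of the linearized polynomial vanishing on \<open>W\<close>: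
  both are monic of degree \<open>card W\<close> with the same roots.\<close>

lemma Ny_eq: "Ny = yv ^ p ^ 4 + Const n3 * yv ^ p ^ 3 * xv ^ (p ^ 4 - p ^ 3)
   + Const n2 * yv ^ p\<^sup>2 * xv ^ (p ^ 4 - p\<^sup>2) + Const n1 * yv ^ p * xv ^ (p ^ 4 - p)
   + Const n0 * yv * xv ^ (p ^ 4 - 1)"
proof -
  let ?X = "xv :: 'a FV"
  define lo where "lo = monom (Const n3 * ?X ^ (p ^ 4 - p ^ 3)) (p ^ 3)
    + monom (Const n2 * ?X ^ (p ^ 4 - p\<^sup>2)) (p\<^sup>2) + monom (Const n1 * ?X ^ (p ^ 4 - p)) p
    + monom (Const n0 * ?X ^ (p ^ 4 - 1)) 1"
  define P where "P = (\<Prod>w\<in>W. [:Const w * ?X, 1:])"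
  have lt: "p ^ 3 < p ^ 4" "p\<^sup>2 < p ^ 4" "p < p ^ 4" "1 < p ^ 4"
    using p_gt_2 power_strict_increasing[of 1 4 p] by (simp_all add: power_strict_increasing)
  have deg_lo: "degree lo < p ^ 4"
    unfolding lo_def using lt
    by (intro degree_add_less le_less_trans[OF degree_monom_le]) simp_all
  have P: "degree P = p ^ 4" "lead_coeff P = 1"
    unfolding P_def by (subst degree_prod_sum_eq) (simp_all add: card_W lead_coeff_prod)
  have "degree (monom 1 (p ^ 4) - P) < p ^ 4"
  proof (rule ccontr)
    assume "\<not> ?thesis"
    moreover have "degree (monom 1 (p ^ 4) - P) \<le> p ^ 4"
      using P(1) by (intro degree_diff_le degree_monom_le) simp
    ultimately have d: "degree (monom 1 (p ^ 4) - P) = p ^ 4" by simp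
    have "coeff (monom 1 (p ^ 4) - P) (p ^ 4) = 0" using P by simp
    with d have "monom 1 (p ^ 4) - P = 0" by (metis leading_coeff_0_iff)
    with d lt show False by simp
  qed
  then have "degree (monom 1 (p ^ 4) - P + lo) < p ^ 4"
    using deg_lo by (rule degree_add_less)
  moreover have "inj_on (\<lambda>w. Const w * ?X) W"
  proof (rule inj_onI)
    fix u v assume "Const u * ?X = Const v * ?X"
    then have "Const (u - v) * ?X ^ 1 = 0" by (simp add: Const_minus left_diff_distrib)
    then have "Const (u - v) = (0 :: 'a FV)" unfolding mult_eq_0_iff using xv_power_nonzero by blast
    then show "u = v" by simp
  qed
  ultimately have deg: "degree (monom 1 (p ^ 4) - P + lo) < card ((\<lambda>w. Const w * ?X) ` W)"
    by (simp add: card_image card_W)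
  have root: "poly (monom 1 (p ^ 4) - P + lo) (Const w * ?X) = 0" if w: "w \<in> W" for w
  proof -
    have "poly [:Const (- w) * ?X, 1:] (Const w * ?X) = 0" by (simp add: Const_uminus)
    then have "poly P (Const w * ?X) = 0"
      unfolding P_def poly_prod using W_uminus[OF w] fin_W by (intro prod_zero) blast+
    moreover have "poly (monom 1 (p ^ 4) + lo) (Const w * ?X) =
        Const (w ^ p ^ 4 + n3 * w ^ p ^ 3 + n2 * w ^ p\<^sup>2 + n1 * w ^ p + n0 * w) * ?X ^ p ^ 4"
    proof -
      have e: "?X ^ (p ^ 4 - k) * ?X ^ k = ?X ^ p ^ 4" if "k < p ^ 4" for k
        using that by (simp flip: power_add)
      have "poly (monom 1 (p ^ 4) + lo) (Const w * ?X) = Const (w ^ p ^ 4) * ?X ^ p ^ 4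
        + Const (n3 * w ^ p ^ 3) * (?X ^ (p ^ 4 - p ^ 3) * ?X ^ p ^ 3)
        + Const (n2 * w ^ p\<^sup>2) * (?X ^ (p ^ 4 - p\<^sup>2) * ?X ^ p\<^sup>2)
        + Const (n1 * w ^ p) * (?X ^ (p ^ 4 - p) * ?X ^ p)
        + Const (n0 * w) * (?X ^ (p ^ 4 - 1) * ?X ^ 1)"
        by (simp add: lo_def poly_monom power_mult_distrib Const_mult Const_power mult_ac)
      then show ?thesis unfolding e[OF lt(1)] e[OF lt(2)] e[OF lt(3)] e[OF lt(4)]
        by (simp only: Const_add distrib_right)
    qed
    ultimately show ?thesis using kernel[OF w] by (simp add: algebra_simps)
  qed
  have "monom 1 (p ^ 4) - P + lo = 0"
    using root fin_W by (intro poly_vanish_card[OF _ _ deg]) auto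
  then have "P = monom 1 (p ^ 4) + lo" by (simp add: algebra_simps)
  then have "poly P yv = poly (monom 1 (p ^ 4) + lo) yv" by simp
  moreover have "poly P yv = Ny"
    by (simp add: P_def Ny_def poly_prod add.commute)
  ultimately show ?thesis by (simp add: lo_def poly_monom mult_ac)
qed

definition a where "a = r1 / r2"
definition b where "b = 1 / r2"
definition d where "d = r0 / r2"

lemma abd_nonzero: "a \<noteq> 0" "b \<noteq> 0"
  using r1 r2 by (simp_all add: a_def b_def)

text \<open>The translates of the four terms are \<open>w\<^sup>q\<close>, \<open>a w\<^sup>p\<close>, \<open>- b phi w\<close> and \<open>d w\<close> times \<open>x\<^sup>q\<close>, \<open>q = p\<^sup>2\<close>, and
  their sum vanishes by the formula for \<open>phi\<close>.\<close>

definition f1 :: "'a FV" where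
  "f1 = yv ^ p\<^sup>2 + Const a * yv ^ p * xv ^ (p\<^sup>2 - p) + Const b * delta * xv ^ (p\<^sup>2 - 2)
     + Const d * yv * xv ^ (p\<^sup>2 - 1)"

lemma act_delta: "act c e delta = delta - Const e * xv\<^sup>2"
  by (simp add: delta_def act_ring_simps Const_add Const_mult Const_power power2_eq_square algebra_simps)

lemma p_exps: "p < p\<^sup>2" "2 < p\<^sup>2" "3 \<le> p"
proof -
  show "p < p\<^sup>2" using p_gt_2 by (simp add: power2_eq_square)
  then show "2 < p\<^sup>2" using p_gt_2 by simp
  show "3 \<le> p" using p_gt_2 by simp
qed

lemma f1_Inv: "f1 \<in> Inv"
  unfolding Inv_def
proof (intro CollectI ballI)
  fix w assume w: "w \<in> W"
  let ?X = "xv :: 'a FV"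
  have e: "?X ^ p * ?X ^ (p\<^sup>2 - p) = ?X ^ p\<^sup>2" "?X\<^sup>2 * ?X ^ (p\<^sup>2 - 2) = ?X ^ p\<^sup>2"
    "?X * ?X ^ (p\<^sup>2 - 1) = ?X ^ p\<^sup>2"
  proof -
    have "p + (p\<^sup>2 - p) = p\<^sup>2" "2 + (p\<^sup>2 - 2) = p\<^sup>2" "Suc (p\<^sup>2 - 1) = p\<^sup>2"
      using p_exps by auto
    then show "?X ^ p * ?X ^ (p\<^sup>2 - p) = ?X ^ p\<^sup>2" "?X\<^sup>2 * ?X ^ (p\<^sup>2 - 2) = ?X ^ p\<^sup>2"
      "?X * ?X ^ (p\<^sup>2 - 1) = ?X ^ p\<^sup>2"
      by (metis power_add power_Suc)+
  qed
  have "act w (phi w) f1 = (yv ^ p\<^sup>2 + Const w ^ p\<^sup>2 * ?X ^ p\<^sup>2)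
      + Const a * (yv ^ p + Const w ^ p * ?X ^ p) * ?X ^ (p\<^sup>2 - p)
      + Const b * (delta - Const (phi w) * ?X\<^sup>2) * ?X ^ (p\<^sup>2 - 2)
      + Const d * (yv + Const w * ?X) * ?X ^ (p\<^sup>2 - 1)"
    by (simp add: f1_def act_ring_simps act_delta frob frob1 power_mult_distrib)
  also have "\<dots> = f1 + (Const w ^ p\<^sup>2 * ?X ^ p\<^sup>2 + Const a * Const w ^ p * (?X ^ p * ?X ^ (p\<^sup>2 - p))
      - Const b * Const (phi w) * (?X\<^sup>2 * ?X ^ (p\<^sup>2 - 2)) + Const d * Const w * (?X * ?X ^ (p\<^sup>2 - 1)))"
    by (simp add: f1_def algebra_simps)
  also have "\<dots> = f1 + Const (w ^ p\<^sup>2 + a * w ^ p - b * phi w + d * w) * ?X ^ p\<^sup>2"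
    unfolding e by (simp add: Const_add Const_mult Const_minus Const_power algebra_simps)
  also have "w ^ p\<^sup>2 + a * w ^ p - b * phi w + d * w = 0"
    using r2 by (simp add: phi[OF w] a_def b_def d_def field_simps)
  finally show "act w (phi w) f1 = f1" by simp
qed

definition m where "m = p\<^sup>2 - p"

text \<open>The part of \<open>f1\<close> after its lead term is \<open>x\<^sup>m g\<close>. Since \<open>g\<close> is again of the shape of a linear
  combination of \<open>y\<^sup>p\<close>, \<open>delta\<close> and \<open>y\<close>, its \<open>p\<close>-th powers are computed termwise; \<open>gd\<close> is its monic
  multiple.\<close>

definition gd :: "'a FV" where
  "gd = yv ^ p + Const (b / a) * delta * xv ^ (p - 2) + Const (d / a) * yv * xv ^ (p - 1)"

definition g :: "'a FV" where
  "g = Const a * yv ^ p + Const b * delta * xv ^ (p - 2) + Const d * yv * xv ^ (p - 1)"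

lemma m_p: "p\<^sup>2 = m + p" "p \<le> m" "3 \<le> m"
proof -
  show *: "p\<^sup>2 = m + p" using p_exps by (simp add: m_def)
  have "3 * p \<le> p * p" using p_exps(3) by (rule mult_right_mono) simp
  then show "p \<le> m" using * unfolding power2_eq_square by linarith
  then show "3 \<le> m" using p_exps by simp
qed

lemma g_gd: "g = Const a * gd"
proof -
  have "Const a * Const (b / a) = (Const b :: 'a FV)" "Const a * Const (d / a) = (Const d :: 'a FV)"
    using abd_nonzero by (simp_all flip: Const_mult)
  then show ?thesis by (simp add: g_def gd_def distrib_left mult.assoc[symmetric])
qed

lemma f1_eq: "f1 = yv ^ p\<^sup>2 + xv ^ m * g"
proof -
  have "p\<^sup>2 - p = m" "p\<^sup>2 - 2 = m + (p - 2)" "p\<^sup>2 - 1 = m + (p - 1)"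
    using m_p p_exps by (simp_all add: m_def)
  then show ?thesis by (simp add: f1_def g_def power_add algebra_simps)
qed

lemma hom_deg_gd: "hom_deg p gd"
  unfolding gd_def
proof (intro hom_deg_add)
  show "hom_deg p (yv ^ p)" by (rule hom_deg_Var_power)
  show "hom_deg p (Const (b / a) * delta * xv ^ (p - 2))"
    by (rule hom_deg_eqI[OF hom_deg_mult[OF hom_deg_Const_mult[OF hom_deg_delta] hom_deg_Var_power]])
       (use p_gt_2 in simp)
  show "hom_deg p (Const (d / a) * yv * xv ^ (p - 1))"
    by (rule hom_deg_eqI[OF hom_deg_mult[OF hom_deg_Const_mult[OF hom_deg_Var] hom_deg_Var_power]])
       (use p_gt_2 in simp)
qed

lemma hom_deg_g: "hom_deg p g"
  unfolding g_gd by (rule hom_deg_Const_mult[OF hom_deg_gd])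

lemma zdeg_gd: "zdeg_le 1 gd"
  unfolding gd_def
  by (intro zdeg_le_add zdeg_le_free_power zdeg_le_mult_free zdeg_delta zdeg_le_Const zdeg_le_Var)

lemma zdeg_g: "zdeg_le 1 g"
  unfolding g_gd by (intro zdeg_le_mult_free zdeg_gd zdeg_le_Const)

lemma hom_deg_f1: "hom_deg (p\<^sup>2) f1"
  unfolding f1_eq
proof (rule hom_deg_add[OF hom_deg_Var_power])
  show "hom_deg (p\<^sup>2) (xv ^ m * g)"
    by (rule hom_deg_eqI[OF hom_deg_mult[OF hom_deg_Var_power hom_deg_g]]) (simp add: m_p)
qed

lemma zdeg_f1: "zdeg_le 1 f1"
  unfolding f1_eq
  by (intro zdeg_le_add zdeg_le_free_power zdeg_le_mult_free zdeg_g zdeg_le_Var)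

definition al1 where "al1 = a ^ p\<^sup>2 - n3"
definition al2 where "al2 = b ^ p\<^sup>2"

definition h2t :: "'a FV" where
  "h2t = Ny - f1 ^ p\<^sup>2 + Const al1 * f1 ^ p * xv ^ (p ^ 4 - p ^ 3)
     + Const al2 * f1\<^sup>2 * xv ^ (p ^ 4 - 2 * p\<^sup>2)"

text \<open>\<open>E\<close> collects the terms of \<open>h2t\<close> that keep an additional factor \<open>x\<^sup>p\<close>. The quotient of \<open>h2t\<close> by
  its power of \<open>x\<close> is written out as \<open>h2\<close>, with its unique term of highest degree in \<open>z\<close> apart from
  the rest \<open>L'\<close>.\<close>

definition E :: "'a FV" where
  "E = Const (n2 - d ^ p\<^sup>2) * yv ^ p\<^sup>2 + Const al1 * g ^ p + Const n1 * yv ^ p * xv ^ m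
     + Const n0 * yv * xv ^ (p\<^sup>2 - 1)"

definition L' :: "'a FV" where
  "L' = Const (1 / (2 * a)) * (xv ^ (m - p) * g\<^sup>2) + Const (1 / (2 * a * b ^ p\<^sup>2)) * E"

definition h2 :: "'a FV" where
  "h2 = yv ^ p\<^sup>2 * gd + xv ^ p * (Const (1 / (2 * a)) * zv ^ p\<^sup>2 + L')"

lemma p_pow: "p ^ 3 = p\<^sup>2 * p" "p ^ 4 = p\<^sup>2 * p\<^sup>2"
  by (simp_all add: power2_eq_square power3_eq_cube power4_eq_xxxx)

text \<open>The powers of \<open>y\<close> alone cancel by the choice of the coefficients \<open>al1\<close> and \<open>al2\<close>; what
  remains of the square of \<open>f1\<close> starts with the mixed term \<open>2 y\<^sup>q x\<^sup>m g\<close>, \<open>q = p\<^sup>2\<close>.\<close>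

lemma h2t_eq: "h2t = Const (2 * a * b ^ p\<^sup>2) * xv ^ (p ^ 4 - p\<^sup>2 - p) * h2"
proof -
  let ?X = "xv :: 'a FV"
  \<comment> \<open>All exponents of \<open>x\<close> are written as sums with the common part \<open>D\<close>.\<close>
  define D where "D = p ^ 4 - 2 * p\<^sup>2"
  have q3: "3 * p\<^sup>2 \<le> p ^ 3" using p_exps(3) by (simp add: p_pow)
  have q4: "3 * p ^ 3 \<le> p ^ 4" using p_exps(3) by (simp add: power4_eq_xxxx power3_eq_cube)
  have ex: "p ^ 4 - 2 * p\<^sup>2 = D" "p ^ 4 - p\<^sup>2 = D + m + p" "p ^ 4 - p = D + (m + p) + m"
    "p ^ 4 - 1 = D + (m + p) + (p\<^sup>2 - 1)" "p ^ 4 - p\<^sup>2 - p = D + m"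
  proof -
    have "p ^ 4 = D + 2 * p\<^sup>2" using q3 q4 unfolding D_def by linarith
    then show "p ^ 4 - 2 * p\<^sup>2 = D" "p ^ 4 - p\<^sup>2 = D + m + p" "p ^ 4 - p = D + (m + p) + m"
      "p ^ 4 - 1 = D + (m + p) + (p\<^sup>2 - 1)" "p ^ 4 - p\<^sup>2 - p = D + m"
      using m_p(1) p_exps by arith+
  qed
  have mp: "m * p = p ^ 3 - p\<^sup>2" "m * p\<^sup>2 = p ^ 4 - p ^ 3"
    by (simp_all add: m_def p_pow diff_mult_distrib power2_eq_square)
  have e3: "p ^ 4 - p ^ 3 + (p ^ 3 - p\<^sup>2) = D + m + p" "p ^ 4 - p ^ 3 + (p\<^sup>2 * (p - 2)) = D"
    "p ^ 4 - p ^ 3 + (p\<^sup>2 * (p - 1)) = D + m + p"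
  proof -
    have "p ^ 4 = D + 2 * p\<^sup>2" using q3 q4 unfolding D_def by linarith
    moreover have "p\<^sup>2 * (p - 2) = p ^ 3 - 2 * p\<^sup>2" "p\<^sup>2 * (p - 1) = p ^ 3 - p\<^sup>2"
      by (simp_all add: p_pow diff_mult_distrib2)
    ultimately show "p ^ 4 - p ^ 3 + (p ^ 3 - p\<^sup>2) = D + m + p" "p ^ 4 - p ^ 3 + (p\<^sup>2 * (p - 2)) = D"
      "p ^ 4 - p ^ 3 + (p\<^sup>2 * (p - 1)) = D + m + p"
      using q3 q4 m_p(1) by arith+
  qed
  define e where "e = p ^ 4 - p ^ 3"
  have gq: "g ^ p\<^sup>2 = Const (a ^ p\<^sup>2) * yv ^ p ^ 3
      + Const (b ^ p\<^sup>2) * (yv ^ p\<^sup>2 * yv ^ p\<^sup>2 - ?X ^ (m + p) * zv ^ p\<^sup>2) * ?X ^ (p\<^sup>2 * (p - 2))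
      + Const (d ^ p\<^sup>2) * yv ^ p\<^sup>2 * ?X ^ (p\<^sup>2 * (p - 1))"
  proof -
    have "delta ^ p\<^sup>2 = (yv * yv) ^ p\<^sup>2 - (?X * zv) ^ p\<^sup>2"
      unfolding delta_def frob_diff power2_eq_square[of "yv :: 'a FV"] ..
    then have dq: "delta ^ p\<^sup>2 = yv ^ p\<^sup>2 * yv ^ p\<^sup>2 - ?X ^ (m + p) * zv ^ p\<^sup>2"
      unfolding power_mult_distrib m_p(1)[symmetric] .
    have pw: "(u ^ k) ^ p\<^sup>2 = u ^ (p\<^sup>2 * k)" for u :: "'a FV" and k
      by (simp only: mult.commute flip: power_mult)
    show ?thesis
      unfolding g_def frob power_mult_distrib dq pw Const_power p_pow(1) ..
  qed
  have "f1 ^ p\<^sup>2 = yv ^ p ^ 4 + ?X ^ e * g ^ p\<^sup>2"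
    unfolding e_def mp(2)[symmetric] unfolding p_pow(2)
    by (simp only: f1_eq frob power_mult_distrib power_mult)
  also have "\<dots> = yv ^ p ^ 4 + Const (a ^ p\<^sup>2) * (yv ^ p ^ 3 * ?X ^ e)
      + Const (b ^ p\<^sup>2) * (yv ^ p\<^sup>2 * yv ^ p\<^sup>2 - ?X ^ (m + p) * zv ^ p\<^sup>2) * ?X ^ D
      + Const (d ^ p\<^sup>2) * yv ^ p\<^sup>2 * ?X ^ (D + m + p)"
  proof -
    define u where "u = ?X ^ (p\<^sup>2 * (p - 2))"
    define v where "v = ?X ^ (p\<^sup>2 * (p - 1))"
    have u: "?X ^ D = ?X ^ e * u" and v: "?X ^ (D + m + p) = ?X ^ e * v"
      unfolding u_def v_def power_add[symmetric] e_def e3(2,3) by (rule refl)+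
    show ?thesis unfolding gq u_def[symmetric] v_def[symmetric] u v by (simp add: algebra_simps)
  qed
  finally have f1q: "f1 ^ p\<^sup>2 = yv ^ p ^ 4 + Const (a ^ p\<^sup>2) * (yv ^ p ^ 3 * ?X ^ e)
      + Const (b ^ p\<^sup>2) * (yv ^ p\<^sup>2 * yv ^ p\<^sup>2 - ?X ^ (m + p) * zv ^ p\<^sup>2) * ?X ^ D
      + Const (d ^ p\<^sup>2) * yv ^ p\<^sup>2 * ?X ^ (D + m + p)" .
  have "f1 ^ p = yv ^ p ^ 3 + ?X ^ (m * p) * g ^ p"
    unfolding p_pow(1) by (simp only: f1_eq frob1 power_mult_distrib power_mult)
  then have "f1 ^ p * ?X ^ e = yv ^ p ^ 3 * ?X ^ e + ?X ^ (D + m + p) * g ^ p"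
    unfolding e3(1)[symmetric] mp e_def[symmetric] by (simp add: power_add algebra_simps)
  then have f1p: "Const al1 * f1 ^ p * ?X ^ e =
      Const al1 * (yv ^ p ^ 3 * ?X ^ e) + Const al1 * (?X ^ (D + m + p) * g ^ p)"
    by (simp only: mult.assoc distrib_left)
  have f1s: "f1\<^sup>2 = yv ^ p\<^sup>2 * yv ^ p\<^sup>2 + 2 * yv ^ p\<^sup>2 * ?X ^ m * g + ?X ^ m * ?X ^ m * g\<^sup>2"
    unfolding f1_eq by (simp add: power2_eq_square algebra_simps)
  have N: "Ny = yv ^ p ^ 4 + Const n3 * (yv ^ p ^ 3 * ?X ^ e)
     + Const n2 * yv ^ p\<^sup>2 * ?X ^ (D + m + p) + Const n1 * yv ^ p * ?X ^ (D + (m + p) + m)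
     + Const n0 * yv * ?X ^ (D + (m + p) + (p\<^sup>2 - 1))"
    unfolding Ny_eq e_def ex by (simp add: mult_ac)
  have lhs: "h2t = ?X ^ D * ?X ^ m * (Const (b ^ p\<^sup>2) * (2 * yv ^ p\<^sup>2 * g + ?X ^ m * g\<^sup>2 + ?X ^ p * zv ^ p\<^sup>2)
      + ?X ^ p * E)"
    unfolding h2t_def ex(1) e_def[symmetric] f1p f1q f1s N al2_def
    unfolding al1_def E_def by (simp add: power_add Const_minus algebra_simps)
  have mm: "?X ^ m = ?X ^ p * ?X ^ (m - p)" using m_p(2) by (simp flip: power_add)
  have c1: "Const (2 * a * b ^ p\<^sup>2) * gd = Const (b ^ p\<^sup>2) * (2 * g)"
    unfolding g_gd by (simp add: Const_mult mult_ac)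
  have c2: "Const (2 * a * b ^ p\<^sup>2) * Const (1 / (2 * a)) = (Const (b ^ p\<^sup>2) :: 'a FV)"
    "Const (2 * a * b ^ p\<^sup>2) * Const (1 / (2 * a * b ^ p\<^sup>2)) = (1 :: 'a FV)"
    using abd_nonzero two_nonzero by (simp_all flip: Const_mult)
  have "Const (2 * a * b ^ p\<^sup>2) * h2 = yv ^ p\<^sup>2 * (Const (2 * a * b ^ p\<^sup>2) * gd)
      + ?X ^ p * ((Const (2 * a * b ^ p\<^sup>2) * Const (1 / (2 * a))) * zv ^ p\<^sup>2
      + ((Const (2 * a * b ^ p\<^sup>2) * Const (1 / (2 * a))) * (?X ^ (m - p) * g\<^sup>2)
      + (Const (2 * a * b ^ p\<^sup>2) * Const (1 / (2 * a * b ^ p\<^sup>2))) * E))"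
    unfolding h2_def L'_def by (simp only: distrib_left mult.assoc mult.left_commute)
  also have "\<dots> = Const (b ^ p\<^sup>2) * (2 * yv ^ p\<^sup>2 * g + ?X ^ m * g\<^sup>2 + ?X ^ p * zv ^ p\<^sup>2) + ?X ^ p * E"
    unfolding c1 c2 mm by (simp add: algebra_simps)
  finally have rhs: "Const (2 * a * b ^ p\<^sup>2) * h2 =
      Const (b ^ p\<^sup>2) * (2 * yv ^ p\<^sup>2 * g + ?X ^ m * g\<^sup>2 + ?X ^ p * zv ^ p\<^sup>2) + ?X ^ p * E" .
  have "Const (2 * a * b ^ p\<^sup>2) * ?X ^ (D + m) * h2 = ?X ^ D * ?X ^ m * (Const (2 * a * b ^ p\<^sup>2) * h2)"
    by (simp add: power_add mult_ac)
  then show ?thesis unfolding ex(5) lhs rhs by simp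
qed

lemma hom_deg_E: "hom_deg (p\<^sup>2) E"
  unfolding E_def
proof (intro hom_deg_add hom_deg_Const_mult)
  show "hom_deg (p\<^sup>2) (yv ^ p\<^sup>2)" by (rule hom_deg_Var_power)
  show "hom_deg (p\<^sup>2) (g ^ p)"
    by (rule hom_deg_eqI[OF hom_deg_power[OF hom_deg_g]]) (simp add: power2_eq_square)
  show "hom_deg (p\<^sup>2) (Const n1 * yv ^ p * xv ^ m)"
    by (rule hom_deg_eqI[OF hom_deg_mult[OF hom_deg_Const_mult[OF hom_deg_Var_power] hom_deg_Var_power]])
       (simp add: m_p)
  show "hom_deg (p\<^sup>2) (Const n0 * yv * xv ^ (p\<^sup>2 - 1))"
    by (rule hom_deg_eqI[OF hom_deg_mult[OF hom_deg_Const_mult[OF hom_deg_Var] hom_deg_Var_power]])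
       (use p_exps in simp)
qed

lemma hom_deg_h2: "hom_deg (p\<^sup>2 + p) h2"
  unfolding h2_def
proof (intro hom_deg_add)
  show "hom_deg (p\<^sup>2 + p) (yv ^ p\<^sup>2 * gd)" by (intro hom_deg_mult hom_deg_Var_power hom_deg_gd)
  have "hom_deg (p\<^sup>2) (xv ^ (m - p) * g\<^sup>2)"
    by (rule hom_deg_eqI[OF hom_deg_mult[OF hom_deg_Var_power hom_deg_power[OF hom_deg_g]]])
       (use m_p in simp)
  then have "hom_deg (p + p\<^sup>2) (xv ^ p * (Const (1 / (2 * a)) * zv ^ p\<^sup>2 + L'))"
    unfolding L'_def
    by (intro hom_deg_mult hom_deg_add hom_deg_Const_mult hom_deg_Var_power hom_deg_E)
  then show "hom_deg (p\<^sup>2 + p) (xv ^ p * (Const (1 / (2 * a)) * zv ^ p\<^sup>2 + L'))"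
    by (simp add: add.commute)
qed

lemma zdeg_L': "zdeg_le p L'"
proof -
  have "zdeg_le (2 * 1) (g\<^sup>2)" by (rule zdeg_le_power[OF zdeg_g])
  then have g2: "zdeg_le p (g\<^sup>2)" by (rule zdeg_le_mono) (use p_gt_2 in simp)
  have "zdeg_le (p * 1) (g ^ p)" by (rule zdeg_le_power[OF zdeg_g])
  then have gp: "zdeg_le p (g ^ p)" by simp
  show ?thesis
    unfolding L'_def E_def
    by (intro zdeg_le_add zdeg_le_mult_free zdeg_le_free_power zdeg_le_Const zdeg_le_Var g2 gp)
qed

lemma h2_top_z:
  obtains h where "h2 = Const (1 / (2 * a)) * xv ^ p * zv ^ p\<^sup>2 + h" "zdeg_le p h"
proof
  show "h2 = Const (1 / (2 * a)) * xv ^ p * zv ^ p\<^sup>2 + (yv ^ p\<^sup>2 * gd + xv ^ p * L')"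
    by (simp add: h2_def algebra_simps)
  have "zdeg_le p gd" using zdeg_gd by (rule zdeg_le_mono) (use p_gt_2 in simp)
  then show "zdeg_le p (yv ^ p\<^sup>2 * gd + xv ^ p * L')"
    by (intro zdeg_le_add zdeg_le_mult_free(2) zdeg_le_free_power zdeg_le_Var zdeg_L')
qed

lemma Const_unit_Inv:
  assumes "c \<noteq> 0" "Const c * f \<in> Inv" shows "f \<in> Inv"
proof -
  have "(Const (inverse c) * Const c) * f = f"
    unfolding Const_mult[symmetric] using assms(1) by simp
  moreover have "Const (inverse c) * (Const c * f) \<in> Inv"
    by (rule subalgebra_mult[OF Inv_subalgebra subalgebra_Const[OF Inv_subalgebra] assms(2)])
  ultimately show ?thesis unfolding mult.assoc by (rule subst)
qed

lemma h2_Inv: "h2 \<in> Inv"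
proof -
  have "h2t \<in> Inv"
    unfolding h2t_def
    by (intro subalgebra_add subalgebra_diff subalgebra_mult subalgebra_power subalgebra_Const
        Inv_subalgebra Ny_Inv f1_Inv xv_Inv)
  then have "xv ^ (p ^ 4 - p\<^sup>2 - p) * (Const (2 * a * b ^ p\<^sup>2) * h2) \<in> Inv"
    unfolding h2t_eq by (simp only: mult.assoc mult.left_commute)
  then have "Const (2 * a * b ^ p\<^sup>2) * h2 \<in> Inv" by (rule Inv_cancel_xv)
  moreover have "2 * a * b ^ p\<^sup>2 \<noteq> 0" using abd_nonzero two_nonzero by simp
  ultimately show ?thesis by (rule Const_unit_Inv[rotated])
qed

end

subsection \<open>Congruences modulo powers of x\<close>

definition xcong :: "nat \<Rightarrow> 'a::comm_ring_1 FV \<Rightarrow> 'a FV \<Rightarrow> bool" where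
  "xcong k u v \<longleftrightarrow> xv ^ k dvd u - v"

lemma xcong_refl [simp]: "xcong k u u"
  by (simp add: xcong_def)

lemma xcong_trans: "xcong k u v \<Longrightarrow> xcong k v w \<Longrightarrow> xcong k u w"
  unfolding xcong_def using dvd_add[of "xv ^ k" "u - v" "v - w"] by simp

lemma xcong_mono: "xcong k u v \<Longrightarrow> l \<le> k \<Longrightarrow> xcong l u v"
  unfolding xcong_def using le_imp_power_dvd dvd_trans by blast

lemma xcong_add: "xcong k u v \<Longrightarrow> xcong k u' v' \<Longrightarrow> xcong k (u + u') (v + v')"
  unfolding xcong_def using dvd_add[of "xv ^ k" "u - v" "u' - v'"] by (simp add: algebra_simps)

lemma xcong_diff: "xcong k u v \<Longrightarrow> xcong k u' v' \<Longrightarrow> xcong k (u - u') (v - v')"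
  unfolding xcong_def using dvd_diff[of "xv ^ k" "u - v" "u' - v'"] by (simp add: algebra_simps)

lemma xcong_mult:
  assumes "xcong k u v" "xcong k u' v'"
  shows "xcong k (u * u') (v * v')"
proof -
  have "u * u' - v * v' = (u - v) * u' + v * (u' - v')" by (simp add: algebra_simps)
  then show ?thesis using assms unfolding xcong_def by simp
qed

lemma xcong_power: "xcong k u v \<Longrightarrow> xcong k (u ^ n) (v ^ n)"
  by (induction n) (auto intro: xcong_mult)

lemma xcong_shift: "xcong k u v \<Longrightarrow> xcong (k + j) (u * xv ^ j) (v * xv ^ j)"
  unfolding xcong_def using mult_dvd_mono[of "xv ^ k" "u - v" "xv ^ j" "xv ^ j"]
  by (simp add: power_add left_diff_distrib)

lemma xcongI: "u - v = xv ^ k * w \<Longrightarrow> xcong k u v"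
  by (simp add: xcong_def)

lemma xv_nonzero [simp]: "xv \<noteq> (0 :: 'a::field FV)"
  using xv_power_nonzero[of 1] unfolding power_one_right .

lemma zdeg_le_cancel_xv:
  assumes "zdeg_le n (xv ^ k * f)" shows "zdeg_le n (f :: 'a::field FV)"
  unfolding zdeg_le_def
proof
  fix l assume "l \<in> mons f"
  from mons_xv_power_multI[OF this, of k] assms
  have "expo (xyzm (k + expo l VX) (expo l VY) (expo l VZ)) VZ \<le> n"
    unfolding zdeg_le_def by blast
  then show "expo l VZ \<le> n" by simp
qed

context linearized_family
begin

definition be where "be = b / a"

text \<open>\<open>be\<close> is the quotient of minors in the definition of the third invariant, and \<open>s\<close> and \<open>e\<close> are
  the exponents of \<open>x\<close> in its numerator and denominator. Congruences modulo \<open>x\<^sup>e\<close> times \<open>x\<close> determine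
  its lead term.\<close>

definition s where "s = p\<^sup>2 - 2 * p"

definition e where "e = p\<^sup>2 - p - 2"

lemma exps: "s = (p - 2) * p" "e + 2 = (p - 1) * p" "s + (p - 2) = e" "s + (p - 1) = e + 1"
  "m = e + 2" "p\<^sup>2 = e + (p + 2)" "s > 0" "e > 0"
proof -
  have q: "3 * p \<le> p\<^sup>2" using p_exps(3) by (simp add: power2_eq_square)
  show "s = (p - 2) * p" by (simp add: s_def power2_eq_square diff_mult_distrib)
  have "(p - 1) * p = p\<^sup>2 - p" by (simp add: power2_eq_square diff_mult_distrib)
  then show "e + 2 = (p - 1) * p" using q p_exps unfolding e_def by linarith
  show "s + (p - 2) = e" "s + (p - 1) = e + 1" "m = e + 2" "p\<^sup>2 = e + (p + 2)" "s > 0" "e > 0"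
    using q p_exps unfolding s_def e_def m_def by linarith+
qed

lemma be_nonzero: "be \<noteq> 0"
  using abd_nonzero by (simp add: be_def)

definition h3t :: "'a FV" where
  "h3t = f1 ^ (p + 1) - h2 ^ p + Const (be ^ p) * f1 ^ (p - 2) * h2\<^sup>2 * xv ^ s"

abbreviation Y :: "'a FV" where "Y \<equiv> yv ^ p\<^sup>2"

lemma f1_cong: "xcong m f1 Y"
  by (rule xcongI[of _ _ _ g]) (simp add: f1_eq)

text \<open>Raising to the power \<open>p\<close> moves the error terms beyond \<open>x\<^sup>e\<close>; only \<open>y\<^sup>p\<close> and the term of \<open>delta\<close>
  in \<open>gd\<close> survive.\<close>

lemma h2_power_cong: "xcong (e + 1) (h2 ^ p) (Y ^ p * (Y + Const (be ^ p) * (yv ^ p)\<^sup>2 * xv ^ s))"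
proof -
  define L where "L = Const (1 / (2 * a)) * zv ^ p\<^sup>2 + L'"
  have yp: "(yv ^ p) ^ p = Y" by (simp add: power2_eq_square flip: power_mult)
  have xp: "(xv ^ p) ^ p = xv ^ (e + 1) * (xv ^ (p + 1) :: 'a FV)"
    using exps(6) by (simp add: power2_eq_square flip: power_mult power_add)
  have xs: "(xv ^ (p - 2)) ^ p = (xv ^ s :: 'a FV)" "(xv ^ (p - 1)) ^ p = xv ^ (e + 1) * (xv :: 'a FV)"
    "(xv :: 'a FV) ^ p * xv ^ s = xv ^ (e + 1) * (xv :: 'a FV)"
  proof -
    show "(xv ^ (p - 2)) ^ p = (xv ^ s :: 'a FV)" by (simp only: exps(1) flip: power_mult)
    show "(xv ^ (p - 1)) ^ p = xv ^ (e + 1) * (xv :: 'a FV)"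
      unfolding power_mult[symmetric] exps(2)[symmetric] by (simp add: mult_ac)
    have "p + s = Suc (e + 1)" using exps(4) p_gt_2 by linarith
    then show "(xv :: 'a FV) ^ p * xv ^ s = xv ^ (e + 1) * (xv :: 'a FV)"
      by (simp only: power_Suc2 flip: power_add)
  qed
  have "delta ^ p = (yv * yv) ^ p - (xv * zv :: 'a FV) ^ p"
    unfolding delta_def frob1_diff power2_eq_square ..
  then have dp: "delta ^ p = (yv ^ p)\<^sup>2 - xv ^ p * (zv ^ p :: 'a FV)"
    by (simp only: power_mult_distrib power2_eq_square)
  have gp: "gd ^ p = Y + Const (be ^ p) * ((yv ^ p)\<^sup>2 - xv ^ p * zv ^ p) * xv ^ s
      + Const ((d / a) ^ p) * yv ^ p * (xv ^ (e + 1) * xv)"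
    unfolding gd_def frob1 power_mult_distrib dp xs yp be_def Const_power ..
  have "h2 ^ p - Y ^ p * (Y + Const (be ^ p) * (yv ^ p)\<^sup>2 * xv ^ s) =
      xv ^ (e + 1) * (Y ^ p * (Const ((d / a) ^ p) * yv ^ p * xv - Const (be ^ p) * zv ^ p * xv)
        + xv ^ (p + 1) * L ^ p)"
  proof -
    have "h2 ^ p = Y ^ p * gd ^ p + (xv ^ p) ^ p * L ^ p"
      by (simp only: h2_def frob1 power_mult_distrib flip: L_def)
    also have "gd ^ p = Y + Const (be ^ p) * (yv ^ p)\<^sup>2 * xv ^ s - Const (be ^ p) * zv ^ p * (xv ^ p * xv ^ s)
      + Const ((d / a) ^ p) * yv ^ p * (xv ^ (e + 1) * xv)"
      unfolding gp by (simp add: algebra_simps)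
    finally show ?thesis unfolding xp xs(3) by (simp add: algebra_simps)
  qed
  then show ?thesis by (rule xcongI)
qed

lemma h2_cong: "xcong (p - 1) h2 (Y * (yv ^ p + Const be * yv\<^sup>2 * xv ^ (p - 2)))"
proof -
  have x1: "xv ^ p = xv ^ (p - 1) * (xv :: 'a FV)" "xv ^ (p - 1) = xv ^ (p - 2) * (xv :: 'a FV)"
    using power_minus_mult[of p "xv :: 'a FV"] power_minus_mult[of "p - 1" "xv :: 'a FV"] p_gt_2
    by (simp_all add: numeral_2_eq_2)
  have "h2 - Y * (yv ^ p + Const be * yv\<^sup>2 * xv ^ (p - 2)) =
    Y * (Const (d / a) * yv * xv ^ (p - 1) - Const be * zv * (xv ^ (p - 2) * xv))
      + xv ^ p * (Const (1 / (2 * a)) * zv ^ p\<^sup>2 + L')"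
    unfolding h2_def gd_def be_def delta_def by (simp add: algebra_simps)
  also have "\<dots> = xv ^ (p - 1) * (Y * (Const (d / a) * yv - Const be * zv)
      + xv * (Const (1 / (2 * a)) * zv ^ p\<^sup>2 + L'))"
    unfolding x1(1) x1(2)[symmetric] by (simp add: algebra_simps)
  finally show ?thesis by (rule xcongI)
qed

text \<open>The pure powers of \<open>y\<close> and the terms with \<open>x\<^sup>s\<close> cancel; the cross term of \<open>h2\<^sup>2\<close>, which carries
  \<open>2 be\<close>, is the first that survives.\<close>

lemma h3t_cong: "xcong (e + 1) h3t (Const (2 * be ^ (p + 1)) * yv ^ (p ^ 3 + p + 2) * xv ^ e)"
proof -
  define t where "t = Const be * yv\<^sup>2 * (xv ^ (p - 2) :: 'a FV)"
  have "t\<^sup>2 = Const (be\<^sup>2) * (yv\<^sup>2)\<^sup>2 * xv ^ ((p - 2) * 2)"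
    unfolding t_def power_mult_distrib Const_power power_mult ..
  moreover have "(p - 2) * 2 = (p - 1) + (p - 3)" using p_gt_2 by simp
  ultimately have t2: "t\<^sup>2 = xv ^ (p - 1) * (Const (be\<^sup>2) * (yv\<^sup>2)\<^sup>2 * xv ^ (p - 3))"
    by (simp add: power_add mult_ac)
  have "xcong (p - 1) (h2\<^sup>2) ((Y * (yv ^ p + t))\<^sup>2)"
    unfolding t_def by (rule xcong_power[OF h2_cong])
  moreover have "xcong (p - 1) ((Y * (yv ^ p + t))\<^sup>2) (Y\<^sup>2 * ((yv ^ p)\<^sup>2 + 2 * yv ^ p * t))"
  proof -
    have "(Y * (yv ^ p + t))\<^sup>2 - Y\<^sup>2 * ((yv ^ p)\<^sup>2 + 2 * yv ^ p * t) = Y\<^sup>2 * t\<^sup>2"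
      unfolding power_mult_distrib power2_sum by (simp add: algebra_simps)
    then show ?thesis unfolding xcong_def t2 by (simp add: dvd_mult)
  qed
  ultimately have h2s: "xcong (p - 1) (h2\<^sup>2) (Y\<^sup>2 * ((yv ^ p)\<^sup>2 + 2 * yv ^ p * t))"
    by (rule xcong_trans)
  have "xcong (p - 1) (f1 ^ (p - 2)) (Y ^ (p - 2))"
    by (rule xcong_mono[OF xcong_power[OF f1_cong]]) (use m_p in simp)
  then have "xcong (p - 1) (Const (be ^ p) * f1 ^ (p - 2) * h2\<^sup>2)
      (Const (be ^ p) * Y ^ (p - 2) * (Y\<^sup>2 * ((yv ^ p)\<^sup>2 + 2 * yv ^ p * t)))"
    by (intro xcong_mult h2s xcong_refl)
  then have "xcong (p - 1 + s) (Const (be ^ p) * f1 ^ (p - 2) * h2\<^sup>2 * xv ^ s)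
      (Const (be ^ p) * Y ^ (p - 2) * (Y\<^sup>2 * ((yv ^ p)\<^sup>2 + 2 * yv ^ p * t)) * xv ^ s)"
    by (rule xcong_shift)
  moreover have "p - 1 + s = e + 1" using exps(4) by simp
  ultimately have 3: "xcong (e + 1) (Const (be ^ p) * f1 ^ (p - 2) * h2\<^sup>2 * xv ^ s)
      (Const (be ^ p) * Y ^ (p - 2) * (Y\<^sup>2 * ((yv ^ p)\<^sup>2 + 2 * yv ^ p * t)) * xv ^ s)"
    by simp
  have 1: "xcong (e + 1) (f1 ^ (p + 1)) (Y ^ (p + 1))"
    by (rule xcong_mono[OF xcong_power[OF f1_cong]]) (simp add: exps)
  have "xcong (e + 1) h3t (Y ^ (p + 1) - Y ^ p * (Y + Const (be ^ p) * (yv ^ p)\<^sup>2 * xv ^ s)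
      + Const (be ^ p) * Y ^ (p - 2) * (Y\<^sup>2 * ((yv ^ p)\<^sup>2 + 2 * yv ^ p * t)) * xv ^ s)"
    unfolding h3t_def by (intro xcong_add xcong_diff 1 h2_power_cong 3)
  also have "Y ^ (p + 1) - Y ^ p * (Y + Const (be ^ p) * (yv ^ p)\<^sup>2 * xv ^ s)
      + Const (be ^ p) * Y ^ (p - 2) * (Y\<^sup>2 * ((yv ^ p)\<^sup>2 + 2 * yv ^ p * t)) * xv ^ s =
      Const (2 * be ^ (p + 1)) * yv ^ (p ^ 3 + p + 2) * xv ^ e"
  proof -
    have "p - 2 + 2 = p" using p_gt_2 by simp
    then have Yp: "Y ^ (p - 2) * Y\<^sup>2 = Y ^ p" by (simp only: power_add[symmetric])
    have "Y ^ (p + 1) - Y ^ p * (Y + Const (be ^ p) * (yv ^ p)\<^sup>2 * xv ^ s)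
      + Const (be ^ p) * Y ^ (p - 2) * (Y\<^sup>2 * ((yv ^ p)\<^sup>2 + 2 * yv ^ p * t)) * xv ^ s =
      Const (be ^ p) * ((Y ^ (p - 2) * Y\<^sup>2) * ((yv ^ p)\<^sup>2 + 2 * yv ^ p * t)) * xv ^ s
      - Y ^ p * (Const (be ^ p) * (yv ^ p)\<^sup>2 * xv ^ s)"
      by (simp add: algebra_simps)
    also have "\<dots> = 2 * Const (be ^ p) * Y ^ p * yv ^ p * (t * xv ^ s)"
      unfolding Yp by (simp add: algebra_simps)
    also have "t * xv ^ s = Const be * yv\<^sup>2 * xv ^ e"
      unfolding t_def exps(3)[symmetric] by (simp add: power_add mult_ac)
    also have "2 * Const (be ^ p) * Y ^ p * yv ^ p * (Const be * yv\<^sup>2 * xv ^ e) =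
        Const (2 * be ^ (p + 1)) * (Y ^ p * yv ^ p * yv\<^sup>2) * xv ^ e"
      by (simp add: Const_mult mult_ac)
    also have "Y ^ p * yv ^ p * yv\<^sup>2 = yv ^ (p ^ 3 + p + 2)"
      by (simp only: p_pow(1) power_add power_mult)
    finally show ?thesis .
  qed
  finally show ?thesis .
qed

definition h3 :: "'a FV" where
  "h3 = (SOME h. h3t = Const (2 * be ^ (p + 1)) * xv ^ e * h)"

lemma h3_coeff_nonzero: "2 * be ^ (p + 1) \<noteq> 0"
  using two_nonzero be_nonzero by simp

lemma h3t_eq: "h3t = Const (2 * be ^ (p + 1)) * xv ^ e * h3"
  and h3_cong: "xcong 1 h3 (yv ^ (p ^ 3 + p + 2))"
proof -
  define c where "c = 2 * be ^ (p + 1)"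
  have c0: "c \<noteq> 0" unfolding c_def by (rule h3_coeff_nonzero)
  obtain Z where Z: "h3t - Const c * yv ^ (p ^ 3 + p + 2) * xv ^ e = xv ^ (e + 1) * Z"
    using h3t_cong unfolding xcong_def c_def by (rule dvdE)
  define h where "h = yv ^ (p ^ 3 + p + 2) + xv * (Const (inverse c) * Z)"
  have "Const c * xv ^ e * h = Const c * yv ^ (p ^ 3 + p + 2) * xv ^ e
      + (Const c * Const (inverse c)) * (xv ^ (e + 1) * Z)"
    by (simp add: h_def algebra_simps)
  also have "\<dots> = h3t" unfolding Const_cancel[OF c0] using Z by (simp add: algebra_simps)
  finally have h: "h3t = Const c * xv ^ e * h" by simp
  then show eq: "h3t = Const (2 * be ^ (p + 1)) * xv ^ e * h3"
    unfolding c_def h3_def by (rule someI)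
  have "Const c * xv ^ e \<noteq> 0" using c0 by simp
  then have "h3 = h" using eq h unfolding c_def[symmetric] by (metis mult_left_cancel)
  then show "xcong 1 h3 (yv ^ (p ^ 3 + p + 2))"
    by (intro xcongI[of _ _ _ "Const (inverse c) * Z"]) (simp add: h_def)
qed

lemma hom_deg_h3: "hom_deg (p ^ 3 + p + 2) h3"
proof -
  have "hom_deg (p ^ 3 + p\<^sup>2) h3t"
    unfolding h3t_def
  proof (intro hom_deg_add hom_deg_diff)
    show "hom_deg (p ^ 3 + p\<^sup>2) (f1 ^ (p + 1))"
      by (rule hom_deg_eqI[OF hom_deg_power[OF hom_deg_f1]]) (simp add: p_pow)
    show "hom_deg (p ^ 3 + p\<^sup>2) (h2 ^ p)"
      by (rule hom_deg_eqI[OF hom_deg_power[OF hom_deg_h2]])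
         (simp add: power2_eq_square power3_eq_cube distrib_left)
    have "(p - 2) * p\<^sup>2 + 2 * (p\<^sup>2 + p) + s = p ^ 3 + p\<^sup>2"
    proof -
      have "2 * p \<le> p\<^sup>2" "2 * p\<^sup>2 \<le> p ^ 3" using p_gt_2 by (simp_all add: power2_eq_square power3_eq_cube)
      moreover have "(p - 2) * p\<^sup>2 = p ^ 3 - 2 * p\<^sup>2"
        by (simp add: diff_mult_distrib power2_eq_square power3_eq_cube)
      ultimately show ?thesis unfolding s_def by simp
    qed
    then show "hom_deg (p ^ 3 + p\<^sup>2) (Const (be ^ p) * f1 ^ (p - 2) * h2\<^sup>2 * xv ^ s)"
      by (rule hom_deg_eqI[OF hom_deg_mult[OF hom_deg_mult[OF hom_deg_Const_mult[OF hom_deg_power[OF hom_deg_f1]]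
          hom_deg_power[OF hom_deg_h2]] hom_deg_Var_power]])
  qed
  moreover have "p ^ 3 + p\<^sup>2 = e + (p ^ 3 + p + 2)" using exps(6) by simp
  ultimately have "hom_deg (e + (p ^ 3 + p + 2)) (Const (inverse (2 * be ^ (p + 1))) * h3t)"
    by (simp add: hom_deg_Const_mult)
  also have "Const (inverse (2 * be ^ (p + 1))) * h3t =
      (Const (2 * be ^ (p + 1)) * Const (inverse (2 * be ^ (p + 1)))) * (xv ^ e * h3)"
    by (simp only: h3t_eq mult_ac)
  finally show ?thesis
    unfolding Const_cancel[OF h3_coeff_nonzero] mult_1 by (rule hom_deg_cancel_xv_power)
qed

text \<open>The coefficient of the highest power of \<open>z\<close> in \<open>h3\<close>. It comes from the summand \<open>h2\<^sup>p\<close>, whose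
  degree \<open>p\<^sup>3\<close> in \<open>z\<close> exceeds that of the other two.\<close>

definition kap where "kap = - ((1 / (2 * a)) ^ p) / (2 * be ^ (p + 1))"

lemma kap_nonzero: "kap \<noteq> 0"
  using h3_coeff_nonzero abd_nonzero two_nonzero by (simp add: kap_def)

lemma zdeg_h2: "zdeg_le (p\<^sup>2) h2"
proof -
  obtain h where h: "h2 = Const (1 / (2 * a)) * xv ^ p * zv ^ p\<^sup>2 + h" "zdeg_le p h"
    by (rule h2_top_z)
  show ?thesis
    unfolding h(1)
  proof (rule zdeg_le_add)
    have "zdeg_le 0 (Const (1 / (2 * a)) * xv ^ p)"
      by (intro zdeg_le_mult_free(2) zdeg_le_free_power zdeg_le_Const zdeg_le_Var)
    moreover have "zdeg_le (p\<^sup>2) (zv ^ p\<^sup>2 :: 'a FV)"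
      using zdeg_le_power[OF zdeg_le_Var(3), of "p\<^sup>2"] by simp
    ultimately show "zdeg_le (p\<^sup>2) (Const (1 / (2 * a)) * xv ^ p * zv ^ p\<^sup>2)"
      by (rule zdeg_le_mult_free(2))
    show "zdeg_le (p\<^sup>2) h" by (rule zdeg_le_mono[OF h(2)]) (use p_exps in simp)
  qed
qed

lemma h3_top_z:
  obtains h where "h3 = Const kap * xv ^ (p + 2) * zv ^ p ^ 3 + h" "zdeg_le (p ^ 3 - 1) h"
proof -
  obtain h where h: "h2 = Const (1 / (2 * a)) * xv ^ p * zv ^ p\<^sup>2 + h" "zdeg_le p h"
    by (rule h2_top_z)
  define c where "c = (1 / (2 * a)) ^ p"
  define R where "R = f1 ^ (p + 1) - h ^ p + Const (be ^ p) * f1 ^ (p - 2) * h2\<^sup>2 * xv ^ s"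
  have h2p: "h2 ^ p = Const c * xv ^ p\<^sup>2 * zv ^ p ^ 3 + h ^ p"
    unfolding h(1) frob1 power_mult_distrib c_def Const_power p_pow(1) power2_eq_square power_mult ..
  have ple: "p + 1 \<le> p ^ 3 - 1" "p * p \<le> p ^ 3 - 1" "p - 2 + 2 * p\<^sup>2 \<le> p ^ 3 - 1"
  proof -
    have "3 * p \<le> p\<^sup>2" using p_exps(3) by (simp add: power2_eq_square)
    moreover have "3 * p\<^sup>2 \<le> p ^ 3" using p_exps(3) by (simp add: p_pow)
    moreover have "p * p = p\<^sup>2" by (simp add: power2_eq_square)
    ultimately show "p + 1 \<le> p ^ 3 - 1" "p * p \<le> p ^ 3 - 1" "p - 2 + 2 * p\<^sup>2 \<le> p ^ 3 - 1"
      using p_gt_2 by linarith+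
  qed
  have zf1: "zdeg_le n (f1 ^ k)" if "k \<le> n" for n k
    using zdeg_le_power[OF zdeg_f1, of k] that by (auto intro: zdeg_le_mono)
  have "zdeg_le (2 * p\<^sup>2) (h2\<^sup>2)" by (rule zdeg_le_power[OF zdeg_h2])
  then have "zdeg_le (p - 2 + 2 * p\<^sup>2) (f1 ^ (p - 2) * h2\<^sup>2)" by (intro zdeg_le_mult zf1) simp
  then have z3: "zdeg_le (p ^ 3 - 1) (f1 ^ (p - 2) * h2\<^sup>2)" using ple(3) by (rule zdeg_le_mono)
  have "zdeg_le (p ^ 3 - 1) (Const (be ^ p) * (f1 ^ (p - 2) * h2\<^sup>2) * xv ^ s)"
    by (rule zdeg_le_mult_free(1)[OF zdeg_le_free_power[OF zdeg_le_Var(1)] zdeg_le_mult_free(2)[OF zdeg_le_Const z3]])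
  then have zR: "zdeg_le (p ^ 3 - 1) R"
    unfolding R_def mult.assoc
    using zf1[OF ple(1)] zdeg_le_mono[OF zdeg_le_power[OF h(2)] ple(2)]
    by (intro zdeg_le_add zdeg_le_diff) (simp_all add: mult.assoc)
  have "h3t = R - Const c * xv ^ p\<^sup>2 * zv ^ p ^ 3"
    unfolding h3t_def h2p R_def by (simp add: algebra_simps)
  moreover have "xv ^ p\<^sup>2 = xv ^ e * (xv ^ (p + 2) :: 'a FV)" unfolding exps(6) power_add ..
  ultimately have "xv ^ e * (Const (2 * be ^ (p + 1)) * h3 + Const c * xv ^ (p + 2) * zv ^ p ^ 3) = R"
    unfolding h3t_eq by (simp add: algebra_simps)
  then have z: "zdeg_le (p ^ 3 - 1) (Const (2 * be ^ (p + 1)) * h3 + Const c * xv ^ (p + 2) * zv ^ p ^ 3)"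
    (is "zdeg_le _ ?Q") using zR zdeg_le_cancel_xv by metis
  define B where "B = 2 * be ^ (p + 1)"
  define iv where "iv = inverse B"
  have BI: "Const B * Const iv = (1 :: 'a FV)"
    unfolding iv_def B_def by (rule Const_cancel[OF h3_coeff_nonzero])
  have "h3 = (Const B * Const iv) * h3" unfolding BI by simp
  also have "\<dots> = Const (iv * (- c)) * xv ^ (p + 2) * zv ^ p ^ 3
      + Const iv * (Const B * h3 + Const c * xv ^ (p + 2) * zv ^ p ^ 3)"
    unfolding Const_mult Const_uminus by (simp add: algebra_simps)
  also have "iv * (- c) = kap"
    unfolding iv_def B_def kap_def c_def divide_inverse by (rule mult.commute)
  finally show ?thesis by (rule that) (rule zdeg_le_mult_free(2)[OF zdeg_le_Const z[folded B_def]])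
qed

lemma h3_Inv: "h3 \<in> Inv"
proof -
  have "h3t \<in> Inv"
    unfolding h3t_def
    by (intro subalgebra_add subalgebra_diff subalgebra_mult subalgebra_power subalgebra_Const
        Inv_subalgebra h2_Inv f1_Inv xv_Inv)
  then have "xv ^ e * (Const (2 * be ^ (p + 1)) * h3) \<in> Inv"
    unfolding h3t_eq by (simp only: mult.assoc mult.left_commute)
  then have "Const (2 * be ^ (p + 1)) * h3 \<in> Inv" by (rule Inv_cancel_xv)
  then show ?thesis by (rule Const_unit_Inv[OF h3_coeff_nonzero])
qed

end

section \<open>The second relation\<close>

text \<open>The generators have degrees at most \<open>1\<close>, \<open>p\<^sup>2\<close> and \<open>p\<^sup>3\<close> in \<open>z\<close>. A product of total degree below that
  of the tete-a-tete, with exponents of \<open>h2\<close> and \<open>h3\<close> less than \<open>p\<close>, cannot reach the power of \<open>z\<close>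
  of exponent \<open>p\<^sup>4\<close>.\<close>

lemma semigroup_zdeg_bound:
  fixes p :: nat
  assumes p: "p > 2" and j: "j < p" and l: "l < p"
    and deg: "p\<^sup>2 * i + (p\<^sup>2 + p) * j + (p ^ 3 + p + 2) * l < p ^ 4 + p\<^sup>2 + 2 * p"
  shows "i + p\<^sup>2 * j + p ^ 3 * l \<le> p ^ 4 - 1"
proof -
  have q: "3 * p \<le> p\<^sup>2" "3 * p\<^sup>2 \<le> p ^ 3" "3 * p ^ 3 \<le> p ^ 4"
    using p by (simp_all add: power2_eq_square power3_eq_cube power4_eq_xxxx)
  have j': "p\<^sup>2 * j + p\<^sup>2 \<le> p ^ 3"
    using mult_le_mono2[of "Suc j" p "p\<^sup>2"] j by (simp add: power2_eq_square power3_eq_cube)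
  show ?thesis
  proof (cases "Suc l = p")
    case True
    have "(p ^ 3 + p + 2) * l + p ^ 3 + 2 = p ^ 4 + p\<^sup>2 + p" "p ^ 3 * l + p ^ 3 = p ^ 4"
      unfolding True[symmetric] by (simp_all add: algebra_simps power2_eq_square power3_eq_cube power4_eq_xxxx)
    moreover have "p\<^sup>2 * i + (p ^ 3 + p + 2) * l < p ^ 4 + p\<^sup>2 + 2 * p"
      using deg by (rule le_less_trans[rotated]) simp
    ultimately have "p\<^sup>2 * i < p ^ 3 + p\<^sup>2" using q p by linarith
    then have "p\<^sup>2 * i < p\<^sup>2 * (p + 1)" by (simp add: power2_eq_square power3_eq_cube)
    then have "i < p + 1" unfolding mult_less_cancel1 by (rule conjunct2)
    moreover note \<open>p ^ 3 * l + p ^ 3 = p ^ 4\<close>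
    ultimately show ?thesis using j' q p by linarith
  next
    case False
    then have "p ^ 3 * l + 2 * p ^ 3 \<le> p ^ 4"
      using mult_le_mono2[of "Suc (Suc l)" p "p ^ 3"] l by (simp add: power3_eq_cube power4_eq_xxxx)
    moreover have "p\<^sup>2 * i < p ^ 4 + p\<^sup>2 + 2 * p"
      using deg by (rule le_less_trans[rotated]) simp
    then have "p\<^sup>2 * i < p ^ 4 + 2 * p\<^sup>2" using q by linarith
    then have "p\<^sup>2 * i < p\<^sup>2 * (p\<^sup>2 + 2)" by (simp add: power2_eq_square power4_eq_xxxx algebra_simps)
    then have "i < p\<^sup>2 + 2" unfolding mult_less_cancel1 by (rule conjunct2)
    ultimately show ?thesis using j' q p by linarith
  qed
qed

text \<open>Exponent vectors of products of all generators but the last.\<close>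

definition mono4 :: "nat \<Rightarrow> nat \<Rightarrow> nat \<Rightarrow> nat \<Rightarrow> nat mon" where
  "mono4 k i j l = sgl 0 k + sgl 1 i + sgl 2 j + sgl 3 l"

lemma expo_mono4 [simp]:
  "expo (mono4 k i j l) 0 = k" "expo (mono4 k i j l) (Suc 0) = i" "expo (mono4 k i j l) 2 = j"
  "expo (mono4 k i j l) 3 = l" "expo (mono4 k i j l) 4 = 0"
  by (simp_all add: mono4_def lookup_single)

lemma supp5_mono4: "supp5 (mono4 k i j l)"
proof -
  have "supp5 (sgl v k)" if "v < 5" for v k :: nat using that by simp
  then show ?thesis by (auto simp: mono4_def mons_add_mon split: if_splits)
qed

lemma Lam_mono4: "Lam p (mono4 k i j l) = xyzm k (p\<^sup>2 * i + (p\<^sup>2 + p) * j + (p ^ 3 + p + 2) * l) 0"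
  by (simp add: Lam_def)

context linearized_family
begin

definition gens :: "'a FV \<Rightarrow> 'a FV list" where
  "gens N = [xv, f1, h2, h3, N]"

abbreviation gval :: "'a FV \<Rightarrow> (nat, 'a) mpoly \<Rightarrow> 'a FV" where
  "gval N \<equiv> subst (\<lambda>i. gens N ! i)"

lemma gval_mono4: "gval N (sgl (mono4 k i j l) c) = Const c * (xv ^ k * (f1 ^ i * h2 ^ j * h3 ^ l))"
  by (simp add: subst_single mono4_def mon_eval_add gens_def mult_ac)

definition sdeg :: "nat \<Rightarrow> nat \<Rightarrow> nat \<Rightarrow> nat" where
  "sdeg i j l = p\<^sup>2 * i + (p\<^sup>2 + p) * j + (p ^ 3 + p + 2) * l"

lemma h2_cong1: "xcong 1 h2 (yv ^ (p\<^sup>2 + p))"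
proof -
  have "xcong 1 h2 (Y * (yv ^ p + Const be * yv\<^sup>2 * xv ^ (p - 2)))"
    by (rule xcong_mono[OF h2_cong]) (use p_gt_2 in simp)
  moreover have "xcong 1 (Const be * yv\<^sup>2 * xv ^ (p - 2)) 0"
  proof -
    have "(xv :: 'a FV) ^ 1 dvd xv ^ (p - 2)" using p_gt_2 by (intro le_imp_power_dvd) simp
    then show ?thesis unfolding xcong_def diff_zero by (rule dvd_mult)
  qed
  then have "xcong 1 (Y * (yv ^ p + Const be * yv\<^sup>2 * xv ^ (p - 2))) (Y * (yv ^ p + 0))"
    by (intro xcong_mult xcong_add xcong_refl)
  ultimately show ?thesis unfolding add_0_right power_add[symmetric] by (rule xcong_trans)
qed

lemma product_cong: "xcong 1 (f1 ^ i * h2 ^ j * h3 ^ l) (yv ^ sdeg i j l)"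
proof -
  have "xcong 1 f1 Y" by (rule xcong_mono[OF f1_cong]) (use m_p in simp)
  then have "xcong 1 (f1 ^ i * h2 ^ j * h3 ^ l) (Y ^ i * (yv ^ (p\<^sup>2 + p)) ^ j * (yv ^ (p ^ 3 + p + 2)) ^ l)"
    by (intro xcong_mult xcong_power h2_cong1 h3_cong)
  then show ?thesis unfolding sdeg_def power_add[of _ "_ + _"] power_add[of _ "p\<^sup>2 * i"] power_mult .
qed

lemma hom_deg_product: "hom_deg (sdeg i j l) (f1 ^ i * h2 ^ j * h3 ^ l)"
  unfolding sdeg_def mult.commute[of _ i] mult.commute[of _ j] mult.commute[of _ l]
  by (intro hom_deg_mult hom_deg_power hom_deg_f1 hom_deg_h2 hom_deg_h3)

lemma zdeg_h3: "zdeg_le (p ^ 3) h3"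
proof -
  obtain h where h: "h3 = Const kap * xv ^ (p + 2) * zv ^ p ^ 3 + h" "zdeg_le (p ^ 3 - 1) h"
    by (rule h3_top_z)
  show ?thesis
    unfolding h(1)
  proof (rule zdeg_le_add)
    have "zdeg_le 0 (Const kap * xv ^ (p + 2))"
      by (intro zdeg_le_mult_free(2) zdeg_le_free_power zdeg_le_Const zdeg_le_Var)
    moreover have "zdeg_le (p ^ 3) (zv ^ p ^ 3 :: 'a FV)"
      using zdeg_le_power[OF zdeg_le_Var(3), of "p ^ 3"] by simp
    ultimately show "zdeg_le (p ^ 3) (Const kap * xv ^ (p + 2) * zv ^ p ^ 3)"
      by (rule zdeg_le_mult_free(2))
    show "zdeg_le (p ^ 3) h" by (rule zdeg_le_mono[OF h(2)]) simp
  qed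
qed

lemma zdeg_product: "zdeg_le (i + p\<^sup>2 * j + p ^ 3 * l) (f1 ^ i * h2 ^ j * h3 ^ l)"
proof -
  have "zdeg_le (i * 1 + j * p\<^sup>2 + l * p ^ 3) (f1 ^ i * h2 ^ j * h3 ^ l)"
    by (intro zdeg_le_mult zdeg_le_power zdeg_f1 zdeg_h2 zdeg_h3)
  then show ?thesis by (simp add: mult.commute)
qed

lemma product_Inv: "f1 ^ i * h2 ^ j * h3 ^ l \<in> Inv"
  by (intro subalgebra_mult subalgebra_power Inv_subalgebra f1_Inv h2_Inv h3_Inv)

text \<open>The difference of the two sides of the second tete-a-tete.\<close>

definition T :: "'a FV" where "T = h3 ^ p - f1 ^ (p\<^sup>2 - 1) * h2\<^sup>2"

definition degT :: nat where "degT = p ^ 4 + p\<^sup>2 + 2 * p"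

lemma degT_eq: "degT = sdeg 0 0 p" "degT = sdeg (p\<^sup>2 - 1) 2 0"
proof -
  show "degT = sdeg 0 0 p"
    by (simp add: degT_def sdeg_def algebra_simps power2_eq_square power3_eq_cube power4_eq_xxxx)
  have "p\<^sup>2 * (p\<^sup>2 - 1) = p\<^sup>2 * p\<^sup>2 - p\<^sup>2" by (simp only: diff_mult_distrib2 mult_1_right)
  moreover have "p\<^sup>2 \<le> p\<^sup>2 * p\<^sup>2" by (rule le_square)
  ultimately have "p\<^sup>2 * (p\<^sup>2 - 1) + p\<^sup>2 = p ^ 4" unfolding p_pow(2) by linarith
  then show "degT = sdeg (p\<^sup>2 - 1) 2 0" by (simp add: degT_def sdeg_def)
qed

lemma T_Inv: "T \<in> Inv"
  unfolding T_def
  by (intro subalgebra_diff subalgebra_mult subalgebra_power Inv_subalgebra f1_Inv h2_Inv h3_Inv)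

lemma T_eq: "T = f1 ^ 0 * h2 ^ 0 * h3 ^ p - f1 ^ (p\<^sup>2 - 1) * h2\<^sup>2 * h3 ^ 0"
  by (simp add: T_def)

lemma hom_deg_T: "hom_deg degT T"
  unfolding T_eq
proof (rule hom_deg_diff)
  show "hom_deg degT (f1 ^ 0 * h2 ^ 0 * h3 ^ p)" unfolding degT_eq(1) by (rule hom_deg_product)
  show "hom_deg degT (f1 ^ (p\<^sup>2 - 1) * h2\<^sup>2 * h3 ^ 0)" unfolding degT_eq(2) by (rule hom_deg_product)
qed

lemma T_cong: "xcong 1 T 0"
proof -
  have "xcong 1 T (yv ^ sdeg 0 0 p - yv ^ sdeg (p\<^sup>2 - 1) 2 0)"
    unfolding T_eq by (intro xcong_diff product_cong)
  then show ?thesis unfolding degT_eq[symmetric] by simp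
qed

lemma T_top_z:
  obtains T' where "T = Const (kap ^ p) * xv ^ (p\<^sup>2 + 2 * p) * zv ^ p ^ 4 + T'" "zdeg_le (p ^ 4 - 1) T'"
proof -
  obtain h where h: "h3 = Const kap * xv ^ (p + 2) * zv ^ p ^ 3 + h" "zdeg_le (p ^ 3 - 1) h"
    by (rule h3_top_z)
  have "xv ^ (p\<^sup>2 + 2 * p) = ((xv ^ (p + 2)) ^ p :: 'a FV)" "zv ^ p ^ 4 = ((zv ^ p ^ 3) ^ p :: 'a FV)"
  proof -
    have "p\<^sup>2 + 2 * p = (p + 2) * p" "p ^ 4 = p ^ 3 * p"
      by (simp_all add: power2_eq_square power3_eq_cube power4_eq_xxxx)
    then show "xv ^ (p\<^sup>2 + 2 * p) = ((xv ^ (p + 2)) ^ p :: 'a FV)" "zv ^ p ^ 4 = ((zv ^ p ^ 3) ^ p :: 'a FV)"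
      by (simp_all only: power_mult)
  qed
  then have "h3 ^ p = Const (kap ^ p) * xv ^ (p\<^sup>2 + 2 * p) * zv ^ p ^ 4 + h ^ p"
    unfolding h(1) frob1 power_mult_distrib Const_power by (simp only:)
  then have "T = Const (kap ^ p) * xv ^ (p\<^sup>2 + 2 * p) * zv ^ p ^ 4 + (h ^ p - f1 ^ (p\<^sup>2 - 1) * h2\<^sup>2 * h3 ^ 0)"
    by (simp add: T_def)
  moreover have "zdeg_le (p ^ 4 - 1) (h ^ p - f1 ^ (p\<^sup>2 - 1) * h2\<^sup>2 * h3 ^ 0)"
  proof (rule zdeg_le_diff)
    have "p * (p ^ 3 - 1) = p ^ 4 - p"
      by (simp add: diff_mult_distrib2 power3_eq_cube power4_eq_xxxx mult.assoc)
    then have "p * (p ^ 3 - 1) \<le> p ^ 4 - 1" using p_gt_2 by linarith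
    then show "zdeg_le (p ^ 4 - 1) (h ^ p)" by (rule zdeg_le_mono[OF zdeg_le_power[OF h(2)]])
    have "3 \<le> p\<^sup>2" using p_exps by linarith
    then have "3 * p\<^sup>2 \<le> p ^ 4" unfolding p_pow(2) by (rule mult_le_mono1)
    then have "p\<^sup>2 - 1 + p\<^sup>2 * 2 + p ^ 3 * 0 \<le> p ^ 4 - 1" using p_exps by linarith
    then show "zdeg_le (p ^ 4 - 1) (f1 ^ (p\<^sup>2 - 1) * h2\<^sup>2 * h3 ^ 0)"
      by (rule zdeg_le_mono[OF zdeg_product])
  qed
  ultimately show ?thesis by (rule that)
qed

text \<open>Subduction of \<open>T\<close>. As long as fewer than \<open>p\<^sup>2 + 2p\<close> factors \<open>x\<close> have been split off, the
  cofactor \<open>u\<close> has the power of \<open>z\<close> of exponent \<open>p\<^sup>4\<close> only together with \<open>x\<close>, so that modulo \<open>x\<close> it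
  is a multiple of a power of \<open>y\<close>, whose exponent exceeds the conductor.\<close>

lemma T_descent:
  assumes "1 \<le> k" "k \<le> p\<^sup>2 + 2 * p"
  shows "\<exists>q u. q \<in> poly_ring 5 \<and> (\<forall>K\<in>mons q. expo K 0 \<ge> 1 \<and> total_degree (Lam p K) = degT) \<and>
    u \<in> Inv \<and> hom_deg (degT - k) u \<and> (\<forall>N. T = gval N q + xv ^ k * u) \<and> zdeg_le (p ^ 4 - 1) (gval 0 q)"
  using assms
proof (induction k rule: dec_induct)
  case base
  obtain u where u: "T = xv ^ 1 * u" using T_cong unfolding xcong_def by (auto elim: dvdE)
  have "degT = 1 + (degT - 1)" using p_gt_2 unfolding degT_def by linarith
  then have "hom_deg (1 + (degT - 1)) (xv ^ 1 * u)" using hom_deg_T u by simp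
  then have "hom_deg (degT - 1) u" by (rule hom_deg_cancel_xv_power)
  moreover have "u \<in> Inv" using T_Inv unfolding u by (rule Inv_cancel_xv)
  ultimately show ?case
    using u by (intro exI[of _ 0] exI[of _ u])
      (simp add: subalgebra_0[OF poly_ring_subalgebra] subst_ring_simps)
next
  case (step k)
  then obtain q u where q: "q \<in> poly_ring 5" "\<forall>K\<in>mons q. expo K 0 \<ge> 1 \<and> total_degree (Lam p K) = degT"
    and u: "u \<in> Inv" "hom_deg (degT - k) u" and Tq: "\<And>N. T = gval N q + xv ^ k * u"
    and zq: "zdeg_le (p ^ 4 - 1) (gval 0 q)"
    by auto
  define n where "n = degT - k"
  have k: "k < p\<^sup>2 + 2 * p" and nk: "n + k = degT" "n \<ge> p ^ 4" "n < p ^ 4 + p\<^sup>2 + 2 * p"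
    using step by (auto simp: n_def degT_def)
  obtain T' where T': "T = Const (kap ^ p) * xv ^ (p\<^sup>2 + 2 * p) * zv ^ p ^ 4 + T'" "zdeg_le (p ^ 4 - 1) T'"
    by (rule T_top_z)
  define S where "S = sgl (xyzm (p\<^sup>2 + 2 * p) 0 (p ^ 4)) (kap ^ p)"
  have S: "Const (kap ^ p) * xv ^ (p\<^sup>2 + 2 * p) * zv ^ p ^ 4 = S"
    unfolding S_def xv_power zv_power by (simp add: Const_def mult_single xyzm_add)
  have xu: "xv ^ k * u = S + (T' - gval 0 q)"
    using Tq[of 0] T'(1) unfolding S by (simp add: algebra_simps)
  have zT: "zdeg_le (p ^ 4 - 1) (T' - gval 0 q)" by (rule zdeg_le_diff[OF T'(2) zq])
  have "expo a VZ < p ^ 4" if a: "a \<in> mons u" "expo a VX = 0" for a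
  proof -
    define a' where "a' = xyzm (k + expo a VX) (expo a VY) (expo a VZ)"
    have "a' \<in> mons (S + (T' - gval 0 q))"
      using mons_xv_power_multI[OF a(1), of k] unfolding a'_def xu .
    then have "a' \<in> mons S \<or> a' \<in> mons (T' - gval 0 q)"
      using Poly_Mapping.keys_add[of S "T' - gval 0 q"] by blast
    moreover have "a' \<notin> mons S" using a(2) k by (auto simp: S_def a'_def split: if_splits)
    ultimately have "expo a' VZ \<le> p ^ 4 - 1" using zT unfolding zdeg_le_def by blast
    moreover have "expo a' VZ = expo a VZ" by (simp add: a'_def)
    moreover have "0 < p ^ 4" using p_gt_2 by simp
    ultimately show ?thesis by linarith
  qed
  then obtain c where c: "xv dvd u - Const c * yv ^ n"
    using invariant_mod_x[OF u] unfolding n_def by blast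
  obtain i j l where ijl: "n = p\<^sup>2 * i + (p\<^sup>2 + p) * j + (p ^ 3 + p + 2) * l" "j < p" "l < p"
    by (rule semigroup_conductor[OF p_odd p_gt_2 nk(2)])
  define B where "B = f1 ^ i * h2 ^ j * h3 ^ l"
  have nB: "n = sdeg i j l" by (simp add: ijl(1) sdeg_def)
  have "xcong 1 (Const c * B) (Const c * yv ^ n)"
    unfolding nB B_def by (intro xcong_mult product_cong xcong_refl)
  moreover have "xcong 1 u (Const c * yv ^ n)" using c by (simp add: xcong_def)
  ultimately have "xcong 1 (u - Const c * B) (Const c * yv ^ n - Const c * yv ^ n)"
    by (intro xcong_diff)
  then obtain u' where u': "u - Const c * B = xv ^ 1 * u'"
    unfolding xcong_def by (auto elim: dvdE)
  have hB: "hom_deg n B" unfolding nB B_def by (rule hom_deg_product)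
  have "hom_deg n (u - Const c * B)"
    using u(2) unfolding n_def[symmetric] by (intro hom_deg_diff hom_deg_Const_mult hB)
  moreover have n1: "n = 1 + (degT - Suc k)" using nk p_gt_2 by (simp add: n_def) (use k degT_def in linarith)
  ultimately have "hom_deg (1 + (degT - Suc k)) (xv ^ 1 * u')" unfolding u' by simp
  then have hu': "hom_deg (degT - Suc k) u'" by (rule hom_deg_cancel_xv_power)
  have "u - Const c * B \<in> Inv"
    unfolding B_def by (intro subalgebra_diff subalgebra_mult subalgebra_Const Inv_subalgebra u(1) product_Inv)
  then have iu': "u' \<in> Inv" unfolding u' by (rule Inv_cancel_xv)
  define q' where "q' = q + sgl (mono4 k i j l) c"
  have g': "gval N q' = gval N q + Const c * (xv ^ k * B)" for N
    by (simp add: q'_def subst_add gval_mono4 B_def)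
  have "u = Const c * B + xv ^ 1 * u'" using u' by (simp add: algebra_simps)
  then have "T = gval N q' + xv ^ Suc k * u'" for N
    unfolding g' using Tq[of N] by (simp add: algebra_simps)
  moreover have "q' \<in> poly_ring 5"
    unfolding q'_def by (intro subalgebra_add[OF poly_ring_subalgebra] q(1) poly_ring_single supp5_mono4)
  moreover have "expo K 0 \<ge> 1 \<and> total_degree (Lam p K) = degT" if "K \<in> mons q'" for K
  proof -
    have "K \<in> mons q \<or> K = mono4 k i j l"
      using that Poly_Mapping.keys_add[of q "sgl (mono4 k i j l) c"] by (auto simp: q'_def split: if_splits)
    then show ?thesis
    proof
      assume K: "K = mono4 k i j l"
      show ?thesis unfolding K Lam_mono4 using step(1) nk(1) ijl(1) by simp
    qed (use q(2) in blast)
  qed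
  moreover have "zdeg_le (p ^ 4 - 1) (gval 0 q')"
    unfolding g'
  proof (rule zdeg_le_add[OF zq])
    have "i + p\<^sup>2 * j + p ^ 3 * l \<le> p ^ 4 - 1"
      by (rule semigroup_zdeg_bound[OF p_gt_2 ijl(2,3)]) (use nk(3) ijl(1) in simp)
    then have "zdeg_le (p ^ 4 - 1) B" unfolding B_def by (rule zdeg_le_mono[OF zdeg_product])
    then show "zdeg_le (p ^ 4 - 1) (Const c * (xv ^ k * B))"
      by (intro zdeg_le_mult_free(2) zdeg_le_free_power zdeg_le_Const zdeg_le_Var)
  qed
  ultimately show ?case using iu' hu' by blast
qed

end

context linearized_family
begin

text \<open>Once the power of \<open>x\<close> in the descent reaches \<open>p\<^sup>2 + 2p\<close>, the cofactor is, up to a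
  scalar, an invariant with lead monomial the power of \<open>z\<close> of exponent \<open>p\<^sup>4\<close>.\<close>

lemma T_relation:
  obtains N q where "N \<in> Inv" "glead N (xyzm 0 0 (p ^ 4)) 1" "q \<in> poly_ring 5"
    "\<And>K. K \<in> mons q \<Longrightarrow> expo K 0 \<ge> 1 \<and> total_degree (Lam p K) = degT"
    "T = gval N q + Const (kap ^ p) * xv ^ (p\<^sup>2 + 2 * p) * N"
proof -
  define k where "k = p\<^sup>2 + 2 * p"
  have "1 \<le> k" using p_gt_2 by (simp add: k_def)
  then obtain q u where q: "q \<in> poly_ring 5" "\<forall>K\<in>mons q. expo K 0 \<ge> 1 \<and> total_degree (Lam p K) = degT"
    and u: "u \<in> Inv" "hom_deg (degT - k) u" and Tq: "\<And>N. T = gval N q + xv ^ k * u"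
    and zq: "zdeg_le (p ^ 4 - 1) (gval 0 q)"
    using T_descent[of k] unfolding k_def by blast
  have dk: "degT - k = p ^ 4" by (simp add: degT_def k_def)
  obtain T' where T': "T = Const (kap ^ p) * xv ^ k * zv ^ p ^ 4 + T'" "zdeg_le (p ^ 4 - 1) T'"
    unfolding k_def by (rule T_top_z)
  define c where "c = kap ^ p"
  have c0: "c \<noteq> 0" using kap_nonzero by (simp add: c_def)
  define u' where "u' = u - Const c * zv ^ p ^ 4"
  have "xv ^ k * u' = T' - gval 0 q"
    using Tq[of 0] T'(1) unfolding u'_def c_def by (simp add: algebra_simps)
  then have zu': "zdeg_le (p ^ 4 - 1) u'"
    using zdeg_le_diff[OF T'(2) zq] zdeg_le_cancel_xv by metis
  have hu': "hom_deg (p ^ 4) u'"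
    using u(2) unfolding u'_def dk by (intro hom_deg_diff hom_deg_Const_mult hom_deg_Var_power)
  define N where "N = Const (inverse c) * u"
  have cc: "Const c * Const (inverse c) = (1 :: 'a FV)" by (rule Const_cancel[OF c0])
  have N: "N = sgl (xyzm 0 0 (p ^ 4)) 1 + Const (inverse c) * u'"
  proof -
    have "N = (Const c * Const (inverse c)) * zv ^ p ^ 4 + Const (inverse c) * u'"
      unfolding N_def u'_def by (simp add: algebra_simps)
    then show ?thesis unfolding cc zv_power by simp
  qed
  have "glead N (xyzm 0 0 (p ^ 4)) 1"
    unfolding N
  proof (intro grevlex.lead_lower grevlex.lead_single)
    fix a assume "a \<in> mons (Const (inverse c) * u')"
    then have a: "a \<in> mons u'" using mons_Const_mult by blast
    have "expo a VZ \<le> p ^ 4 - 1" "total_degree a = p ^ 4"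
      using a zu' hu' by (auto simp: zdeg_le_def hom_deg_def)
    moreover have "0 < p ^ 4" using p_gt_2 by simp
    ultimately have "expo a VX > 0 \<or> expo a VY > 0" unfolding total_degree_xyz by linarith
    then show "grevlex_less a (xyzm 0 0 (p ^ 4))"
      using \<open>total_degree a = p ^ 4\<close> unfolding grevlex_xyz by auto
  qed simp
  moreover have "N \<in> Inv"
    unfolding N_def by (intro subalgebra_mult subalgebra_Const Inv_subalgebra u(1))
  moreover have "T = gval N q + Const c * xv ^ k * N"
  proof -
    have "Const c * xv ^ k * N = (Const c * Const (inverse c)) * (xv ^ k * u)"
      unfolding N_def by (simp only: mult_ac)
    then show ?thesis unfolding cc using Tq[of N] by simp
  qed
  ultimately show ?thesis using that[of N q] q unfolding c_def k_def by blast
qed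

lemma lead_gens_gens:
  assumes "glead N (xyzm 0 0 (p ^ 4)) 1"
  shows "lead_gens p (gens N)"
proof
  show "p > 2" "odd p" "length (gens N) = 5" by (simp_all add: p_gt_2 p_odd gens_def)
  have "glead (sgl (xyzm 1 0 0) (1 :: 'a)) (xyzm 1 0 0) 1" by (rule grevlex.lead_single) simp
  then show "glead (gens N ! 0) (xyzm 1 0 0) 1" by (simp add: gens_def Var_def sgl_xyzm)
  have "xcong 1 f1 Y" by (rule xcong_mono[OF f1_cong]) (use m_p in simp)
  then show "glead (gens N ! 1) (xyzm 0 (p\<^sup>2) 0) 1"
    using glead_y_homI[OF hom_deg_f1] by (simp add: gens_def xcong_def)
  show "glead (gens N ! 2) (xyzm 0 (p\<^sup>2 + p) 0) 1"
    using glead_y_homI[OF hom_deg_h2] h2_cong1 by (simp add: gens_def xcong_def)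
  show "glead (gens N ! 3) (xyzm 0 (p ^ 3 + p + 2) 0) 1"
    using glead_y_homI[OF hom_deg_h3] h3_cong by (simp add: gens_def xcong_def)
  show "glead (gens N ! 4) (xyzm 0 0 (p ^ 4)) 1" using assms by (simp add: gens_def)
qed

text \<open>Among exponent vectors of the same weight, one that involves \<open>x\<close> lies below one whose lead
  monomial is a power of \<open>y\<close>.\<close>

lemma tless_by_x:
  assumes "total_degree (Lam p K) = n" "expo K 0 \<ge> 1" "Lam p I = xyzm 0 n 0"
  shows "tless p K I"
  using assms by (simp add: tless_def grevlex_xyz) (simp add: Lam_def)

lemma deg_identities: "s + (p\<^sup>2 * (p - 2) + (p\<^sup>2 + p) * 2) = (p\<^sup>2 + p) * p"
  "e + (p ^ 3 + p + 2) = (p\<^sup>2 + p) * p"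
proof -
  have "2 * p \<le> p\<^sup>2" "2 * p\<^sup>2 \<le> p ^ 3" using p_gt_2 by (simp_all add: power2_eq_square power3_eq_cube)
  moreover have "p\<^sup>2 * (p - 2) = p ^ 3 - 2 * p\<^sup>2" "(p\<^sup>2 + p) * p = p ^ 3 + p\<^sup>2"
    by (simp_all add: diff_mult_distrib2 distrib_right power2_eq_square power3_eq_cube)
  ultimately show "s + (p\<^sup>2 * (p - 2) + (p\<^sup>2 + p) * 2) = (p\<^sup>2 + p) * p"
    "e + (p ^ 3 + p + 2) = (p\<^sup>2 + p) * p"
    using exps(6) unfolding s_def by simp_all
qed

text \<open>This is the definition of \<open>h3\<close> read as a relation.\<close>

lemma first_relation:
  obtains r where "r \<in> poly_ring 5" "\<forall>N. gval N r = 0" "lead (tless p) r (sgl 2 p) 1"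
proof -
  define r' where "r' = - sgl (mono4 0 (p + 1) 0 0) 1 - sgl (mono4 s (p - 2) 2 0) (be ^ p)
    + sgl (mono4 e 0 0 1) (2 * be ^ (p + 1))"
  define r where "r = sgl (mono4 0 0 p 0) 1 + r'"
  have I: "mono4 0 0 p 0 = sgl 2 p" by (simp add: mono4_def)
  have "r \<in> poly_ring 5"
    unfolding r_def r'_def diff_conv_add_uminus single_uminus[symmetric]
    by (intro subalgebra_add[OF poly_ring_subalgebra] poly_ring_single supp5_mono4)
  moreover have "gval N r = 0" for N
  proof -
    have "gval N r = - h3t + Const (2 * be ^ (p + 1)) * (xv ^ e * h3)"
      unfolding r_def r'_def h3t_def by (simp add: subst_add subst_ring_simps gval_mono4 mult_ac)
    then show ?thesis by (simp add: h3t_eq mult_ac)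
  qed
  moreover have "lead (tless p) r (sgl 2 p) 1"
    unfolding r_def I
  proof (intro tless.lead_lower tless.lead_single)
    fix K assume "K \<in> mons r'"
    then have "K \<in> {mono4 0 (p + 1) 0 0, mono4 s (p - 2) 2 0, mono4 e 0 0 1}"
      using Poly_Mapping.keys_add[of "- sgl (mono4 0 (p + 1) 0 0) 1 - sgl (mono4 s (p - 2) 2 0) (be ^ p)"
          "sgl (mono4 e 0 0 1) (2 * be ^ (p + 1))"]
        mons_diff[of "- sgl (mono4 0 (p + 1) 0 0) (1::'a)" "sgl (mono4 s (p - 2) 2 0) (be ^ p)"]
      unfolding r'_def mons_uminus by (auto split: if_splits)
    moreover have LI: "Lam p (sgl 2 p) = xyzm 0 ((p\<^sup>2 + p) * p) 0"
      unfolding I[symmetric] Lam_mono4 by simp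
    have "tless p (mono4 0 (p + 1) 0 0) (sgl 2 p)"
    proof -
      have "Lam p (mono4 0 (p + 1) 0 0) = Lam p (sgl 2 p)"
        unfolding LI Lam_mono4 by (simp add: algebra_simps power2_eq_square)
      then show ?thesis unfolding I[symmetric] tless_def using p_gt_2 by simp
    qed
    moreover have "tless p (mono4 s (p - 2) 2 0) (sgl 2 p)"
      by (rule tless_by_x[OF _ _ LI]) (use exps(7) deg_identities in \<open>simp_all add: Lam_mono4\<close>)
    moreover have "tless p (mono4 e 0 0 1) (sgl 2 p)"
      by (rule tless_by_x[OF _ _ LI]) (use exps(8) deg_identities in \<open>simp_all add: Lam_mono4\<close>)
    ultimately show "tless p K (sgl 2 p)" by blast
  qed simp
  ultimately show ?thesis using that by blast
qed

lemma second_relation: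
  obtains N s' where "N \<in> Inv" "glead N (xyzm 0 0 (p ^ 4)) 1" "s' \<in> poly_ring 5" "gval N s' = 0"
    "lead (tless p) s' (sgl 3 p) 1"
proof -
  obtain N q where N: "N \<in> Inv" "glead N (xyzm 0 0 (p ^ 4)) 1" and q: "q \<in> poly_ring 5"
    "\<And>K. K \<in> mons q \<Longrightarrow> expo K 0 \<ge> 1 \<and> total_degree (Lam p K) = degT"
    and Tq: "T = gval N q + Const (kap ^ p) * xv ^ (p\<^sup>2 + 2 * p) * N"
    by (rule T_relation) blast
  define J where "J = sgl (0::nat) (p\<^sup>2 + 2 * p) + sgl 4 1"
  define s' where "s' = - sgl (mono4 0 (p\<^sup>2 - 1) 2 0) 1 - q - sgl J (kap ^ p)"
  define t where "t = sgl (mono4 0 0 0 p) 1 + s'"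
  have I: "mono4 0 0 0 p = sgl 3 p" by (simp add: mono4_def)
  have suppJ: "supp5 J" by (auto simp: J_def mons_add_mon split: if_splits)
  have "t \<in> poly_ring 5"
    unfolding t_def s'_def
    by (rule subalgebra_add[OF poly_ring_subalgebra])
       (auto intro!: subalgebra_diff[OF poly_ring_subalgebra] poly_ring_single supp5_mono4 suppJ q(1)
         simp flip: single_uminus)
  moreover have "gval N t = 0"
  proof -
    have "gval N (sgl J (kap ^ p)) = Const (kap ^ p) * (xv ^ (p\<^sup>2 + 2 * p) * N)"
      by (simp add: subst_single J_def mon_eval_add gens_def)
    then have "gval N t = T - gval N q - Const (kap ^ p) * (xv ^ (p\<^sup>2 + 2 * p) * N)"
      unfolding t_def s'_def T_def by (simp add: subst_add subst_ring_simps gval_mono4)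
    then show ?thesis using Tq by (simp add: mult_ac)
  qed
  moreover have "lead (tless p) t (sgl 3 p) 1"
    unfolding t_def I
  proof (intro tless.lead_lower tless.lead_single)
    have LI: "Lam p (sgl 3 p) = xyzm 0 degT 0"
      unfolding I[symmetric] Lam_mono4 degT_eq(1) sdeg_def by simp
    fix K assume "K \<in> mons s'"
    then consider "K = mono4 0 (p\<^sup>2 - 1) 2 0" | "K \<in> mons q" | "K = J"
      using mons_diff[of "- sgl (mono4 0 (p\<^sup>2 - 1) 2 0) 1 - q" "sgl J (kap ^ p)"]
        mons_diff[of "- sgl (mono4 0 (p\<^sup>2 - 1) 2 0) 1" q]
      unfolding s'_def by (auto split: if_splits)
    then show "tless p K (sgl 3 p)"
    proof cases
      case 1
      have "Lam p K = Lam p (sgl 3 p)"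
        unfolding LI 1 Lam_mono4 degT_eq(2) sdeg_def by simp
      then show ?thesis unfolding 1 I[symmetric] tless_def using p_gt_2 by simp
    next
      case 2
      then show ?thesis using q(2)[OF 2] by (intro tless_by_x[OF _ _ LI]) simp_all
    next
      case 3
      have LJ: "Lam p J = xyzm (p\<^sup>2 + 2 * p) 0 (p ^ 4)"
        by (simp add: Lam_def J_def lookup_single)
      show ?thesis
        unfolding 3 by (rule tless_by_x[OF _ _ LI])
          (use p_gt_2 in \<open>simp_all add: LJ degT_def\<close>, simp add: J_def)
    qed
  qed simp
  ultimately show ?thesis using that[OF N] by blast
qed

section \<open>Lead monomials of invariants\<close>

lemma f1_linear_z:
  obtains h where "f1 = Const (- b) * zv * xv ^ (p\<^sup>2 - 1) + h" "zdeg_le 0 h"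
proof -
  define h where "h = Y + Const a * yv ^ p * xv ^ (p\<^sup>2 - p) + Const b * yv\<^sup>2 * xv ^ (p\<^sup>2 - 2)
    + Const d * yv * xv ^ (p\<^sup>2 - 1)"
  have x: "xv ^ (p\<^sup>2 - 1) = xv ^ (p\<^sup>2 - 2) * (xv :: 'a FV)"
    using power_minus_mult[of "p\<^sup>2 - 1" "xv :: 'a FV"] p_exps by (simp add: numeral_2_eq_2)
  have "f1 = Const (- b) * zv * xv ^ (p\<^sup>2 - 1) + h"
    unfolding f1_def h_def delta_def x Const_uminus by (simp add: algebra_simps)
  moreover have "zdeg_le 0 h"
    unfolding h_def by (intro zdeg_le_add zdeg_le_mult_free(2) zdeg_le_free_power zdeg_le_Const zdeg_le_Var)
  ultimately show ?thesis by (rule that)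
qed

text \<open>An invariant becomes a polynomial in the generators after multiplication by a power of
  \<open>x\<close>. In reduced form the lead monomials of its terms are distinct, so the power of \<open>x\<close> can be
  cancelled from the lead monomial.\<close>

lemma LM_Inv:
  assumes f: "f \<in> Inv" "f \<noteq> 0"
  shows "\<exists>K. supp5 K \<and> LM f = Lam p K"
proof -
  obtain r where r: "r \<in> poly_ring 5" "\<forall>N. gval N r = 0" "lead (tless p) r (sgl 2 p) 1"
    by (rule first_relation)
  obtain N s' where N: "N \<in> Inv" "glead N (xyzm 0 0 (p ^ 4)) 1"
    and s': "s' \<in> poly_ring 5" "gval N s' = 0" "lead (tless p) s' (sgl 3 p) 1"
    by (rule second_relation)
  interpret L: lead_gens p "gens N" by (rule lead_gens_gens[OF N(2)])
  define B where "B = gval N ` poly_ring 5"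
  have B: "is_subalgebra B"
    unfolding is_subalgebra_def
  proof (intro conjI ballI)
    show "range Const \<subseteq> B"
    proof clarify
      fix c
      show "Const c \<in> B"
        unfolding B_def
        by (rule image_eqI[of _ _ "Const c"]) (simp_all add: subalgebra_Const[OF poly_ring_subalgebra])
    qed
    fix u v assume "u \<in> B" "v \<in> B"
    then obtain u' v' where *: "u' \<in> poly_ring 5" "u = gval N u'" "v' \<in> poly_ring 5" "v = gval N v'"
      unfolding B_def by blast
    have "u' + v' \<in> poly_ring 5" "u' * v' \<in> poly_ring 5"
      using * subalgebra_add[OF poly_ring_subalgebra] subalgebra_mult[OF poly_ring_subalgebra] by blast+
    then show "u + v \<in> B" "u * v \<in> B"
      unfolding B_def * by (metis imageI subst_add, metis imageI subst_mult)
  qed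
  have gB: "gens N ! i \<in> B" if "i < 5" for i
  proof -
    have "Var i \<in> poly_ring 5" unfolding Var_def by (rule poly_ring_single) (use that in simp)
    then show ?thesis unfolding B_def by (metis imageI subst_Var)
  qed
  have xB: "xv \<in> B" and f1B: "f1 \<in> B" and h2B: "h2 \<in> B"
    using gB[of 0] gB[of 1] gB[of 2] by (simp_all add: gens_def)
  have "h2t \<in> B"
    unfolding h2t_eq by (intro subalgebra_mult subalgebra_power subalgebra_Const B xB h2B)
  then have "h2t + f1 ^ p\<^sup>2 - Const al1 * f1 ^ p * xv ^ (p ^ 4 - p ^ 3)
     - Const al2 * f1\<^sup>2 * xv ^ (p ^ 4 - 2 * p\<^sup>2) \<in> B"
    by (intro subalgebra_add subalgebra_diff subalgebra_mult subalgebra_power subalgebra_Const B xB f1B)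
  then have NyB: "Ny \<in> B" unfolding h2t_def by simp
  obtain h where h: "f1 = Const (- b) * zv * xv ^ (p\<^sup>2 - 1) + h" "zdeg_le 0 h"
    by (rule f1_linear_z)
  have "hom_deg (p\<^sup>2 - 1 + 1) f1" using hom_deg_f1 p_exps by simp
  then obtain j where "xv ^ j * f \<in> B"
    using localization[OF B xB NyB f1B f1_Inv _ h _ f(1)] abd_nonzero by auto
  then obtain q where q: "q \<in> poly_ring 5" "xv ^ j * f = gval N q" unfolding B_def by blast
  obtain n where n: "n \<in> poly_ring 5" "gval N q = gval N n" "\<And>K. K \<in> mons n \<Longrightarrow> reduced p K"
    using L.reduced_representative[OF r(1) spec[OF r(2)] r(3) s' q(1)] by blast
  have "n \<noteq> 0"
  proof
    assume "n = 0"
    then have "xv ^ j * f = 0" using q(2) n(2) by (simp add: subst_ring_simps)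
    then show False using f(2) by simp
  qed
  then obtain K where K: "K \<in> mons n" "glead (gval N n) (Lam p K) (coef n K)"
    using L.lead_value_reduced[of n] n(3) by blast
  have "glead (xv ^ j * f) (xyzm j 0 0 + LM f) (1 * coef f (LM f))"
    unfolding xv_power by (intro grevlex.lead_mult grevlex.lead_single glead_LM f(2)) simp
  then have eq: "xyzm j 0 0 + LM f = Lam p K"
    using grevlex.lead_unique[OF _ K(2)] unfolding q(2) n(2) by blast
  have "expo (Lam p K) VX = j + expo (LM f) VX" by (simp flip: eq)
  then have jK: "j \<le> expo K 0" by (simp add: Lam_def)
  define K' where "K' = K - sgl 0 j"
  have KK: "K = sgl 0 j + K'"
    by (rule poly_mapping_eqI) (use jK in \<open>auto simp: K'_def lookup_minus lookup_single when_def\<close>)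
  have "Lam p (sgl 0 j) = xyzm j 0 0" by (simp add: Lam_def lookup_single)
  then have "LM f = Lam p K'" using eq unfolding KK Lam_add by simp
  moreover have "supp5 K'"
    using n(3)[OF K(1)] unfolding reduced_def KK by (simp add: mons_add_mon)
  ultimately show ?thesis by blast
qed

text \<open>The lead monomials were found with the help of the cofactor from the descent in place of the
  norm of \<open>z\<close>; both have the same lead monomial.\<close>

lemma generators: "lead_generated p (gens Nz) Inv"
proof -
  interpret L: lead_gens p "gens Nz" by (rule lead_gens_gens[OF glead_Nz])
  show ?thesis
  proof
    show "is_subalgebra Inv" by (rule Inv_subalgebra)
    show "set (gens Nz) \<subseteq> Inv" by (simp add: gens_def xv_Inv f1_Inv h2_Inv h3_Inv Nz_Inv)
  qed (rule LM_Inv)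
qed

end

section \<open>Determinants of order four\<close>

lemma vector_4:
  "(vector [u, v, w, x] :: 'a::zero ^ 4) $ 1 = u" "(vector [u, v, w, x] :: 'a ^ 4) $ 2 = v"
  "(vector [u, v, w, x] :: 'a ^ 4) $ 3 = w" "(vector [u, v, w, x] :: 'a ^ 4) $ 4 = x"
  by (simp_all add: vector_def)

lemma det_4:
  "det (A :: 'a::comm_ring_1 ^ 4 ^ 4) =
     A$1$1 * (A$2$2 * (A$3$3 * A$4$4 - A$3$4 * A$4$3) - A$2$3 * (A$3$2 * A$4$4 - A$3$4 * A$4$2)
       + A$2$4 * (A$3$2 * A$4$3 - A$3$3 * A$4$2))
   - A$1$2 * (A$2$1 * (A$3$3 * A$4$4 - A$3$4 * A$4$3) - A$2$3 * (A$3$1 * A$4$4 - A$3$4 * A$4$1)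
       + A$2$4 * (A$3$1 * A$4$3 - A$3$3 * A$4$1))
   + A$1$3 * (A$2$1 * (A$3$2 * A$4$4 - A$3$4 * A$4$2) - A$2$2 * (A$3$1 * A$4$4 - A$3$4 * A$4$1)
       + A$2$4 * (A$3$1 * A$4$2 - A$3$2 * A$4$1))
   - A$1$4 * (A$2$1 * (A$3$2 * A$4$3 - A$3$3 * A$4$2) - A$2$2 * (A$3$1 * A$4$3 - A$3$3 * A$4$1)
       + A$2$3 * (A$3$1 * A$4$2 - A$3$2 * A$4$1))"
proof -
  have f1234: "finite {2 :: 4, 3, 4}" "1 \<notin> {2 :: 4, 3, 4}" by auto
  have f234: "finite {3 :: 4, 4}" "2 \<notin> {3 :: 4, 4}" by auto
  have f34: "finite {4 :: 4}" "3 \<notin> {4 :: 4}" by auto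
  show ?thesis
    unfolding det_def UNIV_4
    unfolding sum_over_permutations_insert[OF f1234]
    unfolding sum_over_permutations_insert[OF f234]
    unfolding sum_over_permutations_insert[OF f34]
    unfolding permutes_sing
    by (simp add: sign_swap_id permutation_swap_id sign_compose permutation_compose sign_id swap_id_eq)
       (simp add: algebra_simps)
qed

abbreviation det_rows :: "'a::comm_ring_1 ^ 4 \<Rightarrow> 'a ^ 4 \<Rightarrow> 'a ^ 4 \<Rightarrow> 'a ^ 4 \<Rightarrow> 'a" where
  "det_rows u v w x \<equiv> det (vector [u, v, w, x] :: 'a ^ 4 ^ 4)"

text \<open>Summands that repeat a row of the determinant contribute nothing.\<close>

lemma det_rows_combination:
  fixes u v w x :: "'a::field ^ 4"
  shows "det_rows (r *s u + s *s v + t *s w + k *s x) v w x = r * det_rows u v w x"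
    "det_rows u (r *s u + s *s v + t *s w + k *s x) w x = s * det_rows u v w x"
    "det_rows u v (r *s u + s *s v + t *s w + k *s x) x = t * det_rows u v w x"
    "det_rows u v w (r *s u + s *s v + t *s w + k *s x) = k * det_rows u v w x"
  by (simp_all add: det_4 vector_4) (simp_all add: algebra_simps)

lemma det_rows_swap:
  fixes u v w x :: "'a::field ^ 4"
  shows "det_rows v u w x = - det_rows u v w x" "det_rows u w v x = - det_rows u v w x"
    "det_rows u v x w = - det_rows u v w x"
  by (simp_all add: det_4 vector_4) (simp_all add: algebra_simps)

section \<open>From the matrix to the translation group\<close>

text \<open>The group element with exponent vector \<open>a\<close> translates by the combination of the entries of a
  row with coefficients \<open>a\<close>.\<close>

definition lin :: "'a::comm_ring_1 ^ 4 \<Rightarrow> (4 \<Rightarrow> int) \<Rightarrow> 'a" where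
  "lin u a = (\<Sum>j\<in>UNIV. of_nat (nat (a j)) * u $ j)"

lemma gen_act_eq: "gen_act M j = act (M $ 1 $ j) (M $ 2 $ j)"
  unfolding gen_act_def act_def
  by (rule arg_cong[where f = subst]) (auto simp: trans_var_def fun_eq_iff split: xyz.split)

lemma act_funpow: "(act c e ^^ n) f = act (of_nat n * c) (of_nat n * e) f"
  by (induction n) (simp_all add: act_0 act_act algebra_simps)

lemma E_act_eq: "E_act M a f = act (lin (M $ 1) a) (lin (M $ 2) a) f"
  unfolding E_act_def gen_act_eq act_funpow act_act lin_def sum_4 by (simp add: add_ac)

lemma carrier_E_group: "p > 0 \<Longrightarrow> carrier (E_group p) = {a. \<forall>j. a j \<in> {0..<int p}}"
  by (auto simp: E_group_def carrier_integer_mod_group PiE_def Pi_def extensional_def)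

lemma card_carrier_E_group: "p > 0 \<Longrightarrow> card (carrier (E_group p)) = p ^ 4"
  by (simp add: E_group_def carrier_integer_mod_group card_PiE)

lemma exact_div_eq: "f = g * q \<Longrightarrow> g \<noteq> 0 \<Longrightarrow> exact_div f g = (q :: 'b::idom)"
  unfolding exact_div_def by (rule the_equality) auto

locale family_matrix =
  fixes p :: nat and M :: "'a::field ^ 4 ^ 2"
  assumes p_prime: "prime p" and p_gt_2: "p > 2" and char_p: "CHAR('a) = p"
    and g1234: "gamma p M 1 2 3 4 \<noteq> 0" and g1235: "gamma p M 1 2 3 5 = 0"
    and g1357: "gamma p M 1 3 5 7 \<noteq> 0" and g1245: "gamma p M 1 2 4 5 \<noteq> 0"
begin

lemma frob_sum: "(\<Sum>j\<in>S. f j :: 'a) ^ p ^ n = (\<Sum>j\<in>S. f j ^ p ^ n)"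
  by (rule freshmans_dream_sum') (simp_all add: char_p p_prime)

lemma frob_add: "(u + v :: 'a) ^ p ^ n = u ^ p ^ n + v ^ p ^ n"
  by (rule freshmans_dream') (simp_all add: char_p p_prime)

lemma frob_of_nat: "(of_nat k :: 'a) ^ p ^ n = of_nat k"
  using p_gt_2 by (induction k) (simp_all add: frob_add)

lemma lin_frob: "lin (u :: 'a ^ 4) a ^ p ^ n = lin (\<chi> j. u $ j ^ p ^ n) a"
proof -
  have "(\<Sum>j\<in>UNIV. of_nat (nat (a j)) * u $ j) ^ p ^ n = (\<Sum>j\<in>UNIV. (of_nat (nat (a j)) * u $ j) ^ p ^ n)"
    by (rule frob_sum)
  then show ?thesis by (simp add: lin_def power_mult_distrib frob_of_nat)
qed

abbreviation R :: "nat \<Rightarrow> 'a ^ 4" where "R \<equiv> Gamma_row p M"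

lemma R_eq: "R 1 = M $ 1" "R 2 = M $ 2" "R 3 $ j = M $ 1 $ j ^ p" "R 4 $ j = M $ 2 $ j ^ p"
  "R 5 $ j = M $ 1 $ j ^ p\<^sup>2" "R 7 $ j = M $ 1 $ j ^ p ^ 3" "R 9 $ j = M $ 1 $ j ^ p ^ 4"
  by (simp_all add: Gamma_row_def vec_eq_iff)

definition G :: "'a ^ 4 ^ 4" where "G = vector [R 1, R 3, R 5, R 7]"

lemma det_G: "det G \<noteq> 0"
  using g1357 unfolding gamma_def G_def .

lemma row_combination:
  obtains r1 r2 r3 r4 where "u = r1 *s R 1 + r2 *s R 3 + r3 *s R 5 + r4 *s R 7"
proof -
  have "det (transpose G) \<noteq> 0" using det_G by simp
  then obtain x where "transpose G *v x = u" using cramer[of "transpose G"] by blast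
  then have "u $ j = x $ 1 * R 1 $ j + x $ 2 * R 3 $ j + x $ 3 * R 5 $ j + x $ 4 * R 7 $ j" for j
    by (auto simp: matrix_vector_mult_def transpose_def G_def sum_4 vector_4 mult.commute)
  then show ?thesis using that[of "x $ 1" "x $ 2" "x $ 3" "x $ 4"] by (simp add: vec_eq_iff)
qed

lemma lin_powers: "lin (R 1) a = lin (M $ 1) a" "lin (R 3) a = lin (M $ 1) a ^ p"
  "lin (R 5) a = lin (M $ 1) a ^ p\<^sup>2" "lin (R 7) a = lin (M $ 1) a ^ p ^ 3"
  "lin (R 9) a = lin (M $ 1) a ^ p ^ 4"
proof -
  have *: "R 3 = (\<chi> j. M $ 1 $ j ^ p ^ 1)" "R 5 = (\<chi> j. M $ 1 $ j ^ p ^ 2)"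
    "R 7 = (\<chi> j. M $ 1 $ j ^ p ^ 3)" "R 9 = (\<chi> j. M $ 1 $ j ^ p ^ 4)"
    by (simp_all add: vec_eq_iff R_eq del: One_nat_def)
  show "lin (R 1) a = lin (M $ 1) a" by (simp only: R_eq)
  show "lin (R 3) a = lin (M $ 1) a ^ p" using lin_frob[of "M $ 1" a 1] by (simp only: * power_one_right)
  show "lin (R 5) a = lin (M $ 1) a ^ p\<^sup>2" "lin (R 7) a = lin (M $ 1) a ^ p ^ 3"
    "lin (R 9) a = lin (M $ 1) a ^ p ^ 4"
    by (simp_all only: * lin_frob)
qed

lemma lin_combination:
  "lin (r1 *s u1 + r2 *s u2 + r3 *s u3 + r4 *s u4) a =
    r1 * lin u1 a + r2 * lin u2 a + r3 * lin u3 a + r4 * lin u4 a"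
  by (simp add: lin_def sum_distrib_left distrib_left sum.distrib mult_ac)

lemma of_nat_inj: "k < p \<Longrightarrow> l < p \<Longrightarrow> of_nat k = (of_nat l :: 'a) \<Longrightarrow> k = l"
  by (simp add: of_nat_eq_iff_cong_CHAR char_p cong_less_modulus_unique_nat)

text \<open>The first row is linearly independent over the prime field, because a relation persists
  for its Frobenius powers, whose determinant does not vanish.\<close>

lemma lin_inj: "inj_on (lin (M $ 1)) (carrier (E_group p))"
proof (rule inj_onI)
  fix a c assume ac: "a \<in> carrier (E_group p)" "c \<in> carrier (E_group p)" and eq: "lin (M $ 1) a = lin (M $ 1) c"
  define k :: "'a ^ 4" where "k = (\<chi> j. of_nat (nat (a j)) - of_nat (nat (c j)))"
  have d: "(\<Sum>j\<in>UNIV. u $ j * k $ j) = lin u a - lin u c" for u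
    by (simp add: k_def lin_def sum_subtractf algebra_simps)
  have "(G *v k) $ i = lin (G $ i) a - lin (G $ i) c" for i
    by (simp add: matrix_vector_mult_def d)
  moreover have "lin (G $ i) a = lin (G $ i) c" for i
    using exhaust_4[of i] eq by (auto simp: G_def vector_4 lin_powers lin_powers(1)[unfolded One_nat_def])
  ultimately have "G *v k = G *v 0" by (simp add: vec_eq_iff)
  then have "k = 0"
    using cramer[OF det_G, of k "G *v 0"] cramer[OF det_G, of 0 "G *v 0"] by simp
  have "a j = c j" for j
  proof -
    have "of_nat (nat (a j)) = (of_nat (nat (c j)) :: 'a)"
      using \<open>k = 0\<close> by (simp add: k_def vec_eq_iff)
    moreover have "0 \<le> a j" "a j < int p" "0 \<le> c j" "c j < int p"
      using ac p_gt_2 by (auto simp: carrier_E_group)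
    ultimately have "nat (a j) = nat (c j)"
      by (intro of_nat_inj) (simp_all add: nat_less_iff)
    then show ?thesis using \<open>0 \<le> a j\<close> \<open>0 \<le> c j\<close> by simp
  qed
  then show "a = c" by (rule ext)
qed

definition W :: "'a set" where "W = lin (M $ 1) ` carrier (E_group p)"

lemma W_E: "w \<in> W \<longleftrightarrow> (\<exists>a\<in>carrier (E_group p). w = lin (M $ 1) a)"
  by (auto simp: W_def)

lemma card_W: "card W = p ^ 4"
  unfolding W_def using card_image[OF lin_inj] card_carrier_E_group p_gt_2 by simp

lemma of_nat_p: "(of_nat p :: 'a) = 0"
  using char_p by (metis of_nat_CHAR)

lemma of_nat_mod: "of_nat (k mod p) = (of_nat k :: 'a)"
proof -
  have "(of_nat k :: 'a) = of_nat (p * (k div p) + k mod p)" by simp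
  also have "\<dots> = of_nat (k mod p)" unfolding of_nat_add of_nat_mult of_nat_p by simp
  finally show ?thesis by simp
qed

text \<open>Coefficients may be reduced modulo \<open>p\<close>, so \<open>W\<close> contains all integral combinations of the
  first row.\<close>

lemma combination_in_W: "(\<Sum>j\<in>UNIV. of_nat (k j) * M $ 1 $ j) \<in> W"
proof -
  have "(\<lambda>j. int (k j mod p)) \<in> carrier (E_group p)"
    using p_gt_2 by (simp add: carrier_E_group)
  moreover have "lin (M $ 1) (\<lambda>j. int (k j mod p)) = (\<Sum>j\<in>UNIV. of_nat (k j) * M $ 1 $ j)"
    unfolding lin_def nat_int of_nat_mod ..
  ultimately show ?thesis unfolding W_E by metis
qed

lemma W_add: "u \<in> W \<Longrightarrow> v \<in> W \<Longrightarrow> u + v \<in> W"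
proof -
  assume "u \<in> W" "v \<in> W"
  then obtain a c where "u = lin (M $ 1) a" "v = lin (M $ 1) c" by (auto simp: W_E)
  then have "u + v = (\<Sum>j\<in>UNIV. of_nat (nat (a j) + nat (c j)) * M $ 1 $ j)"
    by (simp add: lin_def distrib_right sum.distrib)
  then show "u + v \<in> W" using combination_in_W by metis
qed

lemma W_uminus: "u \<in> W \<Longrightarrow> - u \<in> W"
proof -
  assume "u \<in> W"
  then obtain a where u: "u = lin (M $ 1) a" by (auto simp: W_E)
  have "of_nat ((p - 1) * k) = - (of_nat k :: 'a)" for k
    using p_gt_2 by (simp add: of_nat_diff of_nat_p)
  then have "- u = (\<Sum>j\<in>UNIV. of_nat ((p - 1) * nat (a j)) * M $ 1 $ j)"
    by (simp add: u lin_def sum_negf)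
  then show "- u \<in> W" using combination_in_W by metis
qed

lemma W_0: "0 \<in> W"
  using combination_in_W[of "\<lambda>_. 0"] by simp

text \<open>On \<open>W\<close> the second row is a linearized polynomial of degree \<open>p\<^sup>2\<close> in the first, and
  quotients of minors are quotients of its coefficients.\<close>

lemma second_row:
  obtains r0 r1 r2 where "r1 \<noteq> 0" "r2 \<noteq> 0"
    "\<And>a. lin (M $ 2) a = r0 * lin (M $ 1) a + r1 * lin (M $ 1) a ^ p + r2 * lin (M $ 1) a ^ p\<^sup>2"
    "gamma p M 1 2 4 5 = r1 / r2 * gamma p M 1 2 3 4" "gamma p M 1 3 4 5 = 1 / r2 * gamma p M 1 2 3 4"
    "gamma p M 2 3 4 5 = r0 / r2 * gamma p M 1 2 3 4"
proof -
  let ?g = "gamma p M 1 3 5 7"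
  obtain r0 r1 r2 r3 where R2: "R 2 = r0 *s R 1 + r1 *s R 3 + r2 *s R 5 + r3 *s R 7"
    by (rule row_combination)
  have g: "det_rows (R 1) (R 3) (R 5) (R 7) = ?g" by (simp only: gamma_def)
  have g': "det_rows (R 1) (R 3) (R 7) (R 5) = - ?g"
    unfolding g[symmetric] by (rule det_rows_swap(3))
  have perm: "det_rows (R 1) (R 7) (R 3) (R 5) = ?g"
    using det_rows_swap(2)[of "R 1" "R 7" "R 3" "R 5"] unfolding g' by simp
  have "R 2 = r0 *s R 1 + r3 *s R 7 + r1 *s R 3 + r2 *s R 5" unfolding R2 by (simp only: add_ac)
  then have "gamma p M 1 2 3 5 = r3 * ?g"
    unfolding gamma_def[of p M 1 2 3 5] perm[symmetric] by (simp only: det_rows_combination(2))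
  then have r3: "r3 = 0" using g1235 g1357 by simp
  have R2: "R 2 = r0 *s R 1 + r1 *s R 3 + r2 *s R 5" unfolding R2 r3 by simp
  have R4: "R 4 = r0 ^ p *s R 3 + r1 ^ p *s R 5 + r2 ^ p *s R 7"
  proof -
    have pw: "(u ^ p) ^ p = u ^ p\<^sup>2" "(u ^ p\<^sup>2) ^ p = u ^ p ^ 3" for u :: 'a
      by (simp_all add: power2_eq_square[of p] power3_eq_cube[of p] flip: power_mult)
    have "R 4 $ j = (R 2 $ j) ^ p" for j by (simp only: R_eq)
    also have "(R 2 $ j) ^ p = (r0 * M $ 1 $ j) ^ p + (r1 * M $ 1 $ j ^ p) ^ p + (r2 * M $ 1 $ j ^ p\<^sup>2) ^ p" for j
      using frob_add[of _ _ 1] unfolding R2 by (simp add: R_eq R_eq(1)[unfolded One_nat_def])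
    finally show ?thesis
      by (simp add: vec_eq_iff R_eq power_mult_distrib pw)
  qed
  define X where "X = det_rows (R 1) (R 3) (R 4) (R 5)"
  have "R 4 = 0 *s R 1 + r0 ^ p *s R 3 + r2 ^ p *s R 7 + r1 ^ p *s R 5"
    unfolding R4 by (simp add: add_ac)
  then have X: "X = - (r2 ^ p * ?g)"
    unfolding X_def by (simp only: det_rows_combination(3) g') simp
  have g1345: "gamma p M 1 3 4 5 = X" by (simp only: gamma_def X_def)
  have "R 2 = r0 *s R 1 + r1 *s R 3 + 0 *s R 4 + r2 *s R 5" unfolding R2 by simp
  then have g2345: "gamma p M 2 3 4 5 = r0 * X"
    unfolding gamma_def X_def by (simp only: det_rows_combination(1))
  have "R 2 = r0 *s R 1 + r1 *s R 3 + 0 *s R 4 + r2 *s R 5" unfolding R2 by simp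
  then have g1245': "gamma p M 1 2 4 5 = r1 * X"
    unfolding gamma_def X_def by (simp only: det_rows_combination(2))
  have "R 2 = r0 *s R 1 + r2 *s R 5 + r1 *s R 3 + 0 *s R 4" unfolding R2 by (simp add: add_ac)
  then have "gamma p M 1 2 3 4 = r2 * det_rows (R 1) (R 5) (R 3) (R 4)"
    unfolding gamma_def by (simp only: det_rows_combination(2))
  also have "R 4 = 0 *s R 1 + r1 ^ p *s R 5 + r0 ^ p *s R 3 + r2 ^ p *s R 7"
    unfolding R4 by (simp add: add_ac)
  then have "det_rows (R 1) (R 5) (R 3) (R 4) = r2 ^ p * det_rows (R 1) (R 5) (R 3) (R 7)"
    by (simp only: det_rows_combination(4))
  also have "det_rows (R 1) (R 5) (R 3) (R 7) = - ?g"
    using det_rows_swap(2)[of "R 1" "R 5" "R 3" "R 7"] unfolding g .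
  finally have g1234': "gamma p M 1 2 3 4 = r2 * X" by (simp add: X)
  have r: "r1 \<noteq> 0" "r2 \<noteq> 0" using g1234 g1245 unfolding g1234' g1245' by auto
  moreover have "lin (M $ 2) a = r0 * lin (M $ 1) a + r1 * lin (M $ 1) a ^ p + r2 * lin (M $ 1) a ^ p\<^sup>2" for a
  proof -
    have eq: "M $ 2 = r0 *s R 1 + r1 *s R 3 + r2 *s R 5 + 0 *s R 7"
      using R2 unfolding R_eq(2) by simp
    show ?thesis unfolding eq lin_combination lin_powers by simp
  qed
  ultimately show ?thesis
    using that[of r1 r2 r0] unfolding g1345 g2345 g1245' g1234' by simp
qed

text \<open>The Frobenius power of order four of the first row is a combination of the lower ones, and
  the quotient of minors in \<^const>\<open>alpha1\<close> is a coefficient of it.\<close>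

lemma kernel_coefficients:
  obtains n0 n1 n2 n3 where "n3 = - (gamma p M 1 3 5 9 / gamma p M 1 3 5 7)"
    "\<And>w. w \<in> W \<Longrightarrow> w ^ p ^ 4 + n3 * w ^ p ^ 3 + n2 * w ^ p\<^sup>2 + n1 * w ^ p + n0 * w = 0"
proof -
  obtain m0 m1 m2 m3 where R9: "R 9 = m0 *s R 1 + m1 *s R 3 + m2 *s R 5 + m3 *s R 7"
    by (rule row_combination)
  then have "gamma p M 1 3 5 9 = m3 * gamma p M 1 3 5 7"
    unfolding gamma_def by (simp only: det_rows_combination(4))
  then have "- m3 = - (gamma p M 1 3 5 9 / gamma p M 1 3 5 7)" using g1357 by simp
  moreover have "w ^ p ^ 4 + (- m3) * w ^ p ^ 3 + (- m2) * w ^ p\<^sup>2 + (- m1) * w ^ p + (- m0) * w = 0"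
    if w: "w \<in> W" for w
  proof -
    obtain a where "w = lin (M $ 1) a" using w by (auto simp: W_E)
    then have "w ^ p ^ 4 = m0 * w + m1 * w ^ p + m2 * w ^ p\<^sup>2 + m3 * w ^ p ^ 3"
      using lin_combination[of m0 "R 1" m1 "R 3" m2 "R 5" m3 "R 7" a] unfolding R9[symmetric] lin_powers by simp
    then show ?thesis by simp
  qed
  ultimately show ?thesis by (rule that)
qed

text \<open>The normalizing factors in the definitions of \<^const>\<open>h2\<close> and \<^const>\<open>h3\<close> are those that make the
  explicit quotients monic.\<close>

lemma generators: "lead_generated p [xv, f1_hat p M, h2 p M, h3 p M, orbit_prod p M zv] (invariant_ring p M)"
proof -
  obtain r0 r1 r2 where r: "r1 \<noteq> 0" "r2 \<noteq> 0"
    "\<And>a. lin (M $ 2) a = r0 * lin (M $ 1) a + r1 * lin (M $ 1) a ^ p + r2 * lin (M $ 1) a ^ p\<^sup>2"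
    and ga: "gamma p M 1 2 4 5 = r1 / r2 * gamma p M 1 2 3 4" "gamma p M 1 3 4 5 = 1 / r2 * gamma p M 1 2 3 4"
    "gamma p M 2 3 4 5 = r0 / r2 * gamma p M 1 2 3 4"
    by (rule second_row) blast
  obtain n0 n1 n2 n3 where n: "n3 = - (gamma p M 1 3 5 9 / gamma p M 1 3 5 7)"
    "\<And>w. w \<in> W \<Longrightarrow> w ^ p ^ 4 + n3 * w ^ p ^ 3 + n2 * w ^ p\<^sup>2 + n1 * w ^ p + n0 * w = 0"
    by (rule kernel_coefficients) blast
  define phi where "phi w = r0 * w + r1 * w ^ p + r2 * w ^ p\<^sup>2" for w
  interpret L: linearized_family p W phi r0 r1 r2 n0 n1 n2 n3
  proof
    show "phi (u + v) = phi u + phi v" for u v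
      using frob_add[of u v 1] frob_add[of u v 2] by (simp add: phi_def algebra_simps)
    show "finite W" using card_W p_gt_2 by (intro card_ge_0_finite) simp
  qed (use p_prime p_gt_2 char_p card_W W_0 W_add W_uminus r n in \<open>simp_all add: phi_def\<close>)
  let ?g = "gamma p M 1 2 3 4"
  have ga': "gamma p M 1 2 4 5 = L.a * ?g" "gamma p M 1 3 4 5 = L.b * ?g" "gamma p M 2 3 4 5 = L.d * ?g"
    by (simp_all only: ga L.a_def L.b_def L.d_def)
  have gq: "gamma p M 1 2 4 5 / ?g = L.a" "gamma p M 1 3 4 5 / ?g = L.b" "gamma p M 2 3 4 5 / ?g = L.d"
    unfolding ga' using g1234 by simp_all
  have act: "E_act M a f = act (lin (M $ 1) a) (phi (lin (M $ 1) a)) f" for a f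
    by (simp add: E_act_eq r(3) phi_def)
  have inv: "invariant_ring p M = L.Inv"
    unfolding invariant_ring_def L.Inv_def act unfolding W_def by simp
  have orbit: "orbit_prod p M f = (\<Prod>w\<in>W. act w (phi w) f)"
    if "inj_on (\<lambda>w. act w (phi w) f) W" for f
  proof -
    have "orbit (E_group p) (E_act M) f = (\<lambda>w. act w (phi w) f) ` W"
      unfolding orbit_def act W_def by auto
    then show ?thesis unfolding orbit_prod_def using prod.reindex[OF that, of id] by simp
  qed
  have injC: "u = v" if "Const u * xv = Const v * (xv :: 'a FV)" for u v
  proof -
    have "Const (u - v) * xv = 0" using that by (simp add: Const_minus left_diff_distrib)
    then show ?thesis by simp
  qed
  have Ny: "orbit_prod p M yv = L.Ny"
    unfolding L.Ny_def using injC by (subst orbit) (auto simp: inj_on_def)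
  have Nz: "orbit_prod p M zv = L.Nz"
    unfolding L.Nz_def
  proof (rule orbit, rule inj_onI)
    fix u v assume "act u (phi u) zv = act v (phi v) zv"
    then have "coef (act u (phi u) zv) (xyzm 0 1 0) = coef (act v (phi v) zv) (xyzm 0 1 0)"
      by (rule arg_cong)
    moreover have "coef (act w (phi w) zv) (xyzm 0 1 0) = 2 * w" for w
      unfolding act_Var lookup_add coef_Const_mult by (simp add: Var_def sgl_xyzm lookup_single)
    ultimately show "u = v" using L.two_nonzero by simp
  qed
  have f1: "f1_hat p M = L.f1"
    unfolding f1_hat_def L.f1_def gq ..
  have al: "alpha1 p M = L.al1" "alpha2 p M = L.al2"
    unfolding alpha1_def alpha2_def L.al1_def L.al2_def power_divide[symmetric] gq
    by (simp_all add: n(1))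
  have h2t: "h2_tilde p M = L.h2t"
    unfolding h2_tilde_def L.h2t_def f1 al Ny ..
  have ab: "L.a \<noteq> 0" "L.b \<noteq> 0" by (rule L.abd_nonzero)+
  have h2: "h2 p M = L.h2"
    unfolding h2_def
  proof (rule exact_div_eq)
    have c: "?g ^ (p\<^sup>2 + 1) * (2 * L.a * L.b ^ p\<^sup>2) = 2 * gamma p M 1 3 4 5 ^ p\<^sup>2 * gamma p M 1 2 4 5"
      unfolding ga' by (simp add: power_mult_distrib mult_ac)
    show "Const (?g ^ (p\<^sup>2 + 1)) * h2_tilde p M =
        Const (2 * gamma p M 1 3 4 5 ^ p\<^sup>2 * gamma p M 1 2 4 5) * xv ^ (p ^ 4 - p\<^sup>2 - p) * L.h2"
      unfolding c[symmetric] h2t L.h2t_eq Const_mult[of "?g ^ (p\<^sup>2 + 1)"] by (simp only: mult.assoc)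
    show "Const (2 * gamma p M 1 3 4 5 ^ p\<^sup>2 * gamma p M 1 2 4 5) * xv ^ (p ^ 4 - p\<^sup>2 - p) \<noteq> (0 :: 'a FV)"
      using ab g1234 L.two_nonzero unfolding ga' by simp
  qed
  have be: "gamma p M 1 3 4 5 / gamma p M 1 2 4 5 = L.be"
    using g1234 unfolding ga' L.be_def by simp
  have h3t: "h3_tilde p M = L.h3t"
    unfolding h3_tilde_def L.h3t_def f1 h2 be L.s_def ..
  have h3: "h3 p M = L.h3"
    unfolding h3_def
  proof (rule exact_div_eq)
    have "gamma p M 1 3 4 5 = L.be * gamma p M 1 2 4 5"
      using g1245 unfolding be[symmetric] by simp
    then have c: "gamma p M 1 2 4 5 ^ (p + 1) * (2 * L.be ^ (p + 1)) = 2 * gamma p M 1 3 4 5 ^ (p + 1)"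
      by (simp only: power_mult_distrib mult_ac)
    show "Const (gamma p M 1 2 4 5 ^ (p + 1)) * h3_tilde p M =
        Const (2 * gamma p M 1 3 4 5 ^ (p + 1)) * xv ^ (p\<^sup>2 - p - 2) * L.h3"
      unfolding c[symmetric] h3t L.h3t_eq L.e_def Const_mult[of "gamma p M 1 2 4 5 ^ (p + 1)"]
      by (simp only: mult.assoc)
    show "Const (2 * gamma p M 1 3 4 5 ^ (p + 1)) * xv ^ (p\<^sup>2 - p - 2) \<noteq> (0 :: 'a FV)"
      using ab g1234 L.two_nonzero unfolding ga' by simp
  qed
  show ?thesis
    using L.generators unfolding L.gens_def inv f1 h2 h3 Nz .
qed

end

theorem theorem5p4:
  fixes p :: nat and M :: "'a::field ^ 4 ^ 2"
  assumes "prime p" and "p > 2" and "CHAR('a) = p"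
    and "gamma p M 1 2 3 4 \<noteq> 0"
    and "gamma p M 1 2 3 5 = 0"
    and "gamma p M 1 3 5 7 \<noteq> 0"
    and "gamma p M 1 2 4 5 \<noteq> 0"
  shows "sagbi_basis {xv, f1_hat p M, h2 p M, h3 p M, orbit_prod p M zv} (invariant_ring p M)
    \<and> complete_intersection (invariant_ring p M)
    \<and> (let bs = [xv, f1_hat p M, h2 p M, h3 p M, orbit_prod p M zv];
           I\<^sub>1 = Poly_Mapping.single 2 p; J\<^sub>1 = Poly_Mapping.single 1 (p + 1);
           I\<^sub>2 = Poly_Mapping.single 3 p;
           J\<^sub>2 = Poly_Mapping.single 1 (p\<^sup>2 - 1) + Poly_Mapping.single 2 2
       in (\<exists>r. subduction_relation bs I\<^sub>1 J\<^sub>1 r)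
        \<and> (\<exists>s. subduction_relation bs I\<^sub>2 J\<^sub>2 s)
        \<and> (\<forall>r s. subduction_relation bs I\<^sub>1 J\<^sub>1 r \<longrightarrow> subduction_relation bs I\<^sub>2 J\<^sub>2 s \<longrightarrow>
             ci_presentation (invariant_ring p M) bs [r, s]))"
proof -
  interpret family_matrix p M using assms by unfold_locales
  let ?bs = "[xv, f1_hat p M, h2 p M, h3 p M, orbit_prod p M zv]"
  interpret S: lead_generated p ?bs "invariant_ring p M" by (rule generators)
  let ?I1 = "sgl 2 p :: nat mon" and ?J1 = "sgl 1 (p + 1) :: nat mon"
  let ?I2 = "sgl 3 p :: nat mon" and ?J2 = "sgl 1 (p\<^sup>2 - 1) + sgl 2 2 :: nat mon"
  have supp: "supp5 ?I1" "supp5 ?J1" "supp5 ?I2" "supp5 ?J2"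
    by (auto simp: mons_add_mon split: if_splits)
  have Lam1: "Lam p ?I1 = Lam p ?J1"
    by (simp add: Lam_def lookup_single algebra_simps power2_eq_square)
  have Lam2: "Lam p ?I2 = Lam p ?J2"
  proof -
    have e1: "p\<^sup>2 * (p\<^sup>2 - 1) = p\<^sup>2 * p\<^sup>2 - p\<^sup>2" by (simp only: diff_mult_distrib2 mult_1_right)
    have e2: "(p ^ 3 + p + 2) * p = p\<^sup>2 * p\<^sup>2 + p\<^sup>2 + 2 * p"
      by (simp add: algebra_simps power2_eq_square power3_eq_cube)
    have "(p ^ 3 + p + 2) * p = p\<^sup>2 * (p\<^sup>2 - 1) + (p\<^sup>2 + p) * 2"
      unfolding e1 e2 using le_square[of "p\<^sup>2"] by simp
    then show ?thesis by (simp add: Lam_def lookup_single)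
  qed
  have tl1: "tless p ?J1 ?I1"
    unfolding tless_def Lam1 using assms(2) by (simp add: lookup_single)
  have tl2: "tless p ?J2 ?I2"
    unfolding tless_def Lam2 using assms(2) by (simp add: lookup_single)
  have ex1: "\<exists>r. subduction_relation ?bs ?I1 ?J1 r"
    by (rule S.subduction_relation_exists[OF supp(1,2) Lam1])
  have ex2: "\<exists>s. subduction_relation ?bs ?I2 ?J2 s"
    by (rule S.subduction_relation_exists[OF supp(3,4) Lam2])
  have ci: "ci_presentation (invariant_ring p M) ?bs [r, s]"
    if "subduction_relation ?bs ?I1 ?J1 r" "subduction_relation ?bs ?I2 ?J2 s" for r s
    using S.presentation S.subduction_relation_lead[OF that(1) tl1 Lam1]
      S.subduction_relation_lead[OF that(2) tl2 Lam2] by blast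
  have "complete_intersection (invariant_ring p M)"
    unfolding complete_intersection_def using ex1 ex2 ci by blast
  moreover have "sagbi_basis (set ?bs) (invariant_ring p M)" by (rule S.sagbi)
  ultimately show ?thesis
    unfolding Let_def using ex1 ex2 ci by simp
qed

end
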